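(* Let $n > 0$ be an integer and let $S_{\Delta_n,k}$ be the Schoenberg operator of degree $k$ with respect to the extended knot sequence $\Delta_n$. The eigenvalues of $S_{\Delta_n,k}$ are characterized by $$1 = \lambda_0 = \lambda_1 > \lambda_2 > \cdots > \lambda_{n+k-1} > \lambda_{n+k} = 0.$$ Thus, besides $0$ and $1$, the Schoenberg operator has $n+k-1$ distinct positive real eigenvalues.
   Context: Let $\Delta_n = \{x_j\}_{j=-k}^{n+k}$ be a knot sequence with $0 = x_{-k} = \cdots = x_0 < x_1 < \cdots < x_n = \cdots = x_{n+k} = 1$. For $j \in \{-k,\dots,n-1\}$ the Greville nodes are $\xi_{j,k} := \frac{x_{j+1} + \cdots + x_{j+k}}{k}$ and the normalized B-splines are $N_{j,k}(x) := (x_{j+k+1} - x_j)\,[x_j,\dots,x_{j+k+1}](\cdot - x)_+^k$ for $x\in[0,1]$ (with the value at $x=1$ taken by continuity from the left), where $[x_j,\dots,x_{j+k+1}]$ denotes the divided difference and $(\cdot)_+^k$ the truncated power. The Schoenberg operator $S_{\Delta_n,k} : C([0,1]) \to C([0,1])$ is $S_{\Delta_n,k} f := \sum_{j=-k}^{n-1} f(\xi_{j,k})\, N_{j,k}$.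
   Formalization: The degree is taken as k ≥ 1 (Greville nodes are undefined for k = 0), and k = 1 with n ≥ 2 is excluded since S is then a projection with eigenvalues 0 and 1 only; the n+k−1 distinct positive eigenvalues include 1, as the displayed chain leaves only n+k−2 besides 0 and 1. *)

theory Defs
  imports "HOL-Analysis.Analysis" "HOL-Library.Function_Algebras"
begin

text \<open>Knots are indexed by integers; only the values at indices \<open>-k, \<dots>, n + k\<close> matter.\<close>

definition knot_sequence :: "nat \<Rightarrow> nat \<Rightarrow> (int \<Rightarrow> real) \<Rightarrow> bool" where
  "knot_sequence n k x \<longleftrightarrow>
     (\<forall>j\<in>{- int k..0}. x j = 0) \<and>
     strict_mono_on {0..int n} x \<and>
     (\<forall>j\<in>{int n..int n + int k}. x j = 1)"

definition greville :: "nat \<Rightarrow> (int \<Rightarrow> real) \<Rightarrow> int \<Rightarrow> real" where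
  "greville k x j = (\<Sum>i = j + 1..j + int k. x i) / real k"

text \<open>The truncated power \<open>u\<^sub>+^m\<close>, with the convention \<open>0\<^sub>+^0 = 0\<close>.\<close>

definition trunc_power :: "nat \<Rightarrow> real \<Rightarrow> real" where
  "trunc_power m u = (if 0 < u then u ^ m else 0)"

definition left_deriv :: "(real \<Rightarrow> real) \<Rightarrow> real \<Rightarrow> real" where
  "left_deriv f t = vector_derivative f (at_left t)"

text \<open>\<open>divdiff f x i r\<close> is the divided difference \<open>[x i, \<dots>, x (i + r)] f\<close> for nodes that are
  nondecreasing in the index. Where \<open>r + 1\<close> nodes coincide it is the \<open>r\<close>-th derivative divided
  by \<open>r!\<close>. Derivatives are taken from the left: this changes nothing where \<open>f\<close> is
  sufficiently often differentiable, and for \<open>f = (\<cdot> - t)\<^sub>+^k\<close> at \<open>t\<close> it gives the \<open>k\<close>-th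
  derivative the value \<open>k! 0\<^sub>+^0 = 0\<close>. That value is needed at the \<open>(k + 1)\<close>-fold knot \<open>0\<close>,
  and it is the one for which the B-splines are continuous from the right.\<close>

fun divdiff :: "(real \<Rightarrow> real) \<Rightarrow> (int \<Rightarrow> real) \<Rightarrow> int \<Rightarrow> nat \<Rightarrow> real" where
  "divdiff f x i 0 = f (x i)"
| "divdiff f x i (Suc r) =
     (if x i = x (i + int (Suc r))
      then (left_deriv ^^ Suc r) f (x i) / fact (Suc r)
      else (divdiff f x (i + 1) r - divdiff f x i r) / (x (i + int (Suc r)) - x i))"

definition bspline_formula :: "nat \<Rightarrow> (int \<Rightarrow> real) \<Rightarrow> int \<Rightarrow> real \<Rightarrow> real" where
  "bspline_formula k x j t =
     (x (j + int k + 1) - x j) * divdiff (\<lambda>s. trunc_power k (s - t)) x j (k + 1)"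

definition bspline :: "nat \<Rightarrow> (int \<Rightarrow> real) \<Rightarrow> int \<Rightarrow> real \<Rightarrow> real" where
  "bspline k x j t =
     (if t = 1 then Lim (at_left 1) (bspline_formula k x j) else bspline_formula k x j t)"

text \<open>The space \<open>C([0,1])\<close>, over the real or the complex scalars. To make functions with equal
  values on \<open>[0,1]\<close> equal, they are extended by \<open>0\<close> outside of \<open>[0,1]\<close>.\<close>

definition C01 :: "(real \<Rightarrow> 'a::real_normed_field) set" where
  "C01 = {f. continuous_on {0..1} f \<and> (\<forall>t. t \<notin> {0..1} \<longrightarrow> f t = 0)}"

definition schoenberg ::
  "nat \<Rightarrow> nat \<Rightarrow> (int \<Rightarrow> real) \<Rightarrow> (real \<Rightarrow> 'a::real_normed_field) \<Rightarrow> real \<Rightarrow> 'a" where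
  "schoenberg n k x f t =
     (if t \<in> {0..1}
      then \<Sum>j = - int k..int n - 1. f (greville k x j) * of_real (bspline k x j t)
      else 0)"

definition eigenspace ::
  "((real \<Rightarrow> 'a::real_normed_field) \<Rightarrow> real \<Rightarrow> 'a) \<Rightarrow> 'a \<Rightarrow> (real \<Rightarrow> 'a) set" where
  "eigenspace T \<mu> = {f \<in> C01. T f = (\<lambda>t. \<mu> * f t)}"

definition eigenvalues ::
  "((real \<Rightarrow> 'a::real_normed_field) \<Rightarrow> real \<Rightarrow> 'a) \<Rightarrow> 'a set" where
  "eigenvalues T = {\<mu>. \<exists>f \<in> eigenspace T \<mu>. f \<noteq> (\<lambda>_. 0)}"

interpretation fun_space: vector_space "\<lambda>(c::'a::field) (f::'b \<Rightarrow> 'a) t. c * f t"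
  by unfold_locales (auto simp: fun_eq_iff algebra_simps)

end

theory Submission
  imports Defs "Jordan_Normal_Form.Char_Poly"
begin

text \<open>The nonzero spectrum of \<open>S\<close> is that of the collocation matrix \<open>N\<^sub>j(\<xi>\<^sub>i)\<close>. Its first and last
  rows are unit vectors, which gives the eigenvalue \<open>1\<close> twice; what remains is the matrix \<open>B\<close> of
  the interior indices. Inserting the nodes \<open>\<xi>\<^sub>i\<close> as knots until each has multiplicity \<open>k\<close> replaces
  spline coefficients by nonnegative combinations of neighbours. Hence neither \<open>B\<close> nor its
  transpose lengthens the alternating sign patterns of vectors, and \<open>det B > 0\<close> by expanding the
  determinant along the insertions.

  Perturbing an eigenvector of such a matrix shows that its first entry is nonzero. This excludes
  non-real eigenvalues, because a rotation plane contains a vector with vanishing first entry. As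
  it also applies to \<open>B\<close> with the first column rescaled, all these matrices are real-rooted, and
  the first entries of the left and right eigenvectors being nonzero, a multiple eigenvalue would
  become non-real under a small rescaling. Finally, the eigenvalues of \<open>B\<close> are less than \<open>1\<close> by the
  maximum principle.\<close>

section \<open>Matrices that do not increase sign alternations\<close>

text \<open>Refinement stops at multiplicity \<open>k\<close> because at a \<open>k\<close>-fold
  knot exactly one B-spline of degree \<open>k\<close> is nonzero. Evaluation there reads off one
  coefficient up to a positive factor, so on fully refined knots each claim concerns a matrix with
  at most one nonzero entry per row and column. Boehm's insertion formula carries the claim back to
  the given knots, in the manner of Lane and Riesenfeld. The determinant serves injectivity of
  \<open>B\<close>, that is, it excludes the eigenvalue 0. Counting sign changes alone could not
  exclude negative eigenvalues, so alternations also remember their starting sign. Positive entries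
  on and next to the diagonal turn weak sign diminution into strict statements about leading zeros.
  For this the Greville nodes must lie strictly inside neighbouring supports. For
  \<open>k = 1\<close> the nodes are themselves knots, the operator is piecewise linear
  interpolation and \<open>B\<close> is the identity; hence the assumption
  \<open>k = 1 \<longrightarrow> n = 1\<close>, under which \<open>k = 1\<close> leaves no interior
  node.\<close>

fun alternating_signs :: "('a \<Rightarrow> real) \<Rightarrow> real \<Rightarrow> 'a list \<Rightarrow> bool" where
  "alternating_signs f s [] \<longleftrightarrow> True"
| "alternating_signs f s (x # xs) \<longleftrightarrow> 0 < s * f x \<and> alternating_signs f (- s) xs"

text \<open>The sign \<open>s\<close> of the first entry is recorded because the number of sign
  changes does not distinguish a vector from its negative.\<close>

definition alternation :: "('a::linorder \<Rightarrow> real) \<Rightarrow> 'a set \<Rightarrow> real \<Rightarrow> nat \<Rightarrow> bool" where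
  "alternation f I s p \<longleftrightarrow>
     (\<exists>xs. length xs = p \<and> set xs \<subseteq> I \<and> sorted_wrt (<) xs \<and> alternating_signs f s xs)"

lemma alternating_signs_nonzero: "alternating_signs f s xs \<Longrightarrow> x \<in> set xs \<Longrightarrow> f x \<noteq> 0"
  by (induction f s xs rule: alternating_signs.induct) auto

lemma alternating_signs_map:
  assumes "\<And>x. x \<in> set xs \<Longrightarrow> f x \<noteq> 0 \<Longrightarrow> 0 < f x * g (h x)" "alternating_signs f s xs"
  shows "alternating_signs g s (map h xs)"
  using assms
proof (induction f s xs rule: alternating_signs.induct)
  case (2 f s x xs)
  have "f x \<noteq> 0" using 2 by auto
  then have "0 < f x * g (h x)" using 2 by auto
  moreover have "0 < s * f x" using 2 by auto
  ultimately have "0 < s * g (h x)" by (auto simp: zero_less_mult_iff)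
  then show ?case using 2 by auto
qed simp

text \<open>Neighbouring entries of an alternation have opposite signs, so their partners differ; a
  weakly monotone relation therefore already yields strictly increasing partners. The
  sign-diminishing claims below all reduce to this.\<close>

lemma alternation_transport:
  assumes ex: "\<And>i. i \<in> I \<Longrightarrow> f i \<noteq> 0 \<Longrightarrow> \<exists>j\<in>J. 0 < f i * g j \<and> R i j"
    and R: "\<And>i i' j j'. i < i' \<Longrightarrow> R i j \<Longrightarrow> R i' j' \<Longrightarrow> j \<le> j'"
    and alt: "alternation f I s p"
  shows "alternation g J s p"
proof -
  obtain h where h: "\<And>i. i \<in> I \<Longrightarrow> f i \<noteq> 0 \<Longrightarrow> h i \<in> J \<and> 0 < f i * g (h i) \<and> R i (h i)"
    using ex by metis
  obtain xs where xs: "length xs = p" "set xs \<subseteq> I" "sorted_wrt (<) xs" "alternating_signs f s xs"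
    using alt by (auto simp: alternation_def)
  have "sorted_wrt (<) (map h xs)"
    using xs(2-4)
  proof (induction xs arbitrary: s rule: induct_list012)
    case (3 x y zs)
    have nz: "f x \<noteq> 0" "f y \<noteq> 0" "0 < s * f x" "0 < - s * f y" using 3 by auto
    then have "0 < f x * g (h x)" "0 < f y * g (h y)" using h 3 by auto
    with nz have "0 < s * g (h x)" "s * g (h y) < 0" 
      by (auto simp: zero_less_mult_iff mult_less_0_iff)
    then have "h x \<noteq> h y" by auto
    moreover have "h x \<le> h y"
      using 3 nz h[of x] h[of y] R[of x y "h x" "h y"] by auto
    ultimately show ?case using 3(2)[of "-s"] 3(3-) by (auto simp: sorted_wrt2)
  qed auto
  moreover have "alternating_signs g s (map h xs)"
    using h xs by (intro alternating_signs_map[of _ f]) auto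
  moreover have "set (map h xs) \<subseteq> J"
    using h xs alternating_signs_nonzero[OF xs(4)] by auto
  ultimately show ?thesis using xs(1) unfolding alternation_def by (metis length_map)
qed

lemma alternation_same_signs:
  assumes "alternation f I s p" "\<And>i. i \<in> I \<Longrightarrow> f i \<noteq> 0 \<Longrightarrow> 0 < f i * g i"
  shows "alternation g I s p"
  using assms(2) by (intro alternation_transport[OF _ _ assms(1), where R = "(=)"]) auto

lemma alternation_bounded:
  assumes "alternation f {..<N} s p"
  shows "p \<le> (N::nat)"
proof -
  obtain xs where xs: "length xs = p" "set xs \<subseteq> {..<N}" "sorted_wrt (<) xs"
    using assms by (auto simp: alternation_def)
  have "distinct xs" using xs(3) strict_sorted_iff by blast
  then have "p = card (set xs)" using xs distinct_card by metis
  also have "\<dots> \<le> card {..<N}" using xs by (intro card_mono) auto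
  finally show ?thesis by simp
qed

text \<open>The given list starts with sign \<open>s\<close>, and all such entries lie to the right
  of \<open>i\<close>, so \<open>i\<close> can be prepended.\<close>

lemma alternation_Cons:
  assumes "alternation f I s p" "i \<in> I" "0 < - s * f i"
    and "\<And>j. j \<in> I \<Longrightarrow> f j \<noteq> 0 \<Longrightarrow> 0 < s * f j \<Longrightarrow> i < j"
  shows "alternation f I (- s) (Suc p)"
proof -
  obtain xs where xs: "length xs = p" "set xs \<subseteq> I" "sorted_wrt (<) xs" "alternating_signs f s xs"
    using assms by (auto simp: alternation_def)
  have "sorted_wrt (<) (i # xs)"
  proof (cases xs)
    case (Cons y ys)
    have "f y \<noteq> 0" using xs(4) Cons by auto
    then have "i < y" using xs Cons assms(4)[of y] by auto
    then show ?thesis using xs(3) Cons by (auto simp: sorted_wrt2)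
  qed auto
  then show ?thesis using xs assms unfolding alternation_def
    by (intro exI[of _ "i # xs"]) auto
qed

section \<open>Sign-diminishing matrices and the leading zeros of their orbits\<close>

definition lin :: "nat \<Rightarrow> (nat \<Rightarrow> nat \<Rightarrow> real) \<Rightarrow> (nat \<Rightarrow> real) \<Rightarrow> nat \<Rightarrow> real" where
  "lin N b v i = (\<Sum>j<N. b i j * v j)"

text \<open>Modelled on the oscillatory matrices of Gantmacher and Krein, with sign diminution in
  place of total nonnegativity. Only the superdiagonal is required to be positive; the subdiagonal
  is the superdiagonal of the transpose. The last clause is injectivity.\<close>

definition oscillating :: "nat \<Rightarrow> (nat \<Rightarrow> nat \<Rightarrow> real) \<Rightarrow> bool" where
  "oscillating N b \<longleftrightarrow>
     (\<forall>v s p. alternation (lin N b v) {..<N} s p \<longrightarrow> alternation v {..<N} s p) \<and>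
     (\<forall>i<N. 0 < b i i) \<and> (\<forall>i. Suc i < N \<longrightarrow> 0 < b i (Suc i)) \<and>
     (\<forall>v. (\<forall>i<N. lin N b v i = 0) \<longrightarrow> (\<forall>i<N. v i = 0))"

text \<open>Perturbing \<open>v\<close> in its first nonzero coordinate keeps the signs of \<open>v\<close> but can give the
  image one sign change more, unless the image starts with fewer zeros than \<open>v\<close>.\<close>

lemma fewer_leading_zeros:
  assumes osc: "oscillating N b"
    and z: "\<And>i. i < N \<Longrightarrow> lin N b v i = z i"
    and alt: "\<And>s p. alternation v {..<N} s p \<longleftrightarrow> alternation z {..<N} s p"
    and t: "t < N" "z t \<noteq> 0" "\<And>i. i < t \<Longrightarrow> z i = 0" "0 < t"
    and r: "r < N" "v r \<noteq> 0" "\<And>i. i < r \<Longrightarrow> v i = 0"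
  shows "t < r"
proof (rule ccontr)
  assume "\<not> t < r"
  \<comment> \<open>For \<open>r = 0\<close> truncated subtraction gives \<open>i = 0\<close> and
    \<open>b i r\<close> is a diagonal entry; otherwise it lies on the superdiagonal. In both cases
    row \<open>i\<close> comes before \<open>t\<close>, so \<open>z i = 0\<close>.\<close>
  define i where "i = r - 1"
  have i: "i < t" "i < N" "0 < b i r"
  proof -
    show "i < t" "i < N" using t \<open>\<not> t < r\<close> by (auto simp: i_def)
    show "0 < b i r"
    proof (cases r)
      case 0
      then show ?thesis using osc r by (auto simp: oscillating_def i_def)
    next
      case (Suc q)
      then show ?thesis using osc r by (auto simp: oscillating_def i_def)
    qed
  qed
  define \<tau> where "\<tau> = sgn (z t)"
  have tau: "\<tau> \<noteq> 0" "0 < \<tau> * z t" "\<bar>\<tau>\<bar> = 1" using t by (auto simp: \<tau>_def sgn_if)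
  have ev: "\<forall>\<^sub>F h in at_right (0::real). \<bar>h * b l r\<bar> < \<bar>z l\<bar>" if "z l \<noteq> 0" for l
  proof -
    have "((\<lambda>h. \<bar>h * b l r\<bar>) \<longlongrightarrow> \<bar>0 * b l r\<bar>) (at_right 0)" by (intro tendsto_intros)
    then show ?thesis using that order_tendstoD(2)[of _ "\<bar>0 * b l r\<bar>" _ "\<bar>z l\<bar>"] by simp
  qed
  have "\<forall>\<^sub>F h in at_right (0::real). \<forall>l\<in>{l\<in>{..<N}. z l \<noteq> 0}. \<bar>h * b l r\<bar> < \<bar>z l\<bar>"
    by (rule eventually_ball_finite) (auto intro: ev)
  moreover have "\<forall>\<^sub>F h in at_right (0::real). h < \<bar>v r\<bar>"
    using r eventually_at_right_less[of 0] 
    by (intro order_tendstoD(2)[of _ 0] tendsto_ident_at) auto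
  moreover have "\<forall>\<^sub>F h in at_right (0::real). 0 < h" by (rule eventually_at_right_less)
  ultimately have "\<forall>\<^sub>F h in at_right (0::real). (\<forall>l\<in>{l\<in>{..<N}. z l \<noteq> 0}. \<bar>h * b l r\<bar> < \<bar>z l\<bar>) \<and> h < \<bar>v r\<bar> \<and> 0 < h"
    by eventually_elim auto
  then obtain h where h: "\<And>l. l < N \<Longrightarrow> z l \<noteq> 0 \<Longrightarrow> \<bar>h * b l r\<bar> < \<bar>z l\<bar>" "h < \<bar>v r\<bar>" "0 < h"
    by (auto dest!: eventually_happens simp: trivial_limit_at_right_real)
  \<comment> \<open>This moves the image at \<open>i\<close> from 0 to the sign opposite to
    \<open>z t\<close>, while \<open>h\<close> is small enough to preserve the sign of
    \<open>v r\<close> and of every nonzero entry of \<open>z\<close>.\<close>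
  define v' where "v' = v(r := v r - \<tau> * h)"
  have lin': "lin N b v' l = z l - \<tau> * h * b l r" if "l < N" for l
  proof -
    have "lin N b v' l = (\<Sum>j<N. b l j * v j - (if j = r then \<tau> * h * b l r else 0))"
      unfolding lin_def v'_def by (intro sum.cong) (auto simp: algebra_simps)
    also have "\<dots> = lin N b v l - \<tau> * h * b l r"
      using r by (simp add: lin_def sum_subtractf)
    finally show ?thesis using z that by simp
  qed
  define P where "P p \<longleftrightarrow> alternation z {..<N} \<tau> p" for p
  have "P 1" using t tau unfolding P_def alternation_def by (intro exI[of _ "[t]"]) auto
  moreover have "\<forall>q. P q \<longrightarrow> q \<le> N" using alternation_bounded by (auto simp: P_def)
  ultimately obtain p where p: "P p" "\<And>q. P q \<Longrightarrow> q \<le> p"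
    using GreatestI_nat[of P 1 N] Greatest_le_nat[of P _ N] by blast
  have same: "0 < z l * lin N b v' l" if "l < N" "z l \<noteq> 0" for l
  proof -
    have "\<bar>\<tau> * h * b l r\<bar> < \<bar>z l\<bar>" using h(1)[OF that] tau by (simp add: abs_mult)
    then show ?thesis using lin'[OF that(1)] 
      by (auto simp: zero_less_mult_iff abs_if split: if_splits)
  qed
  \<comment> \<open>The perturbation may turn further zeros of \<open>z\<close> into nonzero
    entries, possibly left of \<open>i\<close>. They are masked, so that every remaining entry with
    the sign of \<open>\<tau>\<close> lies at \<open>t\<close> or later.\<close>
  define z' where "z' = (\<lambda>l. if l = i \<or> z l \<noteq> 0 then lin N b v' l else 0)"
  have zi: "z i = 0" using t(3) i by auto
  have "alternation z' {..<N} \<tau> p"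
    using p(1) unfolding P_def
    by (rule alternation_same_signs) (use same zi in \<open>auto simp: z'_def\<close>)
  then have "alternation z' {..<N} (- \<tau>) (Suc p)"
  proof (rule alternation_Cons[of _ _ \<tau> _ i])
    have "- \<tau> * z' i = (\<tau>*\<tau>) * (h * b i r)" using lin'[of i] i zi by (simp add: z'_def)
    also have "\<dots> > 0" using tau(3) abs_mult_self_eq[of \<tau>] h(3) i(3) by simp
    finally show "0 < - \<tau> * z' i" .
    fix j assume j: "j \<in> {..<N}" "z' j \<noteq> 0" "0 < \<tau> * z' j"
    then have "j \<noteq> i" using \<open>0 < - \<tau> * z' i\<close> by auto
    then have "z j \<noteq> 0" using j by (auto simp: z'_def split: if_splits)
    then show "i < j" using t(3)[of j] i by (meson leI order.strict_trans1)
  qed (use i in auto)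
  then have "alternation (lin N b v') {..<N} (- \<tau>) (Suc p)"
    by (rule alternation_same_signs) (auto simp: z'_def zero_less_mult_iff split: if_splits)
  then have "alternation v' {..<N} (- \<tau>) (Suc p)"
    using osc by (auto simp: oscillating_def)
  then have "alternation v {..<N} (- \<tau>) (Suc p)"
  proof (rule alternation_same_signs)
    fix j assume "v' j \<noteq> 0"
    show "0 < v' j * v j"
    proof (cases "j = r")
      case True
      have "\<bar>\<tau> * h\<bar> < \<bar>v r\<bar>" using h tau by (simp add: abs_mult)
      then show ?thesis using True
        by (auto simp: v'_def zero_less_mult_iff abs_if split: if_splits)
    qed (use \<open>v' j \<noteq> 0\<close> in \<open>auto simp: v'_def zero_less_mult_iff\<close>)
  qed
  then have "alternation z {..<N} (- \<tau>) (Suc p)" using alt by simp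
  \<comment> \<open>All entries of \<open>z\<close> with sign opposite to \<open>\<tau>\<close> come
    after \<open>t\<close>. Prepending \<open>t\<close> gives an alternation with two entries more
    than the maximum \<open>p\<close>.\<close>
  then have "alternation z {..<N} (- (- \<tau>)) (Suc (Suc p))"
  proof (rule alternation_Cons[of _ _ "- \<tau>" _ t])
    fix j assume "j \<in> {..<N}" "z j \<noteq> 0" "0 < - \<tau> * z j"
    then have "j \<noteq> t" "\<not> j < t" using tau t(3) by auto
    then show "t < j" by auto
  qed (use t tau in auto)
  then show False using p(2)[of "Suc (Suc p)"] by (auto simp: P_def)
qed

text \<open>If \<open>z 0 = 0\<close>, passing repeatedly to preimages within \<open>Z\<close> gains
  at least one leading zero each time, until a zero vector is reached. In the applications
  \<open>Z\<close> is the ray of an eigenvector or a punctured plane on which the matrix acts as a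
  scaled rotation.\<close>

lemma nonzero_first_coordinate:
  assumes osc: "oscillating N b"
    and pre: "\<And>z. z \<in> Z \<Longrightarrow> \<exists>v\<in>Z. (\<forall>i<N. lin N b v i = z i) \<and>
                 (\<forall>s p. alternation v {..<N} s p \<longleftrightarrow> alternation z {..<N} s p)"
    and nz: "\<And>z. z \<in> Z \<Longrightarrow> \<exists>i<N. z i \<noteq> 0"
    and "z \<in> Z"
  shows "z 0 \<noteq> 0"
proof
  assume "z 0 = 0"
  have "\<exists>w\<in>Z. \<forall>i\<le>r. i < N \<longrightarrow> w i = 0" for r
  proof (induction r)
    case 0
    then show ?case using \<open>z \<in> Z\<close> \<open>z 0 = 0\<close> by auto
  next
    case (Suc r)
    then obtain w where w: "w \<in> Z" "\<forall>i\<le>r. i < N \<longrightarrow> w i = 0" by blast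
    then obtain v where v: "v \<in> Z" "\<And>i. i < N \<Longrightarrow> lin N b v i = w i"
      "\<And>s p. alternation v {..<N} s p \<longleftrightarrow> alternation w {..<N} s p" using pre by metis
    define t where "t = (LEAST i. i < N \<and> w i \<noteq> 0)"
    define q where "q = (LEAST i. i < N \<and> v i \<noteq> 0)"
    have t: "t < N \<and> w t \<noteq> 0" "\<And>i. i < t \<Longrightarrow> i < N \<Longrightarrow> w i = 0"
      using LeastI_ex[OF nz[OF w(1)]] not_less_Least[of _ "\<lambda>i. i < N \<and> w i \<noteq> 0"]
      unfolding t_def by blast+
    have q: "q < N \<and> v q \<noteq> 0" "\<And>i. i < q \<Longrightarrow> i < N \<Longrightarrow> v i = 0"
      using LeastI_ex[OF nz[OF v(1)]] not_less_Least[of _ "\<lambda>i. i < N \<and> v i \<noteq> 0"]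
      unfolding q_def by blast+
    have "r < t" using t w by (meson not_le)
    have "t < q"
      by (rule fewer_leading_zeros[OF osc v(2,3)]) (use t q \<open>r < t\<close> in auto)
    then show ?case using q \<open>r < t\<close> v(1) by (intro bexI[of _ v]) auto
  qed
  from this[of N] obtain w where "w \<in> Z" "\<forall>i\<le>N. i < N \<longrightarrow> w i = 0" by blast
  then show False using nz[of w] by auto
qed

text \<open>For a negative eigenvalue the image has the signs of \<open>- u\<close>. A longest
  alternation starting with the first nonzero sign of \<open>u\<close> would then yield one of the
  same length with the opposite start, and the first nonzero entry could be prepended to it.\<close>

lemma oscillating_eigenvalue_pos:
  assumes osc: "oscillating N b" and ev: "\<And>i. i < N \<Longrightarrow> lin N b u i = \<mu> * u i"
    and "r < N" "u r \<noteq> 0"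
  shows "0 < \<mu>"
proof (rule ccontr)
  assume "\<not> 0 < \<mu>"
  have "\<mu> \<noteq> 0"
  proof
    assume "\<mu> = 0"
    then have "\<forall>i<N. lin N b u i = 0" using ev by auto
    then have "u r = 0" using osc \<open>r < N\<close> unfolding oscillating_def by blast
    then show False using \<open>u r \<noteq> 0\<close> by simp
  qed
  with \<open>\<not> 0 < \<mu>\<close> have neg: "\<mu> < 0" by auto
  define t where "t = (LEAST i. i < N \<and> u i \<noteq> 0)"
  have t: "t < N \<and> u t \<noteq> 0" "\<And>i. i < t \<Longrightarrow> i < N \<Longrightarrow> u i = 0"
    using LeastI[of "\<lambda>i. i < N \<and> u i \<noteq> 0" r] assms(3,4)
      not_less_Least[of _ "\<lambda>i. i < N \<and> u i \<noteq> 0"]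
    unfolding t_def by blast+
  define \<tau> where "\<tau> = sgn (u t)"
  have tau: "0 < \<tau> * u t" using t by (auto simp: \<tau>_def sgn_if)
  define P where "P p \<longleftrightarrow> alternation u {..<N} \<tau> p" for p
  have "P 1" using t tau unfolding P_def alternation_def by (intro exI[of _ "[t]"]) auto
  moreover have "\<forall>q. P q \<longrightarrow> q \<le> N" using alternation_bounded by (auto simp: P_def)
  ultimately obtain p where p: "P p" "\<And>q. P q \<Longrightarrow> q \<le> p"
    using GreatestI_nat[of P 1 N] Greatest_le_nat[of P _ N] by blast
  have flip: "alternating_signs (\<lambda>i. - u i) (- s) xs" if "alternating_signs u s xs" for s xs
    using that by (induction u s xs rule: alternating_signs.induct) auto
  have "alternation (\<lambda>i. - u i) {..<N} (- \<tau>) p"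
    using p(1) flip unfolding P_def alternation_def by blast
  then have "alternation (lin N b u) {..<N} (- \<tau>) p"
    by (rule alternation_same_signs) (use ev neg in \<open>auto simp: zero_less_mult_iff mult_less_0_iff\<close>)
  then have "alternation u {..<N} (- \<tau>) p" using osc by (auto simp: oscillating_def)
  then have "alternation u {..<N} (- (- \<tau>)) (Suc p)"
  proof (rule alternation_Cons[of _ _ "- \<tau>" _ t])
    fix j assume "j \<in> {..<N}" "u j \<noteq> 0" "0 < - \<tau> * u j"
    then have "j \<noteq> t" "\<not> j < t" using tau t(2) by auto
    then show "t < j" by auto
  qed (use t tau in auto)
  then show False using p(2)[of "Suc p"] by (auto simp: P_def)
qed

text \<open>The positive multiples of \<open>u\<close> form a set closed under preimages, since the
  eigenvalue is positive.\<close>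

lemma oscillating_eigenvector_first:
  assumes osc: "oscillating N b" and ev: "\<And>i. i < N \<Longrightarrow> lin N b u i = \<mu> * u i"
    and "r < N" "u r \<noteq> 0"
  shows "u 0 \<noteq> 0"
proof -
  have pos: "0 < \<mu>" by (rule oscillating_eigenvalue_pos[OF assms])
  define Z where "Z = {\<lambda>i. c * u i | c. 0 < c}"
  have "(\<lambda>i. 1 * u i) 0 \<noteq> 0"
  proof (rule nonzero_first_coordinate[OF osc])
    show "(\<lambda>i. 1 * u i) \<in> Z" unfolding Z_def by (intro CollectI exI[of _ 1]) auto
    fix z assume "z \<in> Z"
    then obtain c where c: "0 < c" "z = (\<lambda>i. c * u i)" by (auto simp: Z_def)
    show "\<exists>i<N. z i \<noteq> 0" using c assms(3,4) by auto
    define v where "v = (\<lambda>i. (c / \<mu>) * u i)"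
    have "v \<in> Z" using c pos unfolding Z_def v_def
      by (intro CollectI exI[of _ "c / \<mu>"]) auto
    moreover have "lin N b v i = z i" if "i < N" for i
    proof -
      have "lin N b v i = (c / \<mu>) * lin N b u i"
        by (simp add: lin_def v_def sum_distrib_left mult_ac)
      then show ?thesis using ev[OF that] pos c by simp
    qed
    moreover have "alternation v {..<N} s p \<longleftrightarrow> alternation z {..<N} s p" for s p
    proof
      assume "alternation v {..<N} s p"
      then show "alternation z {..<N} s p"
        by (rule alternation_same_signs)
          (use c pos in \<open>auto simp: v_def zero_less_mult_iff zero_less_divide_iff mult_less_0_iff\<close>)
    next
      assume "alternation z {..<N} s p"
      then show "alternation v {..<N} s p"
        by (rule alternation_same_signs)
          (use c pos in \<open>auto simp: v_def zero_less_mult_iff zero_less_divide_iff mult_less_0_iff\<close>)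
    qed
    ultimately show "\<exists>v\<in>Z. (\<forall>i<N. lin N b v i = z i) \<and>
                 (\<forall>s p. alternation v {..<N} s p \<longleftrightarrow> alternation z {..<N} s p)" by blast
  qed
  then show ?thesis by simp
qed

text \<open>By compactness of the circle two powers of \<open>w\<close> are arbitrarily close; their
  quotient is a power close to 1.\<close>

lemma unit_power_near_one:
  assumes "cmod w = 1" "0 < e"
  shows "\<exists>m>0. cmod (w ^ m - 1) < e"
proof -
  have "bounded (range (\<lambda>m. w ^ m))"
    using assms by (intro boundedI[of _ 1]) (auto simp: norm_power)
  then obtain l r where r: "strict_mono r" "((\<lambda>m. w ^ m) \<circ> r) \<longlonglongrightarrow> l"
    using bounded_imp_convergent_subsequence by blast
  then have "Cauchy (\<lambda>m. w ^ r m)" by (auto intro: LIMSEQ_imp_Cauchy simp: o_def)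
  then obtain M where M: "\<And>m n. m \<ge> M \<Longrightarrow> n \<ge> M \<Longrightarrow> norm (w ^ r m - w ^ r n) < e"
    using assms(2) by (meson CauchyD)
  have lt: "r M < r (Suc M)" using r by (simp add: strict_mono_less)
  have "w ^ r (Suc M) - w ^ r M = w ^ r M * (w ^ (r (Suc M) - r M) - 1)"
    using lt by (simp add: algebra_simps flip: power_add)
  then have "norm (w ^ r (Suc M) - w ^ r M) = norm (w ^ (r (Suc M) - r M) - 1)"
    using assms by (simp add: norm_mult norm_power)
  then show ?thesis using M[of "Suc M" M] lt by (intro exI[of _ "r (Suc M) - r M"]) auto
qed

text \<open>A non-real eigenvalue would act on a real plane as a rotation up to scaling. Rotations are
  recurrent, so the number of alternations is constant along its orbits; but the plane contains
  a nonzero vector with vanishing first coordinate.\<close>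

lemma oscillating_eigenvalue_real:
  assumes osc: "oscillating N b"
    and ev: "\<And>i. i < N \<Longrightarrow> (\<Sum>j<N. complex_of_real (b i j) * u j) = \<mu> * u i"
    and "r < N" "u r \<noteq> 0"
  shows "\<mu> \<in> \<real>"
proof (rule ccontr)
  assume nr: "\<mu> \<notin> \<real>"
  then have l0: "\<mu> \<noteq> 0" by auto
  have im: "Im \<mu> \<noteq> 0" using nr complex_is_Real_iff by blast
  \<comment> \<open>The real plane spanned by the real and imaginary parts of \<open>u\<close>,
    parametrized so that the matrix acts as multiplication of \<open>\<zeta>\<close> by
    \<open>\<mu>\<close>.\<close>
  define z where "z = (\<lambda>\<zeta> i. Re (\<zeta> * u i))"
  have step: "lin N b (z \<zeta>) i = z (\<mu> * \<zeta>) i" if "i < N" for \<zeta> i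
  proof -
    have "lin N b (z \<zeta>) i = Re (\<zeta> * (\<Sum>j<N. complex_of_real (b i j) * u j))"
      unfolding lin_def z_def sum_distrib_left Re_sum
      by (intro sum.cong) (auto simp: algebra_simps)
    also have "\<dots> = z (\<mu> * \<zeta>) i" unfolding ev[OF that] z_def by (simp only: mult_ac)
    finally show ?thesis .
  qed
  have scale: "alternation (z (of_real c * \<zeta>)) {..<N} s p" if "alternation (z \<zeta>) {..<N} s p" "0 < c" for c \<zeta> s p
  proof -
    have "z (of_real c * \<zeta>) i = c * z \<zeta> i" for i by (simp add: z_def algebra_simps)
    then show ?thesis using that
      by (intro alternation_same_signs[OF that(1)]) (auto simp: zero_less_mult_iff mult_less_0_iff)
  qed
  define w where "w = \<mu> / of_real (cmod \<mu>)"
  have w: "cmod w = 1" "\<mu> = of_real (cmod \<mu>) * w" using l0 by (auto simp: w_def norm_divide)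
  have down: "alternation (z \<zeta>) {..<N} s p" if "alternation (z (w * \<zeta>)) {..<N} s p" for \<zeta> s p
  proof -
    have "alternation (z (of_real (cmod \<mu>) * (w * \<zeta>))) {..<N} s p"
      using scale[OF that] l0 by simp
    then have "alternation (z (\<mu> * \<zeta>)) {..<N} s p" using w(2) by (metis mult.assoc)
    then have "alternation (lin N b (z \<zeta>)) {..<N} s p"
      by (rule alternation_same_signs) (use step in \<open>auto simp: zero_less_mult_iff\<close>)
    then show ?thesis using osc by (auto simp: oscillating_def)
  qed
  have down_power: "alternation (z \<zeta>) {..<N} s p" if "alternation (z (w ^ m * \<zeta>)) {..<N} s p" for \<zeta> s p m
    using that by (induction m) (auto simp: mult.assoc intro: down)
  \<comment> \<open>Recurrence reverses \<open>down\<close>: when \<open>w ^ m\<close> is close to 1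
    no nonzero entry changes sign, and \<open>m - 1\<close> applications of \<open>down\<close> lead
    from \<open>w ^ m * \<zeta>\<close> back to \<open>w * \<zeta>\<close>.\<close>
  have up: "alternation (z (w * \<zeta>)) {..<N} s p" if "alternation (z \<zeta>) {..<N} s p" for \<zeta> s p
  proof -
    have "\<exists>e>0. \<forall>y. cmod (y - 1) < e \<longrightarrow> 0 < z \<zeta> i * z (y * \<zeta>) i" if "z \<zeta> i \<noteq> 0" for i
    proof -
      have "((\<lambda>y. z \<zeta> i * z (y * \<zeta>) i) \<longlongrightarrow> z \<zeta> i * z (1 * \<zeta>) i) (nhds 1)"
        unfolding z_def by (intro tendsto_intros filterlim_ident)
      moreover have "0 < z \<zeta> i * z (1 * \<zeta>) i" using that by (auto simp: zero_less_mult_iff)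
      ultimately have "\<forall>\<^sub>F y in nhds 1. 0 < z \<zeta> i * z (y * \<zeta>) i" by (rule order_tendstoD(1))
      then show ?thesis by (auto simp: eventually_nhds_metric dist_norm)
    qed
    then obtain e where e: "\<And>i. z \<zeta> i \<noteq> 0 \<Longrightarrow> 0 < e i \<and> (\<forall>y. cmod (y - 1) < e i \<longrightarrow> 0 < z \<zeta> i * z (y * \<zeta>) i)"
      by metis
    define d where "d = Min (insert 1 (e ` {i\<in>{..<N}. z \<zeta> i \<noteq> 0}))"
    have "0 < d" unfolding d_def using e by (subst Min_gr_iff) auto
    then obtain m where m: "m > 0" "cmod (w ^ m - 1) < d" using unit_power_near_one w by blast
    have "alternation (z (w ^ m * \<zeta>)) {..<N} s p"
    proof (rule alternation_same_signs[OF that])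
      fix i assume i: "i \<in> {..<N}" "z \<zeta> i \<noteq> 0"
      then have "d \<le> e i" unfolding d_def by (intro Min_le) auto
      then show "0 < z \<zeta> i * z (w ^ m * \<zeta>) i" using e[OF i(2)] m by auto
    qed
    then have "alternation (z (w ^ (m - 1) * (w * \<zeta>))) {..<N} s p"
      using m(1) by (simp add: mult.assoc[symmetric] flip: power_Suc2)
    then show ?thesis by (rule down_power)
  qed
  have nz: "\<exists>i<N. z \<zeta> i \<noteq> 0" if "\<zeta> \<noteq> 0" for \<zeta>
  proof (rule ccontr)
    assume "\<not> ?thesis"
    then have 0: "z \<zeta> i = 0" if "i < N" for i using that by auto
    have "z (\<mu> * \<zeta>) r = lin N b (z \<zeta>) r" using step \<open>r < N\<close> by simp
    also have "\<dots> = 0" unfolding lin_def using 0 by simp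
    finally have "Re (\<mu> * (\<zeta> * u r)) = 0" unfolding z_def by (simp only: mult_ac)
    moreover have re0: "Re (\<zeta> * u r) = 0" using 0 \<open>r < N\<close> by (simp add: z_def)
    ultimately have "Im \<mu> * Im (\<zeta> * u r) = 0"
      by (simp add: algebra_simps)
    then have "\<zeta> * u r = 0" using re0 im by (simp add: complex_eq_iff)
    then show False using that \<open>u r \<noteq> 0\<close> by simp
  qed
  have first: "z \<zeta> 0 \<noteq> 0" if "\<zeta> \<noteq> 0" for \<zeta>
  proof (rule nonzero_first_coordinate[OF osc, where Z = "{z \<zeta> | \<zeta>. \<zeta> \<noteq> 0}"])
    fix v assume "v \<in> {z \<zeta> | \<zeta>. \<zeta> \<noteq> 0}"
    then obtain \<eta> where \<eta>: "\<eta> \<noteq> 0" "v = z \<eta>" by auto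
    show "\<exists>i<N. v i \<noteq> 0" using nz \<eta> by auto
    have "alternation (z (\<eta> / \<mu>)) {..<N} s p \<longleftrightarrow> alternation (z \<eta>) {..<N} s p" for s p
    proof
      assume "alternation (z (\<eta> / \<mu>)) {..<N} s p"
      then have "alternation (z (of_real (cmod \<mu>) * (w * (\<eta> / \<mu>)))) {..<N} s p" using up scale l0 by (simp del: times_divide_eq_right)
      then show "alternation (z \<eta>) {..<N} s p" using l0 by (simp add: w_def)
    next
      assume "alternation (z \<eta>) {..<N} s p"
      then have "alternation (z (of_real (inverse (cmod \<mu>)) * \<eta>)) {..<N} s p" using scale l0 
        by (simp del: of_real_inverse)
      moreover have "of_real (inverse (cmod \<mu>)) * \<eta> = w * (\<eta> / \<mu>)" using l0 
        by (simp add: w_def field_simps)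
      ultimately show "alternation (z (\<eta> / \<mu>)) {..<N} s p" using down by (simp del: times_divide_eq_right)
    qed
    moreover have "\<forall>i<N. lin N b (z (\<eta> / \<mu>)) i = v i" using step \<eta> l0 by simp
    ultimately show "\<exists>v'\<in>{z \<zeta> | \<zeta>. \<zeta> \<noteq> 0}. (\<forall>i<N. lin N b v' i = v i) \<and>
       (\<forall>s p. alternation v' {..<N} s p \<longleftrightarrow> alternation v {..<N} s p)"
      using \<eta> l0 by (intro bexI[of _ "z (\<eta> / \<mu>)"]) auto
  qed (use that in auto)
  show False
  proof (cases "u 0 = 0")
    case True
    then show False using first[of 1] by (simp add: z_def)
  next
    case False
    \<comment> \<open>This choice makes \<open>\<zeta> * u 0\<close> purely imaginary, so the first
      coordinate of \<open>z \<zeta>\<close> vanishes.\<close>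
    then show False using first[of "\<i> * cnj (u 0)"] by (simp add: z_def)
  qed
qed

section \<open>B-splines and knot insertion\<close>

text \<open>\<open>mspline k y j\<close> is the B-spline on the knots \<open>y\<^sub>j, \<dots>, y\<^bsub>j+k+1\<^esub>\<close> divided by \<open>y\<^bsub>j+k+1\<^esub> - y\<^sub>j\<close>. In
  this normalization knot insertion also holds at coinciding knots, where \<open>mspline\<close> is \<open>0\<close>.\<close>

fun mspline :: "nat \<Rightarrow> (int \<Rightarrow> real) \<Rightarrow> int \<Rightarrow> real \<Rightarrow> real" where
  "mspline 0 y j t = (if y j \<le> t \<and> t < y (j + 1) then 1 / (y (j + 1) - y j) else 0)"
| "mspline (Suc k) y j t =
     (if y j < y (j + int k + 2)
      then ((t - y j) * mspline k y j t + (y (j + int k + 2) - t) * mspline k y (j + 1) t)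
             / (y (j + int k + 2) - y j)
      else 0)"

lemma mspline_support:
  assumes "mono y" "mspline k y j t \<noteq> 0"
  shows "y j \<le> t \<and> t < y (j + int k + 1)"
  using assms(2)
proof (induction k arbitrary: j)
  case 0
  then show ?case by (auto split: if_splits)
next
  case (Suc k)
  then have "mspline k y j t \<noteq> 0 \<or> mspline k y (j + 1) t \<noteq> 0" by (auto split: if_splits)
  then show ?case
  proof
    assume "mspline k y j t \<noteq> 0"
    from Suc.IH[OF this] show ?thesis
      using monoD[OF assms(1), of "j + int k + 1" "j + int (Suc k) + 1"] by auto
  next
    assume "mspline k y (j + 1) t \<noteq> 0"
    from Suc.IH[OF this] show ?thesis
      using monoD[OF assms(1), of j "j + 1"] by (auto simp: algebra_simps)
  qed
qed

text \<open>The division-free form holds without a case distinction: if the outer knots coincide,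
  both splines of lower degree vanish by their support.\<close>

lemma mspline_rec:
  assumes "mono y"
  shows "(y (j + int k + 2) - y j) * mspline (Suc k) y j t =
    (t - y j) * mspline k y j t + (y (j + int k + 2) - t) * mspline k y (j + 1) t"
proof (cases "y j < y (j + int k + 2)")
  case False
  have "mspline k y j t = 0"
    using mspline_support[OF assms, of k j t] False
      monoD[OF assms, of "j + int k + 1" "j + int k + 2"] by fastforce
  moreover have "mspline k y (j + 1) t = 0"
    using mspline_support[OF assms, of k "j + 1" t] False
      monoD[OF assms, of j "j + 1"] by (fastforce simp: algebra_simps)
  ultimately show ?thesis using False by simp
qed simp

lemma mspline_nonneg:
  assumes "mono y"
  shows "0 \<le> mspline k y j t"
proof (induction k arbitrary: j)
  case 0
  then show ?case by auto
next
  case (Suc k)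
  have "0 \<le> (t - y j) * mspline k y j t"
    using Suc mspline_support[OF assms, of k j t] 
    by (cases "mspline k y j t = 0") (auto intro: mult_nonneg_nonneg)
  moreover have "0 \<le> (y (j + int k + 2) - t) * mspline k y (j + 1) t"
  proof (cases "mspline k y (j + 1) t = 0")
    case False
    then have "t \<le> y (j + int k + 2)" using mspline_support[OF assms, of k "j + 1" t] 
      by (simp add: algebra_simps)
    then show ?thesis using Suc by simp
  qed simp
  ultimately show ?case by simp
qed

lemma mspline_pos:
  assumes "mono y" "y j < t" "t < y (j + int k + 1)"
  shows "0 < mspline k y j t"
  using assms(2-)
proof (induction k arbitrary: j)
  case 0
  then show ?case by auto
next
  case (Suc k)
  have lt: "y j < y (j + int k + 2)" using Suc.prems by (auto simp: algebra_simps)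
  have up: "t < y (j + int k + 2)" using Suc.prems by (simp add: algebra_simps)
  have n: "0 \<le> mspline k y i t" for i using mspline_nonneg[OF assms(1)] .
  have le: "y (j + 1) \<le> y (j + int k + 1)" using monoD[OF assms(1)] by simp
  have "0 < (t - y j) * mspline k y j t + (y (j + int k + 2) - t) * mspline k y (j + 1) t"
  proof (cases "t < y (j + int k + 1)")
    case True
    then have "0 < (t - y j) * mspline k y j t" using Suc by simp
    moreover have "0 \<le> (y (j + int k + 2) - t) * mspline k y (j + 1) t"
      using n[of "j + 1"] up by simp
    ultimately show ?thesis by simp
  next
    case False
    show ?thesis
    proof (cases "y (j + 1) < t")
      case True
      have "0 < (y (j + int k + 2) - t) * mspline k y (j + 1) t"
        using Suc.IH[of "j + 1"] True up by (simp add: add_ac)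
      moreover have "0 \<le> (t - y j) * mspline k y j t" using n Suc.prems by simp
      ultimately show ?thesis by simp
    next
      case False
      then have "y (j + 1) = t" "y (j + int k + 1) = t" using le \<open>\<not> t < y (j + int k + 1)\<close> by auto
      then have eq: "y i = t" if "j + 1 \<le> i" "i \<le> j + int k + 1" for i
        using that monoD[OF assms(1)] by (metis order.antisym)
      \<comment> \<open>Here \<open>t\<close> is a \<open>(k + 1)\<close>-fold knot and the outer
        induction hypothesis does not apply. The half-open interval makes the degree 0 spline
        starting at the last copy of \<open>t\<close> positive; each step of the recursion keeps
        only the term of the right spline, because the left one has the factor
        \<open>t - t\<close>.\<close>
      have "0 < mspline r y (j + 1 + int k - int r) t" if "r \<le> k" for r
        using that
      proof (induction r)
        case 0
        then show ?case using eq[of "j + int k + 1"] up by (simp add: add_ac)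
      next
        case (Suc r)
        have "y (j + 1 + int k - int (Suc r)) = t" using Suc by (intro eq) auto
        moreover have "t < y (j + int k + 2)" by (rule up)
        moreover have "0 < mspline r y (j + 1 + int k - int r) t" using Suc by auto
        ultimately show ?case by (simp add: algebra_simps)
      qed
      from this[of k] have "0 < (y (j + int k + 2) - t) * mspline k y (j + 1) t"
        using up by simp
      moreover have "0 \<le> (t - y j) * mspline k y j t" using n Suc.prems by simp
      ultimately show ?thesis by simp
    qed
  qed
  then show ?case using lt by simp
qed

lemma mspline_cong:
  assumes "\<And>i. j \<le> i \<Longrightarrow> i \<le> j + int k + 1 \<Longrightarrow> y i = y' i"
  shows "mspline k y j t = mspline k y' j t"
  using assms
proof (induction k arbitrary: j)
  case (Suc k)
  have "mspline k y j t = mspline k y' j t" "mspline k y (j + 1) t = mspline k y' (j + 1) t"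
    using Suc.prems by (auto intro!: Suc.IH)
  then show ?case using Suc.prems by simp
qed simp

lemma mspline_shift: "mspline k (\<lambda>i. y (i - 1)) (j + 1) t = mspline k y j t"
proof (induction k arbitrary: j)
  case (Suc k)
  have "mspline k (\<lambda>i. y (i - 1)) (j + 2) t = mspline k y (j + 1) t"
    using Suc[of "j + 1"] by (simp add: add.assoc)
  then show ?case using Suc[of j] by (simp add: add_ac)
qed (simp add: add_ac)

definition insert_knot :: "int \<Rightarrow> real \<Rightarrow> (int \<Rightarrow> real) \<Rightarrow> int \<Rightarrow> real" where
  "insert_knot m z y i = (if i \<le> m then y i else if i = m + 1 then z else y (i - 1))"

lemma mono_insert_knot:
  assumes "mono y" "y m \<le> z" "z \<le> y (m + 1)"
  shows "mono (insert_knot m z y)"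
proof (rule monoI)
  fix i j :: int assume "i \<le> j"
  have "y a \<le> z" if "a \<le> m" for a using monoD[OF assms(1) that] assms by simp
  moreover have "z \<le> y a" if "m + 1 \<le> a" for a using monoD[OF assms(1) that] assms by simp
  ultimately show "insert_knot m z y i \<le> insert_knot m z y j"
    using \<open>i \<le> j\<close> by (auto simp: insert_knot_def intro: monoD[OF assms(1)])
qed

lemma insert_knot_below: "j + int k + 1 \<le> m \<Longrightarrow> mspline k (insert_knot m z y) j t = mspline k y j t"
  by (rule mspline_cong) (auto simp: insert_knot_def)

lemma insert_knot_above:
  assumes "m < j"
  shows "mspline k (insert_knot m z y) (j + 1) t = mspline k y j t"
proof -
  have "mspline k (insert_knot m z y) (j + 1) t = mspline k (\<lambda>i. y (i - 1)) (j + 1) t"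
    using assms by (intro mspline_cong) (auto simp: insert_knot_def)
  then show ?thesis by (simp add: mspline_shift)
qed

text \<open>Boehm's knot insertion in unnormalized form. Both splines in the recursion are split by
  the induction hypothesis, except that for \<open>j = m\<close> the right one and for
  \<open>m = j + int k + 1\<close> the left one is not cut by \<open>z\<close>. Multiplying by the
  support lengths leaves polynomial identities.\<close>

lemma insert_knot_between:
  assumes y: "mono y" "y m \<le> z" "z < y (m + 1)" and "j \<le> m" "m \<le> j + int k"
  shows "(y (j + int k + 1) - y j) * mspline k y j t =
    (z - y j) * mspline k (insert_knot m z y) j t +
    (y (j + int k + 1) - z) * mspline k (insert_knot m z y) (j + 1) t"
  using assms(4-)
proof (induction k arbitrary: j)
  case 0
  then have "j = m" by simp
  then show ?case using y by (auto simp: insert_knot_def add_ac)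
next
  case (Suc k)
  define y' where "y' = insert_knot m z y"
  have my': "mono y'" unfolding y'_def using y by (intro mono_insert_knot) auto
  define A B C D where "A = y j" and "B = y (j + 1)" and "C = y (j + int k + 1)" and "D = y (j + int k + 2)"
  define m0 m1 m2 where "m0 = mspline k y' j t" and "m1 = mspline k y' (j + 1) t" and "m2 = mspline k y' (j + 2) t"
  have lo: "y a \<le> z" if "a \<le> m" for a using monoD[OF y(1) that] y by simp
  have hi: "z < y a" if "m + 1 \<le> a" for a using monoD[OF y(1) that] y by simp
  have rec: "(D - A) * mspline (Suc k) y j t = (t - A) * mspline k y j t + (D - t) * mspline k y (j + 1) t"
    unfolding A_def D_def by (rule mspline_rec[OF y(1)])
  have rec0: "(y' (j + int k + 2) - y' j) * mspline (Suc k) y' j t = (t - y' j) * m0 + (y' (j + int k + 2) - t) * m1"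
    unfolding m0_def m1_def by (rule mspline_rec[OF my'])
  have rec1: "(y' (j + int k + 3) - y' (j + 1)) * mspline (Suc k) y' (j + 1) t =
      (t - y' (j + 1)) * m1 + (y' (j + int k + 3) - t) * m2"
    unfolding m1_def m2_def using mspline_rec[OF my', of "j + 1" k] by (simp add: algebra_simps)
  have y'j: "y' j = A" "y' (j + int k + 3) = D" using Suc.prems by (auto simp: y'_def insert_knot_def A_def D_def add_ac)
  define K where "K = (D - A) * mspline (Suc k) y j t"
  have goal: "K = (z - A) * mspline (Suc k) y' j t + (D - z) * mspline (Suc k) y' (j + 1) t"
  proof (cases "j = m")
    case True
    have 1: "mspline k y (j + 1) t = m2"
      using insert_knot_above[of m "j + 1" k z y t] True by (simp add: m2_def y'_def add.commute)
    have 2: "(C - A) * mspline k y j t = (z - A) * m0 + (C - z) * m1"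
      using Suc.IH[of j] True by (simp add: C_def A_def m0_def m1_def y'_def)
    have "y' (j + int k + 2) = C" "y' (j + 1) = z" using True 
      by (auto simp: y'_def insert_knot_def C_def algebra_simps)
    then have 3: "(C - A) * mspline (Suc k) y' j t = (t - A) * m0 + (C - t) * m1"
      and 4: "(D - z) * mspline (Suc k) y' (j + 1) t = (t - z) * m1 + (D - t) * m2"
      using rec0 rec1 y'j by simp_all
    have "A < C" using lo[of j] hi[of "j + int k + 1"] True by (simp add: A_def C_def)
    have "(C - A) * K = (t - A) * ((C - A) * mspline k y j t) + (C - A) * (D - t) * m2"
      unfolding K_def rec 1 by (simp add: algebra_simps)
    also have "\<dots> = (z - A) * ((C - A) * mspline (Suc k) y' j t) + (C - A) * ((D - z) * mspline (Suc k) y' (j + 1) t)"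
      unfolding 2 3 4 by (simp add: algebra_simps)
    also have "\<dots> = (C - A) * ((z - A) * mspline (Suc k) y' j t + (D - z) * mspline (Suc k) y' (j + 1) t)"
      by (simp add: algebra_simps)
    finally show ?thesis using \<open>A < C\<close> by simp
  next
    case jm: False
    have y'B: "y' (j + 1) = B" using jm Suc.prems by (auto simp: y'_def insert_knot_def B_def)
    have 2: "(D - B) * mspline k y (j + 1) t = (z - B) * m1 + (D - z) * m2"
      using Suc.IH[of "j + 1"] jm Suc.prems
      by (simp add: D_def B_def m1_def m2_def y'_def algebra_simps)
    have 4: "(D - B) * mspline (Suc k) y' (j + 1) t = (t - B) * m1 + (D - t) * m2"
      using rec1 y'j y'B by simp
    have "B < D" using lo[of "j + 1"] hi[of "j + int k + 2"] jm Suc.prems by (simp add: B_def D_def)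
    show ?thesis
    proof (cases "m = j + int k + 1")
      case True
      have 1: "mspline k y j t = m0"
        using insert_knot_below[of j k m z y t] True by (simp add: m0_def y'_def)
      have "y' (j + int k + 2) = z" using True by (auto simp: y'_def insert_knot_def)
      then have 3: "(z - A) * mspline (Suc k) y' j t = (t - A) * m0 + (z - t) * m1"
        using rec0 y'j by simp
      have "(D - B) * K = (t - A) * (D - B) * m0 + (D - t) * ((D - B) * mspline k y (j + 1) t)"
        unfolding K_def rec 1 by (simp add: algebra_simps)
      also have "\<dots> = (D - B) * ((z - A) * mspline (Suc k) y' j t) + (D - z) * ((D - B) * mspline (Suc k) y' (j + 1) t)"
        unfolding 2 3 4 by (simp add: algebra_simps)
      also have "\<dots> = (D - B) * ((z - A) * mspline (Suc k) y' j t + (D - z) * mspline (Suc k) y' (j + 1) t)"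
        by (simp add: algebra_simps)
      finally show ?thesis using \<open>B < D\<close> by simp
    next
      case False
      have 1: "(C - A) * mspline k y j t = (z - A) * m0 + (C - z) * m1"
        using Suc.IH[of j] False Suc.prems by (simp add: C_def A_def m0_def m1_def y'_def)
      have "y' (j + int k + 2) = C" using False Suc.prems
        by (auto simp: y'_def insert_knot_def C_def algebra_simps)
      then have 3: "(C - A) * mspline (Suc k) y' j t = (t - A) * m0 + (C - t) * m1"
        using rec0 y'j by simp
      have "A < C" using lo[of j] hi[of "j + int k + 1"] False Suc.prems by (simp add: A_def C_def)
      have "(C - A) * (D - B) * K = (t - A) * (D - B) * ((C - A) * mspline k y j t)
          + (D - t) * (C - A) * ((D - B) * mspline k y (j + 1) t)"
        unfolding K_def rec by (simp add: algebra_simps)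
      also have "\<dots> = (D - B) * (z - A) * ((C - A) * mspline (Suc k) y' j t) 
          + (C - A) * (D - z) * ((D - B) * mspline (Suc k) y' (j + 1) t)"
        unfolding 1 2 3 4 by (simp add: algebra_simps)
      also have "\<dots> = (C - A) * (D - B) * ((z - A) * mspline (Suc k) y' j t + (D - z) * mspline (Suc k) y' (j + 1) t)"
        by (simp add: algebra_simps)
      finally show ?thesis using \<open>B < D\<close> \<open>A < C\<close> by simp
    qed
  qed
  then show ?case by (simp add: K_def A_def D_def y'_def algebra_simps)
qed

text \<open>Boehm's insertion coefficient, completed by 1 and 0 for the splines that lie entirely
  before or after the new knot and are at most shifted in index.\<close>

definition left_weight :: "nat \<Rightarrow> (int \<Rightarrow> real) \<Rightarrow> int \<Rightarrow> real \<Rightarrow> int \<Rightarrow> real" where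
  "left_weight k y m z j =
     (if j + int k + 1 \<le> m then 1 else if m < j then 0 else (z - y j) / (y (j + int k + 1) - y j))"

lemma insert_knot_mspline:
  assumes y: "mono y" "y m \<le> z" "z < y (m + 1)"
  shows "mspline k y j t = left_weight k y m z j * mspline k (insert_knot m z y) j t +
           (1 - left_weight k y m z j) * mspline k (insert_knot m z y) (j + 1) t"
    and "0 \<le> left_weight k y m z j" and "left_weight k y m z j \<le> 1"
proof -
  have lo: "y a \<le> z" if "a \<le> m" for a using monoD[OF y(1) that] y by simp
  have hi: "z < y a" if "m + 1 \<le> a" for a using monoD[OF y(1) that] y by simp
  show "mspline k y j t = left_weight k y m z j * mspline k (insert_knot m z y) j t +
           (1 - left_weight k y m z j) * mspline k (insert_knot m z y) (j + 1) t"
  proof (cases "j + int k + 1 \<le> m \<or> m < j")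
    case True
    then show ?thesis by (auto simp: left_weight_def insert_knot_below insert_knot_above)
  next
    case False
    then have d: "y j < y (j + int k + 1)" using lo[of j] hi[of "j + int k + 1"] by auto
    define w where "w = left_weight k y m z j"
    define S where "S = y (j + int k + 1) - y j"
    have S: "S > 0" using d by (simp add: S_def)
    have "w = (z - y j) / S" using False by (simp add: w_def left_weight_def S_def)
    then have w1: "z - y j = w * S" using S by simp
    then have w: "z - y j = w * S" "y (j + int k + 1) - z = (1 - w) * S"
      by (simp_all add: S_def left_diff_distrib)
    have "S * mspline k y j t = w * S * mspline k (insert_knot m z y) j t +
        (1 - w) * S * mspline k (insert_knot m z y) (j + 1) t"
      using insert_knot_between[OF y, of j k t] False unfolding w S_def[symmetric] by simp
    then have "S * mspline k y j t = 
        S * (w * mspline k (insert_knot m z y) j t + (1 - w) * mspline k (insert_knot m z y) (j + 1) t)"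
      by (simp add: algebra_simps)
    then show ?thesis using S by (simp add: w_def)
  qed
  show "0 \<le> left_weight k y m z j" "left_weight k y m z j \<le> 1"
    using lo[of j] hi[of "j + int k + 1"] by (auto simp: left_weight_def divide_le_eq_1)
qed

section \<open>Sign alternations of splines\<close>

lemma mono_int_crossing:
  fixes y :: "int \<Rightarrow> real"
  assumes "mono y" "y a \<le> z" "z < y b"
  shows "\<exists>m. y m \<le> z \<and> z < y (m + 1)"
proof (rule ccontr)
  assume no: "\<not> ?thesis"
  have "y (a + int n) \<le> z" for n
  proof (induction n)
    case (Suc n)
    then show ?case using no by (metis add.assoc add.commute not_le of_nat_Suc)
  qed (use assms in simp)
  from this[of "nat (b - a)"] have "y (max a b) \<le> z" by (simp add: max_def split: if_splits)
  moreover have "y b \<le> y (max a b)" using assms(1) by (auto intro: monoD)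
  ultimately show False using assms by simp
qed

lemma mono_int_crossing':
  fixes y :: "int \<Rightarrow> real"
  assumes "mono y" "y a < z" "z \<le> y b"
  shows "\<exists>m. y m < z \<and> z \<le> y (m + 1)"
proof (rule ccontr)
  assume no: "\<not> ?thesis"
  have "y (a + int n) < z" for n
  proof (induction n)
    case (Suc n)
    then show ?case using no by (metis add.assoc add.commute not_le of_nat_Suc)
  qed (use assms in simp)
  from this[of "nat (b - a)"] have "y (max a b) < z" by (simp add: max_def split: if_splits)
  moreover have "y b \<le> y (max a b)" using assms(1) by (auto intro: monoD)
  ultimately show False using assms by simp
qed

text \<open>The strict bounds make every level set finite, so that \<open>card\<close> is the true
  multiplicity; an infinite set would count as 0. Multiplicity at most \<open>k\<close> allows
  refinement to exactly \<open>k\<close>.\<close>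

definition admissible :: "nat \<Rightarrow> real set \<Rightarrow> (int \<Rightarrow> real) \<Rightarrow> bool" where
  "admissible k T y \<longleftrightarrow>
     mono y \<and> (\<forall>t\<in>T. (\<exists>a. y a < t) \<and> (\<exists>b. t < y b) \<and> card {j. y j = t} \<le> k)"

lemma finite_level:
  fixes y :: "int \<Rightarrow> real"
  assumes "mono y" "y a < t" "t < y b"
  shows "finite {j. y j = t}"
proof (rule finite_subset)
  show "{j. y j = t} \<subseteq> {a..b}"
  proof
    fix j assume "j \<in> {j. y j = t}"
    then have "y a < y j" "y j < y b" using assms by auto
    then show "j \<in> {a..b}" using monoD[OF assms(1)] by (metis atLeastAtMost_iff linorder_linear not_le)
  qed
qed simp

lemma card_insert_knot:
  assumes "finite {j. y j = t}"
  shows "card {j. insert_knot m z y j = t} = card {j. y j = t} + (if t = z then 1 else 0)"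
proof -
  define h :: "int \<Rightarrow> int" where "h j = (if j \<le> m then j else j + 1)" for j
  have inj: "inj_on h A" for A by (auto simp: inj_on_def h_def split: if_splits)
  have "{j. insert_knot m z y j = t} = h ` {j. y j = t} \<union> (if t = z then {m + 1} else {})" (is "?L = ?R")
  proof
    show "?L \<subseteq> ?R"
    proof
      fix j assume j: "j \<in> ?L"
      consider "j \<le> m" | "j = m + 1" | "j > m + 1" by linarith
      then show "j \<in> ?R"
      proof cases
        case 1
        then show ?thesis using j by (auto simp: insert_knot_def h_def image_iff)
      next
        case 2
        then show ?thesis using j by (auto simp: insert_knot_def)
      next
        case 3
        then have "j = h (j - 1)" "y (j - 1) = t" using j by (auto simp: insert_knot_def h_def)
        then show ?thesis by auto
      qed
    qed
    show "?R \<subseteq> ?L" by (auto simp: insert_knot_def h_def)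
  qed
  moreover have "card (h ` {j. y j = t}) = card {j. y j = t}" by (rule card_image[OF inj])
  moreover have "m + 1 \<notin> h ` {j. y j = t}" by (auto simp: h_def)
  ultimately show ?thesis using assms by auto
qed

lemma insert_knot_eq_old: 
  "insert_knot m z y (if j \<le> m then j else j + 1) = y j"
  by (auto simp: insert_knot_def)

text \<open>The measure is the total multiplicity still missing at the points of \<open>T\<close>.
  Properties are pulled back from a refined sequence to a coarser one, so the base case is the fully
  refined one.\<close>

lemma knot_refinement_induct [consumes 2, case_names full insert]:
  assumes "finite T" "admissible k T y"
    and full: "\<And>y. admissible k T y \<Longrightarrow> \<forall>t\<in>T. card {j. y j = t} = k \<Longrightarrow> P y"
    and ins: "\<And>y m z. admissible k T y \<Longrightarrow> admissible k T (insert_knot m z y) \<Longrightarrow>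
       y m \<le> z \<Longrightarrow> z < y (m + 1) \<Longrightarrow> P (insert_knot m z y) \<Longrightarrow> P y"
  shows "P y"
  using assms(2)
proof (induction "\<Sum>t\<in>T. k - card {j. y j = t}" arbitrary: y rule: less_induct)
  case less
  show ?case
  proof (cases "\<forall>t\<in>T. card {j. y j = t} = k")
    case True
    then show ?thesis using full less by blast
  next
    case False
    then obtain z where z: "z \<in> T" "card {j. y j = z} < k"
      using less.prems by (auto simp: admissible_def order.strict_iff_order)
    obtain a b where "y a < z" "z < y b" using less.prems z by (auto simp: admissible_def)
    moreover have my: "mono y" using less.prems by (simp add: admissible_def)
    ultimately obtain m where m: "y m \<le> z" "z < y (m + 1)" using mono_int_crossing by (metis less_imp_le)
    have fin: "finite {j. y j = t}" if "t \<in> T" for t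
      using less.prems that finite_level[OF my] unfolding admissible_def by blast
    have card: "card {j. insert_knot m z y j = t} = card {j. y j = t} + (if t = z then 1 else 0)"
      if "t \<in> T" for t using card_insert_knot[OF fin[OF that]] .
    have adm: "admissible k T (insert_knot m z y)"
      unfolding admissible_def
    proof (intro conjI ballI)
      show "mono (insert_knot m z y)" using mono_insert_knot[OF my] m by simp
      fix t assume t: "t \<in> T"
      show "card {j. insert_knot m z y j = t} \<le> k"
        using card[OF t] z less.prems t by (auto simp: admissible_def)
      show "\<exists>a. insert_knot m z y a < t" "\<exists>b. t < insert_knot m z y b"
        using less.prems t insert_knot_eq_old unfolding admissible_def by metis+
    qed
    have "(\<Sum>t\<in>T. k - card {j. insert_knot m z y j = t}) < (\<Sum>t\<in>T. k - card {j. y j = t})"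
      using assms(1) card z by (intro sum_strict_mono_ex1) (auto intro!: bexI[of _ z])
    from less.hyps[OF this adm] show ?thesis using ins[OF less.prems adm m] by blast
  qed
qed

lemma full_knot_index:
  assumes "admissible k T y" "t \<in> T" "card {j. y j = t} = k"
  obtains J where "y J < t" "\<And>i. J < i \<Longrightarrow> i \<le> J + int k \<Longrightarrow> y i = t" "t < y (J + int k + 1)"
proof -
  have my: "mono y" using assms by (simp add: admissible_def)
  obtain a b where ab: "y a < t" "t < y b" using assms by (auto simp: admissible_def)
  obtain J where J: "y J < t" "t \<le> y (J + 1)"
    using mono_int_crossing'[OF my ab(1), of b] ab by auto
  obtain L where L: "y L \<le> t" "t < y (L + 1)"
    using mono_int_crossing[OF my _ ab(2), of a] ab by auto
  have "{j. y j = t} = {J + 1..L}"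
  proof (intro equalityI subsetI)
    fix j assume "j \<in> {j. y j = t}"
    then have "y J < y j" "y j < y (L + 1)" using J L by auto
    then have "J < j" "j < L + 1" using monoD[OF my] by (meson not_le)+
    then show "j \<in> {J + 1..L}" by simp
  next
    fix j assume "j \<in> {J + 1..L}"
    then have "y (J + 1) \<le> y j" "y j \<le> y L" using monoD[OF my] by auto
    then show "j \<in> {j. y j = t}" using J L by simp
  qed
  moreover have "J \<le> L"
  proof (rule ccontr)
    assume "\<not> J \<le> L"
    then have "y (L + 1) \<le> y J" using monoD[OF my] by simp
    then show False using J L by simp
  qed
  moreover have "y i = t" if "J < i" "i \<le> L" for i
    using calculation(1) that by (auto simp: set_eq_iff)
  moreover have "L = J + int k" using calculation(1,2) assms(3) by simp
  ultimately have "L = J + int k" "\<And>i. J < i \<Longrightarrow> i \<le> L \<Longrightarrow> y i = t" by blast+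
  then show ?thesis using that[of J] J L by auto
qed

text \<open>A spline is continuous with value 0 at its left end unless its first
  \<open>k + 1\<close> knots coincide, which \<open>t < y (j + int k)\<close> excludes.\<close>

lemma mspline_left_end:
  assumes "mono y" "t \<le> y j" "t < y (j + int k)"
  shows "mspline k y j t = 0"
  using assms(2,3)
proof (induction k arbitrary: j)
  case (Suc k)
  have "t \<le> y (j + 1)" using Suc.prems monoD[OF assms(1), of j "j + 1"] by simp
  then have "mspline k y (j + 1) t = 0" using Suc by (simp add: add_ac)
  moreover have "t < y j \<Longrightarrow> mspline k y j t = 0" using mspline_support[OF assms(1), of k j t] by fastforce
  ultimately show ?case using Suc.prems by (cases "t = y j") auto
qed simp

text \<open>Splines starting before \<open>J\<close> end at or before \<open>t\<close>. Those
  starting later vanish at or left of their first knot, of which at most \<open>k\<close> copies are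
  available.\<close>

lemma mspline_full_knot:
  assumes "mono y" "0 < k" "y J < t" "\<And>i. J < i \<Longrightarrow> i \<le> J + int k \<Longrightarrow> y i = t" "t < y (J + int k + 1)"
  shows "0 < mspline k y J t" and "j \<noteq> J \<Longrightarrow> mspline k y j t = 0"
proof -
  show "0 < mspline k y J t" using assms by (intro mspline_pos) auto
  assume "j \<noteq> J"
  show "mspline k y j t = 0"
  proof (cases "j < J")
    case True
    have "y (j + int k + 1) \<le> y (J + int k)" using True monoD[OF assms(1)] by simp
    also have "\<dots> = t" using assms by simp
    finally show ?thesis using mspline_support[OF assms(1), of k j t] by fastforce
  next
    case False
    then have "y (J + 1) \<le> y j" "y (J + int k + 1) \<le> y (j + int k)"
      using \<open>j \<noteq> J\<close> monoD[OF assms(1)] by auto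
    moreover have "y (J + 1) = t" using assms by simp
    ultimately show ?thesis using assms by (intro mspline_left_end) auto
  qed
qed

definition full_index :: "nat \<Rightarrow> (int \<Rightarrow> real) \<Rightarrow> real \<Rightarrow> int \<Rightarrow> bool" where
  "full_index k y t J \<longleftrightarrow> y J < t \<and> (\<forall>i. J < i \<and> i \<le> J + int k \<longrightarrow> y i = t) \<and> t < y (J + int k + 1)"

lemma full_index_mono:
  assumes "mono y" "0 < k" "full_index k y t J" "full_index k y t' J'" "t < t'"
  shows "J < J'"
proof (rule ccontr)
  assume "\<not> J < J'"
  then have "y (J' + 1) \<le> y (J + 1)" using monoD[OF assms(1)] by simp
  moreover have "y (J + 1) = t" "y (J' + 1) = t'" using assms by (auto simp: full_index_def)
  ultimately show False using assms by simp
qed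

lemma mspline_full_index:
  assumes "mono y" "0 < k" "full_index k y t J"
  shows "0 < mspline k y J t" and "j \<noteq> J \<Longrightarrow> mspline k y j t = 0"
  using mspline_full_knot[OF assms(1,2), of J t] assms(3) unfolding full_index_def by blast+

lemma nonneg_combination_sign:
  fixes a b v w :: real
  assumes "0 \<le> v" "0 \<le> w" "c = v * a + w * b" "c \<noteq> 0"
  shows "0 < c * a \<or> 0 < c * b"
proof (rule ccontr)
  assume "\<not> ?thesis"
  then have "v * (c * a) \<le> 0" "w * (c * b) \<le> 0" using assms(1,2) by (auto intro: mult_nonneg_nonpos)
  moreover have "c * c = v * (c * a) + w * (c * b)" by (subst (2) assms(3)) (simp add: algebra_simps)
  moreover have "0 < c * c" using assms(4) not_real_square_gt_zero by blast
  ultimately show False by simp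
qed

text \<open>On fully refined knots the values at \<open>T\<close> are positive multiples of selected
  coefficients in the same order. A knot insertion changes coefficients by corner cutting, which
  creates no new alternation.\<close>

lemma spline_alternation:
  assumes "finite T" "admissible k T y" "0 < k"
    and "\<And>j. j \<notin> {lo..hi} \<Longrightarrow> c j = 0"
    and "alternation (\<lambda>t. \<Sum>j=lo..hi. c j * mspline k y j t) T s p"
  shows "alternation c UNIV s p"
  using assms(1,2,4,5)
proof (induction y arbitrary: c lo hi rule: knot_refinement_induct)
  case (full y)
  have my: "mono y" using full by (simp add: admissible_def)
  have ex: "\<exists>J. full_index k y t J" if "t \<in> T" for t
    using full_knot_index[OF full(1) that] full(2) that unfolding full_index_def by metis
  show ?case
  proof (rule alternation_transport[OF _ _ full(4)])
    fix t assume t: "t \<in> T" "(\<Sum>j=lo..hi. c j * mspline k y j t) \<noteq> 0"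
    obtain J where J: "full_index k y t J" using ex t by blast
    have "(\<Sum>j=lo..hi. c j * mspline k y j t) = (\<Sum>j=lo..hi. if j = J then c J * mspline k y J t else 0)"
      using mspline_full_index(2)[OF my \<open>0 < k\<close> J] by (intro sum.cong) auto
    then have eq: "(\<Sum>j=lo..hi. c j * mspline k y j t) = (if J \<in> {lo..hi} then c J * mspline k y J t else 0)" by simp
    with t have "c J \<noteq> 0" by (auto split: if_splits)
    then have "0 < (\<Sum>j=lo..hi. c j * mspline k y j t) * c J"
      using eq t mspline_full_index(1)[OF my \<open>0 < k\<close> J]
      by (auto simp: zero_less_mult_iff mult_less_0_iff split: if_splits)
    then show "\<exists>j\<in>UNIV. 0 < (\<Sum>j=lo..hi. c j * mspline k y j t) * c j \<and> full_index k y t j" using J by blast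
  qed (use full_index_mono[OF my \<open>0 < k\<close>] in \<open>auto intro: less_imp_le\<close>)
next
  case (insert y m z)
  have my: "mono y" using insert by (simp add: admissible_def)
  define w where "w = left_weight k y m z"
  note M = insert_knot_mspline[OF my insert(3,4), of k, folded w_def]
  define y' where "y' = insert_knot m z y"
  \<comment> \<open>The coefficients of the same spline on the refined knots. Coefficient
    \<open>j\<close> receives the left part of spline \<open>j\<close> and the right part of spline
    \<open>j - 1\<close>, so the index range grows by one.\<close>
  define c' where "c' j = w j * c j + (1 - w (j - 1)) * c (j - 1)" for j
  have "(\<Sum>j=lo..hi. c j * mspline k y j t) = (\<Sum>j=lo..hi + 1. c' j * mspline k y' j t)" for t
  proof -
    have "(\<Sum>j=lo..hi. c j * mspline k y j t) =
       (\<Sum>j=lo..hi. w j * c j * mspline k y' j t) + (\<Sum>j=lo..hi. (1 - w j) * c j * mspline k y' (j + 1) t)"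
      unfolding M(1)[of _ t] y'_def by (simp add: algebra_simps sum.distrib sum_subtractf)
    also have "(\<Sum>j=lo..hi. (1 - w j) * c j * mspline k y' (j + 1) t) =
       (\<Sum>j=lo + 1..hi + 1. (1 - w (j - 1)) * c (j - 1) * mspline k y' j t)"
      by (rule sum.reindex_bij_witness[of _ "\<lambda>j. j - 1" "\<lambda>j. j + 1"]) auto
    also have "\<dots> = (\<Sum>j=lo..hi + 1. (1 - w (j - 1)) * c (j - 1) * mspline k y' j t)"
      using insert(6) by (intro sum.mono_neutral_left) auto
    also have "(\<Sum>j=lo..hi. w j * c j * mspline k y' j t) = (\<Sum>j=lo..hi + 1. w j * c j * mspline k y' j t)"
      using insert(6) by (intro sum.mono_neutral_left) auto
    finally show ?thesis by (simp add: c'_def distrib_right sum.distrib)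
  qed
  then have "alternation (\<lambda>t. \<Sum>j=lo..hi + 1. c' j * mspline k y' j t) T s p" using insert(7) by simp
  then have "alternation c' UNIV s p"
    using insert(6) by (intro insert(5)[of lo "hi + 1"]) (auto simp: c'_def y'_def)
  then show ?case
  proof (rule alternation_transport[where R = "\<lambda>i j. j = i \<or> j = i - 1", rotated 2])
    fix i assume "c' i \<noteq> 0"
    have "0 \<le> w i" "0 \<le> 1 - w (i - 1)" using M(2,3) by auto
    from nonneg_combination_sign[OF this c'_def \<open>c' i \<noteq> 0\<close>]
    show "\<exists>j\<in>UNIV. 0 < c' i * c j \<and> (j = i \<or> j = i - 1)" by blast
  qed auto
qed

text \<open>The transposed statement, for functionals supported on \<open>T\<close> applied to the
  successive splines. A coarse value is a nonnegative combination of two neighbouring refined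
  values.\<close>

lemma spline_dual_alternation:
  assumes "finite T" "admissible k T y" "0 < k"
    and "alternation (\<lambda>j. \<Sum>t\<in>T. v t * mspline k y j t) UNIV s p"
  shows "alternation v T s p"
  using assms(1,2,4)
proof (induction y rule: knot_refinement_induct)
  case (full y)
  have my: "mono y" using full by (simp add: admissible_def)
  have ex: "\<exists>J. full_index k y t J" if "t \<in> T" for t
    using full_knot_index[OF full(1) that] full(2) that unfolding full_index_def by metis
  show ?case
  proof (rule alternation_transport[OF _ _ full(3), where R = "\<lambda>j t. full_index k y t j"])
    fix j assume "(\<Sum>t\<in>T. v t * mspline k y j t) \<noteq> 0"
    then obtain t where t: "t \<in> T" "v t * mspline k y j t \<noteq> 0" by (meson sum.not_neutral_contains_not_neutral)
    then obtain J where "full_index k y t J" using ex by blast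
    then have J: "full_index k y t j" using mspline_full_index(2)[OF my \<open>0 < k\<close>] t by (metis mult_zero_right)
    have "mspline k y j t' = 0" if t': "t' \<in> T" "t' \<noteq> t" for t'
    proof -
      obtain J' where J': "full_index k y t' J'" using ex t' by blast
      have "J' \<noteq> j" using full_index_mono[OF my \<open>0 < k\<close> J J'] full_index_mono[OF my \<open>0 < k\<close> J' J] t'
        by (cases t t' rule: linorder_cases) auto
      then show ?thesis using mspline_full_index(2)[OF my \<open>0 < k\<close> J'] by simp
    qed
    then have "(\<Sum>t\<in>T. v t * mspline k y j t) = (\<Sum>t'\<in>T. if t' = t then v t * mspline k y j t else 0)"
      by (intro sum.cong) auto
    also have "\<dots> = v t * mspline k y j t" using t assms(1) by simp
    finally have "0 < (\<Sum>t\<in>T. v t * mspline k y j t) * v t"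
      using t mspline_full_index(1)[OF my \<open>0 < k\<close> J] by (auto simp: zero_less_mult_iff mult_less_0_iff)
    then show "\<exists>t\<in>T. 0 < (\<Sum>t\<in>T. v t * mspline k y j t) * v t \<and> full_index k y t j" using J t by blast
  next
    fix j j' t t' assume "j < j'" "full_index k y t j" "full_index k y t' j'"
    then show "t \<le> t'" using full_index_mono[OF my \<open>0 < k\<close>, of t' j' t j] by linarith
  qed
next
  case (insert y m z)
  have my: "mono y" using insert by (simp add: admissible_def)
  define w where "w = left_weight k y m z"
  note M = insert_knot_mspline[OF my insert(3,4), of k, folded w_def]
  define g where "g j = (\<Sum>t\<in>T. v t * mspline k (insert_knot m z y) j t)" for j
  have g: "(\<Sum>t\<in>T. v t * mspline k y j t) = w j * g j + (1 - w j) * g (j + 1)" for j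
    unfolding M(1)[of j] g_def by (simp add: sum_distrib_left sum.distrib algebra_simps sum_subtractf)
  have "alternation g UNIV s p"
  proof (rule alternation_transport[OF _ _ insert(6), where R = "\<lambda>i j. j = i \<or> j = i + 1"])
    fix i assume nz: "(\<Sum>t\<in>T. v t * mspline k y i t) \<noteq> 0"
    have "0 \<le> w i" "0 \<le> 1 - w i" using M(2,3) by auto
    from nonneg_combination_sign[OF this g nz]
    show "\<exists>j\<in>UNIV. 0 < (\<Sum>t\<in>T. v t * mspline k y i t) * g j \<and> (j = i \<or> j = i + 1)" by blast
  qed auto
  then show ?case using insert(5) unfolding g_def by blast
qed

section \<open>Positivity of collocation determinants\<close>

text \<open>The column index comes first, so that \<open>h(i := u)\<close> replaces a whole column.
  Columns will be B-splines and rows collocation points.\<close>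

definition column_det :: "nat \<Rightarrow> (nat \<Rightarrow> nat \<Rightarrow> real) \<Rightarrow> real" where
  "column_det p h = Determinant.det (Matrix.mat p p (\<lambda>(l, i). h i l))"

lemma column_det_cong:
  assumes "\<And>i l. i < p \<Longrightarrow> l < p \<Longrightarrow> h i l = h' i l"
  shows "column_det p h = column_det p h'"
proof -
  have "Matrix.mat p p (\<lambda>(l, i). h i l) = Matrix.mat p p (\<lambda>(l, i). h' i l)"
    using assms by (intro eq_matI) auto
  then show ?thesis by (simp add: column_det_def)
qed

lemma column_det_linear:
  assumes "i < p" "\<And>l. l < p \<Longrightarrow> h i l = a * u l + b * v l"
  shows "column_det p h = a * column_det p (h(i := u)) + b * column_det p (h(i := v))"
proof -
  define A where "A h = Matrix.mat p p (\<lambda>(l, i). h i l)" for h :: "nat \<Rightarrow> nat \<Rightarrow> real"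
  have del: "mat_delete (A (h(i := w))) l i = mat_delete (A h) l i" for l w
    unfolding mat_delete_def A_def using assms(1) by (intro eq_matI) auto
  have exp: "column_det p g = (\<Sum>l<p. g i l * cofactor (A g) l i)" for g
    using laplace_expansion_column[of "A g" p i] assms(1) by (simp add: column_det_def A_def)
  have "column_det p h = (\<Sum>l<p. (a * u l + b * v l) * cofactor (A h) l i)"
    unfolding exp using assms(2) by (intro sum.cong) auto
  also have "\<dots> = a * (\<Sum>l<p. u l * cofactor (A h) l i) + b * (\<Sum>l<p. v l * cofactor (A h) l i)"
    by (simp add: sum_distrib_left algebra_simps sum.distrib)
  also have "\<dots> = a * column_det p (h(i := u)) + b * column_det p (h(i := v))"
    unfolding exp cofactor_def del by simp
  finally show ?thesis .
qed

lemma column_det_identical: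
  assumes "i < p" "j < p" "i \<noteq> j" "\<And>l. l < p \<Longrightarrow> h i l = h j l"
  shows "column_det p h = 0"
  unfolding column_det_def
  by (rule Determinant.det_identical_columns[of _ p i j]) (use assms in auto)

lemma column_det_zero_row:
  assumes "l < p" "\<And>i. i < p \<Longrightarrow> h i l = 0"
  shows "column_det p h = 0"
  using laplace_expansion_row[of "Matrix.mat p p (\<lambda>(l, i). h i l)" p l] assms
  by (simp add: column_det_def)

lemma column_det_diagonal_pos:
  assumes "\<And>i l. i < p \<Longrightarrow> l < p \<Longrightarrow> i \<noteq> l \<Longrightarrow> h i l = 0" "\<And>i. i < p \<Longrightarrow> 0 < h i i"
  shows "0 < column_det p h"
proof -
  define A where "A = Matrix.mat p p (\<lambda>(l, i). h i l)"
  have "Determinant.det A = prod_list (diag_mat A)"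
    using assms(1) by (intro Determinant.det_upper_triangular[of _ p]) (auto simp: A_def)
  also have "\<dots> = (\<Prod>i<p. h i i)"
    by (simp add: prod_list_diag_prod A_def atLeast0LessThan)
  also have "\<dots> > 0" using assms(2) by (intro prod_pos) auto
  finally show ?thesis by (simp add: column_det_def A_def)
qed

lemma column_det_kernel:
  assumes "column_det p h \<noteq> 0" "\<And>l. l < p \<Longrightarrow> (\<Sum>i<p. h i l * v i) = 0" "i < p"
  shows "v i = 0"
proof (rule ccontr)
  assume "v i \<noteq> 0"
  define A where "A = Matrix.mat p p (\<lambda>(l, i). h i l)"
  have A: "A \<in> carrier_mat p p" by (simp add: A_def)
  have "Matrix.vec p v \<noteq> 0\<^sub>v p" using \<open>v i \<noteq> 0\<close> \<open>i < p\<close> by (auto simp: vec_eq_iff)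
  moreover have "A *\<^sub>v Matrix.vec p v = 0\<^sub>v p"
    using assms(2) by (intro eq_vecI) (auto simp: A_def scalar_prod_def atLeast0LessThan)
  ultimately have "Determinant.det A = 0"
    using det_0_iff_vec_prod_zero_field[OF A] vec_carrier by blast
  then show False using assms(1) by (simp add: column_det_def A_def)
qed

lemma column_det_transpose: "column_det p (\<lambda>i l. h l i) = column_det p h"
proof -
  have "Matrix.mat p p (\<lambda>(l, i). h l i) = transpose_mat (Matrix.mat p p (\<lambda>(l, i). h i l))"
    by (intro eq_matI) auto
  then show ?thesis by (simp add: column_det_def Determinant.det_transpose[of _ p])
qed

text \<open>Multilinearity expands the determinant over all choices of \<open>u\<close> or
  \<open>v\<close> in each column, with nonnegative products as weights. For strict positivity one
  positive term with positive weights suffices.\<close>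

lemma column_det_mixture:
  assumes g: "\<And>i l. i < p \<Longrightarrow> l < p \<Longrightarrow> g i l = a i * u i l + b i * v i l"
    and ab: "\<And>i. i < p \<Longrightarrow> 0 \<le> a i" "\<And>i. i < p \<Longrightarrow> 0 \<le> b i"
    and nn: "\<And>S. 0 \<le> column_det p (\<lambda>i. if i \<in> S then v i else u i)"
  shows "0 \<le> column_det p g"
    and "\<lbrakk>\<And>i. i < p \<Longrightarrow> i \<in> S \<Longrightarrow> 0 < b i; \<And>i. i < p \<Longrightarrow> i \<notin> S \<Longrightarrow> 0 < a i;
          0 < column_det p (\<lambda>i. if i \<in> S then v i else u i)\<rbrakk> \<Longrightarrow> 0 < column_det p g"
proof -
  \<comment> \<open>The first \<open>m\<close> columns are already expanded according to
    \<open>S\<close>; the others still carry \<open>g\<close>.\<close>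
  define h where "h m S i = (if i < m then (if i \<in> S then v i else u i) else g i)" for m S i
  have step: "column_det p (h m S) =
      a m * column_det p (h (Suc m) (S - {m})) + b m * column_det p (h (Suc m) (insert m S))"
    if "m < p" for m S
  proof -
    have "(h m S)(m := u m) = h (Suc m) (S - {m})" "(h m S)(m := v m) = h (Suc m) (insert m S)"
      by (auto simp: h_def fun_eq_iff)
    then show ?thesis
      using column_det_linear[OF that, of "h m S" "a m" "u m" "b m" "v m"] g[OF that] by (simp add: h_def)
  qed
  have last: "column_det p (h p S) = column_det p (\<lambda>i. if i \<in> S then v i else u i)" for S
    by (rule column_det_cong) (simp add: h_def)
  have first: "h 0 S = g" for S by (simp add: h_def fun_eq_iff)
  have nonneg: "0 \<le> column_det p (h m S)" if "m \<le> p" for m S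
    using that
  proof (induction m arbitrary: S rule: inc_induct)
    case base
    then show ?case using nn last by simp
  next
    case (step n)
    then show ?case using \<open>\<And>m S. m < p \<Longrightarrow> column_det p (h m S) = _\<close> ab by simp
  qed
  then show "0 \<le> column_det p g" using first by (metis le0)
  assume S: "\<And>i. i < p \<Longrightarrow> i \<in> S \<Longrightarrow> 0 < b i" "\<And>i. i < p \<Longrightarrow> i \<notin> S \<Longrightarrow> 0 < a i"
    "0 < column_det p (\<lambda>i. if i \<in> S then v i else u i)"
  have "0 < column_det p (h m S)" if "m \<le> p" for m
    using that
  proof (induction m rule: inc_induct)
    case base
    then show ?case using S last by simp
  next
    case (step n)
    have n: "0 \<le> column_det p (h (Suc n) (S - {n}))" "0 \<le> column_det p (h (Suc n) (insert n S))"
      using nonneg step by auto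
    have e: "column_det p (h n S) =
      a n * column_det p (h (Suc n) (S - {n})) + b n * column_det p (h (Suc n) (insert n S))"
      using step by (simp add: \<open>\<And>m S. m < p \<Longrightarrow> column_det p (h m S) = _\<close>)
    show ?case
    proof (cases "n \<in> S")
      case True
      then have "0 < b n * column_det p (h (Suc n) (insert n S))"
        using S(1) step by (simp add: insert_absorb)
      then show ?thesis using e n ab(1)[of n] step by (simp add: add_nonneg_pos)
    next
      case False
      then have "0 < a n * column_det p (h (Suc n) (S - {n}))"
        using S(2) step by simp
      then show ?thesis using e n ab(2)[of n] step by (simp add: add_pos_nonneg)
    qed
  qed
  then show "0 < column_det p g" using first by (metis le0)
qed

lemma strict_mono_on_lessThan_id:
  fixes f :: "nat \<Rightarrow> nat"
  assumes "\<And>i j. i < j \<Longrightarrow> j < p \<Longrightarrow> f i < f j" "\<And>i. i < p \<Longrightarrow> f i < p" "i < p"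
  shows "f i = i"
proof -
  have "j < p \<Longrightarrow> j \<le> f j" for j
  proof (induction j)
    case (Suc j)
    then show ?case using assms(1)[of j "Suc j"] by simp
  qed simp
  moreover have "j \<le> p - 1 \<Longrightarrow> f j \<le> j" for j
  proof (induction j rule: inc_induct)
    case base
    then show ?case using assms(2)[of "p - 1"] \<open>i < p\<close> by simp
  next
    case (step n)
    then show ?case using assms(1)[of n "Suc n"] by linarith
  qed
  ultimately show ?thesis using assms(3) by (simp add: order.antisym)
qed

text \<open>Expanding each column along a knot insertion at \<open>z\<close> writes the determinant as a nonnegative
  combination of refined ones. For the term taking the left spline in the columns with
  \<open>\<tau>\<^sub>i < z\<close> and the right one in those with \<open>\<tau>\<^sub>i > z\<close>, the interlacing condition persists.\<close>

lemma collocation_det: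
  fixes \<tau> :: "nat \<Rightarrow> real" and J :: "nat \<Rightarrow> int"
  assumes \<tau>: "\<And>i j. i < j \<Longrightarrow> j < p \<Longrightarrow> \<tau> i < \<tau> j" and "admissible k (\<tau> ` {..<p}) y" "0 < k"
    and J: "\<And>i j. i < j \<Longrightarrow> j < p \<Longrightarrow> J i < J j"
  shows "0 \<le> column_det p (\<lambda>i l. mspline k y (J i) (\<tau> l)) \<and>
    ((\<forall>i<p. y (J i) < \<tau> i \<and> \<tau> i < y (J i + int k + 1)) \<longrightarrow>
      0 < column_det p (\<lambda>i l. mspline k y (J i) (\<tau> l)))"
  using finite_imageI[OF finite_lessThan] assms(2) J
proof (induction y arbitrary: J rule: knot_refinement_induct)
  case (full y)
  have my: "mono y" using full by (simp add: admissible_def)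
  have "\<exists>j. full_index k y (\<tau> l) j" if "l < p" for l
    using full_knot_index[OF full(1), of "\<tau> l"] full(2) that unfolding full_index_def
    by (metis imageI lessThan_iff)
  then obtain K where K: "\<And>l. l < p \<Longrightarrow> full_index k y (\<tau> l) (K l)" by metis
  note M = mspline_full_index[OF my \<open>0 < k\<close> K]
  show ?case
  proof (cases "\<forall>i<p. J i = K i")
    case True
    have "K i \<noteq> K l" if "i < p" "l < p" "i \<noteq> l" for i l
      using full_index_mono[OF my \<open>0 < k\<close> K K] \<tau> that by (metis linorder_neqE_nat order.strict_iff_order)
    then have "0 < column_det p (\<lambda>i l. mspline k y (J i) (\<tau> l))"
      using True M by (intro column_det_diagonal_pos) auto
    then show ?thesis by simp
  next
    case False
    \<comment> \<open>Column \<open>i\<close> is nonzero in row \<open>l\<close> only if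
      \<open>J i = K l\<close>. If some \<open>K l\<close> is missed, row \<open>l\<close> vanishes;
      if none is, both sequences being strictly increasing forces \<open>J = K\<close>.\<close>
    have "column_det p (\<lambda>i l. mspline k y (J i) (\<tau> l)) = 0"
    proof (cases "\<exists>l<p. \<forall>i<p. J i \<noteq> K l")
      case True
      then obtain l where "l < p" "\<forall>i<p. J i \<noteq> K l" by blast
      then show ?thesis using M(2) by (intro column_det_zero_row[of l]) auto
    next
      case nex: False
      then obtain f where f: "\<And>l. l < p \<Longrightarrow> f l < p \<and> J (f l) = K l" by metis
      have "f l = l" if "l < p" for l
      proof (rule strict_mono_on_lessThan_id[of p f])
        fix i j assume ij: "i < j" "j < p"
        then have "K i < K j" using full_index_mono[OF my \<open>0 < k\<close> K K] \<tau> by simp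
        then have "J (f i) < J (f j)" using f ij by simp
        then show "f i < f j" using full(3)[of "f j" "f i"] f ij
          by (metis linorder_neqE_nat not_less_iff_gr_or_eq order.strict_trans)
      qed (use f that in auto)
      then show ?thesis using f False by metis
    qed
    moreover have "\<not> (\<forall>i<p. y (J i) < \<tau> i \<and> \<tau> i < y (J i + int k + 1))"
    proof
      assume I: "\<forall>i<p. y (J i) < \<tau> i \<and> \<tau> i < y (J i + int k + 1)"
      \<comment> \<open>A support that strictly contains a \<open>k\<close>-fold knot has all its
        copies among its \<open>k\<close> inner knots, hence starts just before them.\<close>
      have "J i = K i" if "i < p" for i
      proof -
        have y1: "y (K i + 1) = \<tau> i" and yk: "y (K i + int k) = \<tau> i" 
          using K[OF that] \<open>0 < k\<close> by (auto simp: full_index_def)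
        have "y (J i) < y (K i + 1)" "y (K i + int k) < y (J i + int k + 1)" using I that y1 yk by auto
        then have "J i < K i + 1" "K i + int k < J i + int k + 1" using monoD[OF my] by (meson not_le)+
        then show ?thesis by simp
      qed
      then show False using False by simp
    qed
    ultimately show ?thesis by simp
  qed
next
  case (insert y m z)
  have my: "mono y" using insert by (simp add: admissible_def)
  have lo: "y a \<le> z" if "a \<le> m" for a using monoD[OF my that] insert by simp
  have hi: "z < y a" if "m + 1 \<le> a" for a using monoD[OF my that] insert by simp
  define w where "w = left_weight k y m z"
  note M = insert_knot_mspline[OF my insert(3,4), of k, folded w_def]
  define y' where "y' = insert_knot m z y"
  have my': "mono y'" using insert by (simp add: admissible_def y'_def)
  define JS where "JS S i = J i + (if i \<in> S then 1 else 0)" for S i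
  have col: "column_det p (\<lambda>i. if i \<in> S then (\<lambda>l. mspline k y' (J i + 1) (\<tau> l)) else (\<lambda>l. mspline k y' (J i) (\<tau> l)))
      = column_det p (\<lambda>i l. mspline k y' (JS S i) (\<tau> l))" for S
    by (rule column_det_cong) (simp add: JS_def)
  \<comment> \<open>Adding 0 or 1 keeps \<open>J\<close> weakly increasing; where two indices
    collide, two columns are equal.\<close>
  have nn: "0 \<le> column_det p (\<lambda>i l. mspline k y' (JS S i) (\<tau> l))" for S
  proof (cases "\<forall>i j. i < j \<longrightarrow> j < p \<longrightarrow> JS S i < JS S j")
    case True
    then show ?thesis using insert(5)[of "JS S"] by (simp add: y'_def)
  next
    case False
    then obtain i j where ij: "i < j" "j < p" "\<not> JS S i < JS S j" by blast
    then have "JS S i = JS S j" using insert(6)[of i j] by (auto simp: JS_def split: if_splits)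
    then have "column_det p (\<lambda>i l. mspline k y' (JS S i) (\<tau> l)) = 0"
      using ij by (intro column_det_identical[of i _ j]) auto
    then show ?thesis by simp
  qed
  note mix = column_det_mixture[where p = p and g = "\<lambda>i l. mspline k y (J i) (\<tau> l)"
      and u = "\<lambda>i l. mspline k y' (J i) (\<tau> l)" and v = "\<lambda>i l. mspline k y' (J i + 1) (\<tau> l)"
      and a = "\<lambda>i. w (J i)" and b = "\<lambda>i. 1 - w (J i)", unfolded col]
  have nonneg: "0 \<le> column_det p (\<lambda>i l. mspline k y (J i) (\<tau> l))"
    using M nn by (intro mix(1)) (auto simp: y'_def)
  moreover have "0 < column_det p (\<lambda>i l. mspline k y (J i) (\<tau> l))"
    if I: "\<forall>i<p. y (J i) < \<tau> i \<and> \<tau> i < y (J i + int k + 1)"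
  proof -
    \<comment> \<open>At \<open>\<tau> i = z\<close> the right spline is taken exactly when the left
      one no longer reaches beyond \<open>\<tau> i\<close>. Since \<open>\<tau>\<close> increases,
      every index after a member of \<open>S\<close> is also in \<open>S\<close>, so
      \<open>JS S\<close> stays strictly increasing.\<close>
    define S where "S = {i. z < \<tau> i \<or> \<tau> i = z \<and> y' (J i + int k + 1) \<le> \<tau> i}"
    have lower: "0 < w (J i) \<and> y' (J i) < \<tau> i \<and> \<tau> i < y' (J i + int k + 1)" if i: "i < p" "i \<notin> S" for i
    proof -
      have le: "\<tau> i \<le> z" and eq: "\<tau> i = z \<Longrightarrow> \<tau> i < y' (J i + int k + 1)" using i by (auto simp: S_def)
      have yi: "y (J i) < \<tau> i" "\<tau> i < y (J i + int k + 1)" using I i by auto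
      have "J i \<le> m" using hi[of "J i"] yi le by force
      then have "y' (J i) < \<tau> i" using yi by (simp add: y'_def insert_knot_def)
      moreover have "0 < w (J i)" using \<open>J i \<le> m\<close> yi le by (auto simp: w_def left_weight_def)
      moreover have "\<tau> i < y' (J i + int k + 1)" if "\<tau> i < z"
      proof -
        consider "J i + int k + 1 \<le> m" | "J i + int k = m" | "m < J i + int k" by linarith
        then show ?thesis
        proof cases
          case 3
          then have "y' (J i + int k + 1) = y (J i + int k)" by (simp add: y'_def insert_knot_def)
          then show ?thesis using hi[of "J i + int k"] 3 that by simp
        qed (use yi that in \<open>auto simp: y'_def insert_knot_def\<close>)
      qed
      ultimately show ?thesis using eq le by fastforce
    qed
    have upper: "0 < 1 - w (J i) \<and> y' (J i + 1) < \<tau> i \<and> \<tau> i < y' (J i + 1 + int k + 1)" if i: "i < p" "i \<in> S" for i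
    proof -
      have ge: "z \<le> \<tau> i" and eq: "\<tau> i = z \<Longrightarrow> y' (J i + int k + 1) \<le> \<tau> i" using i by (auto simp: S_def)
      have yi: "y (J i) < \<tau> i" "\<tau> i < y (J i + int k + 1)" using I i by auto
      have jm: "m < J i + int k + 1" using lo[of "J i + int k + 1"] yi ge by force
      then have "y' (J i + 1 + int k + 1) = y (J i + int k + 1)" 
        by (auto simp: y'_def insert_knot_def add_ac)
      moreover have "0 < 1 - w (J i)"
      proof (cases "m < J i")
        case False
        then have "w (J i) = (z - y (J i)) / (y (J i + int k + 1) - y (J i))"
          using jm by (simp add: w_def left_weight_def)
        also have "\<dots> < 1" using hi[of "J i + int k + 1"] jm yi by (subst divide_less_eq_1_pos) auto
        finally show ?thesis by simp
      qed (use jm in \<open>simp add: w_def left_weight_def\<close>)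
      moreover have "y' (J i + 1) < \<tau> i"
      proof (rule ccontr)
        \<comment> \<open>Otherwise the \<open>k + 1\<close> knots from \<open>J i + 1\<close> to
          \<open>J i + int k + 1\<close> would all equal \<open>\<tau> i\<close>, contradicting
          admissibility of the refined sequence.\<close>
        assume c: "\<not> y' (J i + 1) < \<tau> i"
        have "y' (J i + 1) \<le> z \<or> y' (J i + 1) = y (J i)"
          using lo[of "J i + 1"] by (auto simp: y'_def insert_knot_def)
        then have "\<tau> i = z" using c ge yi by auto
        then have le: "y' (J i + int k + 1) \<le> \<tau> i" by (rule eq)
        have adm: "card {j. y' j = \<tau> i} \<le> k" "(\<exists>a. y' a < \<tau> i) \<and> (\<exists>b. \<tau> i < y' b)"
          using insert(2) i by (auto simp: admissible_def y'_def)
        then have fin: "finite {j. y' j = \<tau> i}" using finite_level[OF my'] by blast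
        have "{J i + 1..J i + int k + 1} \<subseteq> {j. y' j = \<tau> i}"
        proof
          fix j assume "j \<in> {J i + 1..J i + int k + 1}"
          then have "y' (J i + 1) \<le> y' j" "y' j \<le> y' (J i + int k + 1)" using monoD[OF my'] by auto
          then show "j \<in> {j. y' j = \<tau> i}" using c le by simp
        qed
        from card_mono[OF fin this] adm show False by simp
      qed
      ultimately show ?thesis using yi by simp
    qed
    have incr: "JS S i < JS S j" if "i < j" "j < p" for i j
      using insert(6)[OF that] \<tau>[OF that] by (auto simp: JS_def S_def)
    have "0 < column_det p (\<lambda>i l. mspline k y' (JS S i) (\<tau> l))"
      using insert(5)[of "JS S"] incr lower upper unfolding y'_def[symmetric]
      by (auto simp: JS_def)
    then show ?thesis
      using M nn lower upper by (intro mix(2)[of S]) (auto simp: y'_def)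
  qed
  ultimately show ?case by blast
qed

section \<open>Simple real spectrum\<close>

text \<open>Positive scaling of the input coordinates changes no signs.\<close>

lemma oscillating_scale_columns:
  assumes "oscillating N b" "\<And>j. 0 < d j"
  shows "oscillating N (\<lambda>i j. b i j * d j)"
proof -
  have lin: "lin N (\<lambda>i j. b i j * d j) v = lin N b (\<lambda>j. d j * v j)" for v
    by (simp add: lin_def fun_eq_iff mult.assoc)
  have "alternation v {..<N} s p" if "alternation (lin N b (\<lambda>j. d j * v j)) {..<N} s p" for v s p
  proof -
    have "alternation (\<lambda>j. d j * v j) {..<N} s p" using that assms(1) by (auto simp: oscillating_def)
    then show ?thesis
    proof (rule alternation_same_signs)
      fix i assume "d i * v i \<noteq> 0"
      then have "v i \<noteq> 0" by auto
      then have "0 < v i * v i" using not_real_square_gt_zero by blast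
      then have "0 < d i * (v i * v i)" using assms(2)[of i] by (rule mult_pos_pos[rotated])
      then show "0 < d i * v i * v i" by (simp add: mult.assoc)
    qed
  qed
  moreover have "v i = 0" if "\<forall>i<N. lin N b (\<lambda>j. d j * v j) i = 0" "i < N" for v i
  proof -
    have "d i * v i = 0" using that assms(1) unfolding oscillating_def by blast
    then show ?thesis using assms(2)[of i] by simp
  qed
  moreover have "0 < b i i * d i" if "i < N" for i
    using that assms by (simp add: oscillating_def)
  moreover have "0 < b i (Suc i) * d (Suc i)" if "Suc i < N" for i
    using that assms by (simp add: oscillating_def)
  ultimately show ?thesis unfolding oscillating_def lin by blast
qed

text \<open>A quantitative Laguerre inequality. Away from the roots, \<open>D f\<close> divided by
  the square of \<open>f\<close> is the sum of \<open>1 / (x - r)^2\<close> over all roots, so it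
  bounds each single term. The recursion for a linear factor avoids the division.\<close>

lemma prod_linear_discriminant:
  fixes x :: real
  defines "D f \<equiv> (poly (pderiv f) x)\<^sup>2 - poly f x * poly (pderiv (pderiv f)) x"
  shows "0 \<le> D (\<Prod>r\<leftarrow>rs. [:- r, 1:])"
    and "r \<in> set rs \<Longrightarrow> (poly (\<Prod>r\<leftarrow>rs. [:- r, 1:]) x)\<^sup>2 \<le> (x - r)\<^sup>2 * D (\<Prod>r\<leftarrow>rs. [:- r, 1:])"
proof -
  have rec: "D ([:- r, 1:] * g) = (poly g x)\<^sup>2 + (x - r)\<^sup>2 * D g" for r g
  proof -
    define l where "l = [:- r, 1:]"
    have l: "pderiv l = 1" "poly l x = x - r" by (simp_all add: l_def pderiv_pCons)
    have d: "poly (l * g) x = (x - r) * poly g x"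
      "poly (pderiv (l * g)) x = (x - r) * poly (pderiv g) x + poly g x"
      "poly (pderiv (pderiv (l * g))) x = (x - r) * poly (pderiv (pderiv g)) x + 2 * poly (pderiv g) x"
      by (simp_all add: l pderiv_mult pderiv_add)
    have "((x - r) * b + a)\<^sup>2 - (x - r) * a * ((x - r) * c + 2 * b) = a\<^sup>2 + (x - r)\<^sup>2 * (b\<^sup>2 - a * c)"
      for a b c by (simp add: power2_eq_square algebra_simps)
    then show ?thesis unfolding D_def l_def[symmetric] d .
  qed
  show nn: "0 \<le> D (\<Prod>r\<leftarrow>rs. [:- r, 1:])" for rs
  proof (induction rs)
    case Nil
    then show ?case by (simp add: D_def pderiv_1)
  next
    case (Cons r rs)
    then show ?case by (simp only: list.map prod_list.Cons rec) simp
  qed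
  show "(poly (\<Prod>r\<leftarrow>rs. [:- r, 1:]) x)\<^sup>2 \<le> (x - r)\<^sup>2 * D (\<Prod>r\<leftarrow>rs. [:- r, 1:])" if "r \<in> set rs"
    using that
  proof (induction rs)
    case (Cons r0 rs)
    define g where "g = (\<Prod>r\<leftarrow>rs. [:- r, 1:])"
    have p: "(poly ([:- r0, 1:] * g) x)\<^sup>2 = (x - r0)\<^sup>2 * (poly g x)\<^sup>2"
      unfolding poly_mult power_mult_distrib by simp
    have "(x - r0)\<^sup>2 * (poly g x)\<^sup>2 \<le> (x - r)\<^sup>2 * ((poly g x)\<^sup>2 + (x - r0)\<^sup>2 * D g)"
    proof (cases "r = r0")
      case True
      then show ?thesis using nn[of rs] by (simp add: g_def distrib_left)
    next
      case False
      then have "(poly g x)\<^sup>2 \<le> (x - r)\<^sup>2 * D g" using Cons by (auto simp: g_def)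
      then have "(x - r0)\<^sup>2 * (poly g x)\<^sup>2 \<le> (x - r0)\<^sup>2 * ((x - r)\<^sup>2 * D g)" by (rule mult_left_mono) simp
      also have "\<dots> \<le> (x - r)\<^sup>2 * (poly g x)\<^sup>2 + (x - r0)\<^sup>2 * ((x - r)\<^sup>2 * D g)" by simp
      finally show ?thesis by (simp add: algebra_simps)
    qed
    then show ?case by (simp only: list.map prod_list.Cons p rec flip: g_def)
  qed simp
qed

text \<open>If \<open>a\<close> were a multiple root of \<open>f\<close>, then for one sign of \<open>e\<close> the roots of the real-rooted
  polynomial \<open>f + e q\<close> would stay away from \<open>a\<close> as \<open>e\<close> tends to \<open>0\<close>.\<close>

lemma real_rooted_pencil_simple_root:
  fixes f q :: "real poly"
  assumes rr: "\<And>e. \<bar>e\<bar> < 1 \<Longrightarrow> \<exists>rs. length rs = N \<and> f + Polynomial.smult e q = (\<Prod>r\<leftarrow>rs. [:- r, 1:])"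
    and "poly f a = 0" "poly q a \<noteq> 0"
  shows "poly (pderiv f) a \<noteq> 0"
proof
  assume f1: "poly (pderiv f) a = 0"
  define q0 q1 q2 f2 where "q0 = poly q a" and "q1 = poly (pderiv q) a"
    and "q2 = poly (pderiv (pderiv q)) a" and "f2 = poly (pderiv (pderiv f)) a"
  \<comment> \<open>With \<open>f\<close> and its derivative vanishing at \<open>a\<close>,
    \<open>K\<close> bounds the quotient of the discriminant of \<open>f + e q\<close> by its
    squared value at \<open>a\<close>, once the term with \<open>f2\<close> has a favourable sign.
    Every root of \<open>f + e q\<close> then has squared distance at least \<open>1 / K\<close>
    from \<open>a\<close>.\<close>
  define K where "K = max 1 ((q1\<^sup>2 - q0 * q2) / q0\<^sup>2)"
  have K: "1 \<le> K" and "(q1\<^sup>2 - q0 * q2) / q0\<^sup>2 \<le> K" by (auto simp: K_def)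
  then have Kq: "q1\<^sup>2 - q0 * q2 \<le> K * q0\<^sup>2" using assms(3) by (simp add: q0_def field_simps)
  \<comment> \<open>The first bound keeps the perturbation within the pencil; the second makes the
    squared value at \<open>a\<close> smaller than \<open>(1 / K) ^ N\<close>, the lower bound given
    by the distances of the roots.\<close>
  define h where "h = min (1 / 2) ((1 / K) ^ N / (2 * (q0\<^sup>2 + 1)))"
  have q0p: "0 < q0\<^sup>2 + 1" by (simp add: add_nonneg_pos)
  have "0 < (1 / K) ^ N / (2 * (q0\<^sup>2 + 1))"
    using K q0p by (intro divide_pos_pos zero_less_power) auto
  then have h: "0 < h" by (simp add: h_def)
  have h2: "h \<le> 1 / 2" unfolding h_def by (rule min.cobounded1)
  have "h \<le> (1 / K) ^ N / (2 * (q0\<^sup>2 + 1))" by (simp add: h_def)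
  then have h3: "h * (2 * (q0\<^sup>2 + 1)) \<le> (1 / K) ^ N" using q0p by (subst (asm) pos_le_divide_eq) auto
  \<comment> \<open>The sign that makes the contribution \<open>- e * (q0 * f2)\<close> to the
    discriminant nonpositive.\<close>
  define e where "e = (if 0 \<le> q0 * f2 then h else - h)"
  have e: "\<bar>e\<bar> = h" "0 \<le> e * (q0 * f2)" using h by (auto simp: e_def intro: mult_nonneg_nonpos)
  then obtain rs where rs: "length rs = N" "f + Polynomial.smult e q = (\<Prod>r\<leftarrow>rs. [:- r, 1:])" using rr[of e] h2 by auto
  define F where "F = f + Polynomial.smult e q"
  have F: "poly F a = e * q0" "poly (pderiv F) a = e * q1" "poly (pderiv (pderiv F)) a = f2 + e * q2"
    using assms(2) f1 by (simp_all add: F_def pderiv_add pderiv_smult q0_def q1_def q2_def f2_def)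
  have "(poly (pderiv F) a)\<^sup>2 - poly F a * poly (pderiv (pderiv F)) a = e\<^sup>2 * (q1\<^sup>2 - q0 * q2) - e * (q0 * f2)"
    unfolding F by (simp add: power2_eq_square algebra_simps)
  also have "\<dots> \<le> e\<^sup>2 * (K * q0\<^sup>2)" using mult_left_mono[OF Kq, of "e\<^sup>2"] e(2) by simp
  finally have D: "(poly (pderiv F) a)\<^sup>2 - poly F a * poly (pderiv (pderiv F)) a \<le> K * (e * q0)\<^sup>2"
    by (simp add: power2_eq_square mult_ac)
  have pos: "0 < (e * q0)\<^sup>2" using e h assms(3) by (auto simp: q0_def)
  have root: "1 / K \<le> (a - r)\<^sup>2" if "r \<in> set rs" for r
  proof -
    have "(e * q0)\<^sup>2 \<le> (a - r)\<^sup>2 * ((poly (pderiv F) a)\<^sup>2 - poly F a * poly (pderiv (pderiv F)) a)"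
      using prod_linear_discriminant(2)[OF that, of a] by (simp flip: rs(2) F_def add: F(1))
    also have "\<dots> \<le> (a - r)\<^sup>2 * (K * (e * q0)\<^sup>2)" by (rule mult_left_mono[OF D]) simp
    finally have "(e * q0)\<^sup>2 * 1 \<le> (e * q0)\<^sup>2 * ((a - r)\<^sup>2 * K)" by (simp add: mult_ac)
    then have "1 \<le> (a - r)\<^sup>2 * K" using pos mult_le_cancel_left_pos by blast
    then show ?thesis using K by (simp add: field_simps)
  qed
  have "(1 / K) ^ length rs \<le> (poly (\<Prod>r\<leftarrow>rs. [:- r, 1:]) a)\<^sup>2"
    using root
  proof (induction rs)
    case (Cons r rs)
    have "(1 / K) ^ length (r # rs) = 1 / K * (1 / K) ^ length rs" by simp
    also have "\<dots> \<le> (a - r)\<^sup>2 * (poly (\<Prod>r\<leftarrow>rs. [:- r, 1:]) a)\<^sup>2"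
      using Cons K by (intro mult_mono) auto
    also have "\<dots> = (poly (\<Prod>r\<leftarrow>r # rs. [:- r, 1:]) a)\<^sup>2"
      unfolding list.map prod_list.Cons poly_mult power_mult_distrib by simp
    finally show ?case .
  qed simp
  then have "(1 / K) ^ N \<le> (e * q0)\<^sup>2" using rs F(1) by (simp flip: F_def)
  also have "\<dots> = h * (h * q0\<^sup>2)" using e(1) by (metis power2_abs power2_eq_square power_mult_distrib mult.assoc)
  also have "\<dots> < h * (2 * (q0\<^sup>2 + 1))"
  proof (rule mult_strict_left_mono[OF _ h])
    have "h * q0\<^sup>2 \<le> 1 * q0\<^sup>2" using h2 by (intro mult_right_mono) auto
    then show "h * q0\<^sup>2 < 2 * (q0\<^sup>2 + 1)" using q0p by simp
  qed
  also have "\<dots> \<le> (1 / K) ^ N" by (rule h3)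
  finally show False by simp
qed

section \<open>Characteristic polynomials of oscillating matrices\<close>

lemma char_poly_root_iff:
  fixes c :: "nat \<Rightarrow> nat \<Rightarrow> 'a::field"
  shows "poly (char_poly (Matrix.mat N N (\<lambda>(i, j). c i j))) \<mu> = 0 \<longleftrightarrow>
    (\<exists>u. (\<exists>i<N. u i \<noteq> 0) \<and> (\<forall>i<N. (\<Sum>j<N. c i j * u j) = \<mu> * u i))"
proof -
  define A where "A = Matrix.mat N N (\<lambda>(i, j). c i j)"
  have A: "A \<in> carrier_mat N N" by (simp add: A_def)
  have mv: "A *\<^sub>v v = \<mu> \<cdot>\<^sub>v v \<longleftrightarrow> (\<forall>i<N. (\<Sum>j<N. c i j * vec_index v j) = \<mu> * vec_index v i)"
    if "v \<in> carrier_vec N" for v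
    using that by (auto simp: vec_eq_iff A_def scalar_prod_def atLeast0LessThan)
  have "eigenvalue A \<mu> \<longleftrightarrow> (\<exists>u. (\<exists>i<N. u i \<noteq> 0) \<and> (\<forall>i<N. (\<Sum>j<N. c i j * u j) = \<mu> * u i))"
  proof
    assume "eigenvalue A \<mu>"
    then obtain v where v: "v \<in> carrier_vec N" "v \<noteq> 0\<^sub>v N" "A *\<^sub>v v = \<mu> \<cdot>\<^sub>v v"
      using A by (auto simp: eigenvalue_def eigenvector_def)
    then show "\<exists>u. (\<exists>i<N. u i \<noteq> 0) \<and> (\<forall>i<N. (\<Sum>j<N. c i j * u j) = \<mu> * u i)"
      using mv by (intro exI[of _ "\<lambda>i. vec_index v i"]) auto
  next
    assume "\<exists>u. (\<exists>i<N. u i \<noteq> 0) \<and> (\<forall>i<N. (\<Sum>j<N. c i j * u j) = \<mu> * u i)"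
    then obtain u where u: "\<exists>i<N. u i \<noteq> 0" "\<forall>i<N. (\<Sum>j<N. c i j * u j) = \<mu> * u i" by blast
    have "Matrix.vec N u \<noteq> 0\<^sub>v N" using u(1) by (auto simp: vec_eq_iff)
    moreover have "A *\<^sub>v Matrix.vec N u = \<mu> \<cdot>\<^sub>v Matrix.vec N u" using u(2) by (subst mv) auto
    ultimately show "eigenvalue A \<mu>" using A by (auto simp: eigenvalue_def eigenvector_def intro!: exI[of _ "Matrix.vec N u"])
  qed
  then show ?thesis using eigenvalue_root_char_poly[OF A] by (simp add: A_def)
qed

text \<open>In the Laplace expansion along the first column the cofactors do not involve that
  column, so \<open>e\<close> enters linearly.\<close>

lemma char_poly_first_column_affine:
  fixes b :: "nat \<Rightarrow> nat \<Rightarrow> real"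
  assumes "0 < N"
  obtains q where "\<And>e. char_poly (Matrix.mat N N (\<lambda>(i, j). b i j * (if j = 0 then 1 + e else 1))) =
     char_poly (Matrix.mat N N (\<lambda>(i, j). b i j)) + Polynomial.smult e q"
proof -
  define A where "A e = Matrix.mat N N (\<lambda>(i, j). b i j * (if j = 0 then 1 + e else 1))" for e
  define C where "C e = char_poly_matrix (A e)" for e
  have A: "A e \<in> carrier_mat N N" for e by (simp add: A_def)
  have C: "C e \<in> carrier_mat N N" for e by (simp add: C_def A)
  have entry: "C e $$ (i, j) = (if i = j then [:0, 1:] else 0) - [:b i j * (if j = 0 then 1 + e else 1):]"
    if "i < N" "j < N" for e i j
    using that by (auto simp: C_def char_poly_matrix_def A_def)
  define C' where "C' i = mat_delete (C 0) i 0" for i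
  have del: "mat_delete (C e) i 0 = C' i" for e i
    unfolding C'_def mat_delete_def using C[of e] C[of 0] by (intro eq_matI) (auto simp: entry)
  define g where "g i = cofactor (C 0) i 0" for i
  have exp: "char_poly (A e) = (\<Sum>i<N. C e $$ (i, 0) * g i)" for e
    using laplace_expansion_column[OF C[of e] assms]
    by (simp add: char_poly_def cofactor_def del g_def flip: C_def)
  define q where "q = (\<Sum>i<N. - Polynomial.smult (b i 0) (g i))"
  have "char_poly (A e) = char_poly (A 0) + Polynomial.smult e q" for e
  proof -
    have "char_poly (A e) = (\<Sum>i<N. C 0 $$ (i, 0) * g i + Polynomial.smult e (- Polynomial.smult (b i 0) (g i)))"
      unfolding exp
    proof (rule sum.cong)
      fix i assume "i \<in> {..<N}"
      then have "C e $$ (i, 0) = C 0 $$ (i, 0) - [:e * b i 0:]"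
        using assms by (simp add: entry algebra_simps)
      then show "C e $$ (i, 0) * g i = C 0 $$ (i, 0) * g i + Polynomial.smult e (- Polynomial.smult (b i 0) (g i))"
        by (simp add: left_diff_distrib)
    qed simp
    also have "\<dots> = char_poly (A 0) + Polynomial.smult e q"
      unfolding exp q_def by (simp only: sum.distrib smult_sum2)
    finally show ?thesis .
  qed
  moreover have "A 0 = Matrix.mat N N (\<lambda>(i, j). b i j)" by (intro eq_matI) (auto simp: A_def)
  ultimately show ?thesis using that by (simp add: A_def)
qed

lemma map_of_real_linear_factors:
  "(\<Prod>a\<leftarrow>map complex_of_real rs. [:- a, 1:]) = map_poly complex_of_real (\<Prod>r\<leftarrow>rs. [:- r, 1:])"
proof -
  interpret map_poly_inj_idom_hom complex_of_real ..
  have "map_poly complex_of_real [:- r, 1:] = [:- complex_of_real r, 1:]" for r by simp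
  then show ?thesis by (induction rs) (simp_all add: hom_mult del: mult_pCons_left)
qed

lemma oscillating_real_rooted:
  assumes "oscillating N b"
  shows "\<exists>rs. length rs = N \<and> char_poly (Matrix.mat N N (\<lambda>(i, j). b i j)) = (\<Prod>r\<leftarrow>rs. [:- r, 1:])"
proof -
  interpret map_poly_inj_idom_hom complex_of_real ..
  define A where "A = Matrix.mat N N (\<lambda>(i, j). b i j)"
  define Ac where "Ac = Matrix.mat N N (\<lambda>(i, j). complex_of_real (b i j))"
  have A: "A \<in> carrier_mat N N" and Ac: "Ac \<in> carrier_mat N N" by (simp_all add: A_def Ac_def)
  have "map_mat complex_of_real A = Ac" by (intro eq_matI) (auto simp: A_def Ac_def)
  then have hom: "char_poly Ac = map_poly complex_of_real (char_poly A)"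
    using of_real_hom.char_poly_hom[OF A, where ?'a = complex] by simp
  obtain as where as: "char_poly Ac = (\<Prod>a\<leftarrow>as. [:- a, 1:])" "length as = N"
    using char_poly_factorized[OF Ac] by blast
  have "a \<in> \<real>" if "a \<in> set as" for a
  proof -
    have "poly (char_poly Ac) a = 0" using that unfolding as(1) by (auto simp: poly_prod_list prod_list_zero_iff)
    then obtain u r where "r < N" "u r \<noteq> 0" "\<And>i. i < N \<Longrightarrow> (\<Sum>j<N. complex_of_real (b i j) * u j) = a * u i"
      using char_poly_root_iff[of N "\<lambda>i j. complex_of_real (b i j)" a] by (auto simp: Ac_def)
    then show ?thesis using oscillating_eigenvalue_real[OF assms] by metis
  qed
  then have "map complex_of_real (map Re as) = as" by (simp add: map_idI)
  then have "map_poly complex_of_real (char_poly A) = (\<Prod>a\<leftarrow>map complex_of_real (map Re as). [:- a, 1:])"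
    using hom as(1) by simp
  also have "\<dots> = map_poly complex_of_real (\<Prod>r\<leftarrow>map Re as. [:- r, 1:])"
    by (rule map_of_real_linear_factors)
  finally have "char_poly A = (\<Prod>r\<leftarrow>map Re as. [:- r, 1:])"
    by (simp only: eq_iff)
  then show ?thesis using as(2) by (intro exI[of _ "map Re as"]) (simp add: A_def)
qed

theorem oscillating_spectrum:
  assumes osc: "oscillating N b" and osct: "oscillating N (\<lambda>i j. b j i)"
  obtains rs where "length rs = N" "distinct rs"
    "char_poly (Matrix.mat N N (\<lambda>(i, j). b i j)) = (\<Prod>r\<leftarrow>rs. [:- r, 1:])"
proof -
  define A where "A = Matrix.mat N N (\<lambda>(i, j). b i j)"
  obtain rs where rs: "length rs = N" "char_poly A = (\<Prod>r\<leftarrow>rs. [:- r, 1:])"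
    using oscillating_real_rooted[OF osc] by (auto simp: A_def)
  have "distinct rs"
  proof (rule ccontr)
    assume "\<not> distinct rs"
    then obtain xs ys zs a where dec: "rs = xs @ [a] @ ys @ [a] @ zs" using not_distinct_decomp by blast
    then have N: "0 < N" using rs by auto
    define l where "l = [:- a, 1:]"
    define g where "g = (\<Prod>r\<leftarrow>xs @ ys @ zs. [:- r, 1:])"
    have fac: "char_poly A = l * (l * g)"
      unfolding rs dec l_def g_def by (simp only: map_append prod_list.append list.map prod_list.Cons prod_list.Nil mult_ac mult_1_right)
    have "poly l a = 0" by (simp add: l_def)
    then have root: "poly (char_poly A) a = 0" and droot: "poly (pderiv (char_poly A)) a = 0"
      unfolding fac by (simp_all add: pderiv_mult)
    define d :: "real \<Rightarrow> nat \<Rightarrow> real" where "d e j = (if j = 0 then 1 + e else 1)" for e j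
    have oscd: "oscillating N (\<lambda>i j. b i j * d e j)" if "\<bar>e\<bar> < 1" for e
      using that by (intro oscillating_scale_columns[OF osc]) (auto simp: d_def)
    obtain q where q: "\<And>e. char_poly (Matrix.mat N N (\<lambda>(i, j). b i j * d e j)) = char_poly A + Polynomial.smult e q"
      using char_poly_first_column_affine[OF N, of b] unfolding A_def d_def by blast
    \<comment> \<open>Otherwise \<open>a\<close> would remain an eigenvalue after rescaling with
      \<open>e = 1 / 2\<close>. Pairing a right eigenvector \<open>u\<close> of the rescaled matrix
      with a left eigenvector \<open>y\<close> of the original one leaves
      \<open>a / 2 * y 0 * u 0 = 0\<close>, although all three factors \<open>a\<close>,
      \<open>y 0\<close>, \<open>u 0\<close> are nonzero.\<close>
    have "poly q a \<noteq> 0"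
    proof
      assume "poly q a = 0"
      then have "poly (char_poly (Matrix.mat N N (\<lambda>(i, j). b i j * d (1 / 2) j))) a = 0"
        using root by (simp add: q)
      then obtain u r where u: "r < N" "u r \<noteq> 0"
          "\<And>i. i < N \<Longrightarrow> (\<Sum>j<N. b i j * d (1 / 2) j * u j) = a * u i"
        using char_poly_root_iff[of N "\<lambda>i j. b i j * d (1 / 2) j" a] by auto
      have u0: "u 0 \<noteq> 0"
        using u by (intro oscillating_eigenvector_first[OF oscd, of "1/2" u a r]) (auto simp: lin_def)
      have "char_poly (Matrix.mat N N (\<lambda>(i, j). b j i)) = char_poly A"
      proof -
        have "Matrix.mat N N (\<lambda>(i, j). b j i) = transpose_mat A" by (intro eq_matI) (auto simp: A_def)
        moreover have "A \<in> carrier_mat N N" by (simp add: A_def)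
        ultimately show ?thesis by simp
      qed
      then obtain y l where y: "l < N" "y l \<noteq> 0" "\<And>j. j < N \<Longrightarrow> (\<Sum>i<N. b i j * y i) = a * y j"
        using char_poly_root_iff[of N "\<lambda>i j. b j i" a] root by auto
      have y0: "y 0 \<noteq> 0"
        using y by (intro oscillating_eigenvector_first[OF osct, of y a l]) (auto simp: lin_def)
      have a: "0 < a"
        using y by (intro oscillating_eigenvalue_pos[OF osct, of y a l]) (auto simp: lin_def)
      have "(\<Sum>i<N. y i * (a * u i)) = (\<Sum>i<N. \<Sum>j<N. y i * (b i j * d (1 / 2) j * u j))"
      proof (rule sum.cong)
        fix i assume "i \<in> {..<N}"
        then show "y i * (a * u i) = (\<Sum>j<N. y i * (b i j * d (1 / 2) j * u j))"
          using u(3)[of i] by (simp flip: sum_distrib_left)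
      qed simp
      also have "\<dots> = (\<Sum>j<N. \<Sum>i<N. y i * (b i j * d (1 / 2) j * u j))" by (rule sum.swap)
      also have "\<dots> = (\<Sum>j<N. (a * y j) * (d (1 / 2) j * u j))"
      proof (rule sum.cong)
        fix j assume "j \<in> {..<N}"
        then have j: "j < N" by simp
        have "(\<Sum>i<N. y i * (b i j * d (1 / 2) j * u j)) = (\<Sum>i<N. b i j * y i) * (d (1 / 2) j * u j)"
          unfolding sum_distrib_right by (simp only: mult_ac)
        then show "(\<Sum>i<N. y i * (b i j * d (1 / 2) j * u j)) = (a * y j) * (d (1 / 2) j * u j)"
          unfolding y(3)[OF j] .
      qed simp
      also have "\<dots> = (\<Sum>j<N. y j * (a * u j) + (if j = 0 then a / 2 * y 0 * u 0 else 0))"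
        by (intro sum.cong) (auto simp: d_def algebra_simps)
      also have "\<dots> = (\<Sum>j<N. y j * (a * u j)) + a / 2 * y 0 * u 0" using N by (simp add: sum.distrib)
      finally show False using a u0 y0 by simp
    qed
    moreover have "\<exists>rs. length rs = N \<and> char_poly A + Polynomial.smult e q = (\<Prod>r\<leftarrow>rs. [:- r, 1:])" if "\<bar>e\<bar> < 1" for e
      using oscillating_real_rooted[OF oscd[OF that]] by (simp add: q)
    ultimately show False using real_rooted_pencil_simple_root[OF _ root, of N q] droot by blast
  qed
  then show ?thesis using that rs by (simp add: A_def)
qed

section \<open>Divided differences of truncated powers\<close>

lemma trunc_power_Suc: "trunc_power (Suc m) u = u * trunc_power m u"
  by (simp add: trunc_power_def)

text \<open>At \<open>s = t\<close> the function vanishes identically on the left, which matches the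
  convention that the truncated power is 0 there. For \<open>m = 0\<close> the factor
  \<open>real m\<close> takes care of the truncated exponent.\<close>

lemma left_deriv_trunc_power:
  "left_deriv (\<lambda>s. c * trunc_power m (s - t)) = (\<lambda>s. c * real m * trunc_power (m - 1) (s - t))"
proof
  fix s
  let ?f = "\<lambda>s. c * trunc_power m (s - t)"
  have "(?f has_vector_derivative c * real m * trunc_power (m - 1) (s - t)) (at_left s)"
  proof (cases "t < s")
    case True
    have "((\<lambda>s. c * (s - t) ^ m) has_real_derivative c * real m * (s - t) ^ (m - 1)) (at s)"
      by (auto intro!: derivative_eq_intros)
    then have "((\<lambda>s. c * (s - t) ^ m) has_vector_derivative c * real m * (s - t) ^ (m - 1)) (at s)"
      by (simp add: has_real_derivative_iff_has_vector_derivative)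
    then have "(?f has_vector_derivative c * real m * (s - t) ^ (m - 1)) (at s)"
      by (rule has_vector_derivative_transform_within_open[of _ _ _ "{t<..}"])
         (use True in \<open>auto simp: trunc_power_def\<close>)
    then show ?thesis using True by (simp add: trunc_power_def has_vector_derivative_at_within)
  next
    case False
    have "((\<lambda>_. 0) has_vector_derivative (0::real)) (at s within {..s})" by simp
    then have "(?f has_vector_derivative 0) (at s within {..s})"
      by (rule has_vector_derivative_transform[rotated 2]) (use False in \<open>auto simp: trunc_power_def\<close>)
    then have "(?f has_vector_derivative 0) (at_left s)"
      by (rule has_vector_derivative_within_subset) auto
    then show ?thesis using False by (simp add: trunc_power_def)
  qed
  then show "left_deriv ?f s = c * real m * trunc_power (m - 1) (s - t)"
    unfolding left_deriv_def by (intro vector_derivative_within) (simp add: trivial_limit_at_left_real)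
qed

lemma iterated_left_deriv_trunc_power:
  "(left_deriv ^^ r) (\<lambda>s. trunc_power k (s - t)) =
     (\<lambda>s. fact r * real (k choose r) * trunc_power (k - r) (s - t))"
proof (induction r)
  case (Suc r)
  have "Suc r * (k choose Suc r) = (k - r) * (k choose r)"
    by (simp only: binomial_absorb_comp binomial_absorption)
  then have "real (Suc r) * real (k choose Suc r) = real (k - r) * real (k choose r)"
    by (metis of_nat_mult)
  then have "fact r * real (k choose r) * real (k - r) = fact (Suc r) * real (k choose Suc r)"
    by (simp add: mult_ac)
  then show ?case
    by (simp add: Suc left_deriv_trunc_power fun_eq_iff)
qed simp

context
  fixes y :: "int \<Rightarrow> real"
  assumes mono_y: "mono y"
begin

abbreviation (input) trunc_divdiff :: "nat \<Rightarrow> real \<Rightarrow> int \<Rightarrow> nat \<Rightarrow> real" where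
  "trunc_divdiff k t i r \<equiv> divdiff (\<lambda>s. trunc_power k (s - t)) y i r"

lemma knots_equal_between:
  assumes "y i = y j" "i \<le> l" "l \<le> j"
  shows "y l = y i"
  using monoD[OF mono_y assms(2)] monoD[OF mono_y assms(3)] assms(1) by simp

lemma trunc_divdiff_equal:
  assumes "y i = y (i + int r)"
  shows "trunc_divdiff k t i r = real (k choose r) * trunc_power (k - r) (y i - t)"
proof (cases r)
  case (Suc q)
  then have "trunc_divdiff k t i r = (left_deriv ^^ r) (\<lambda>s. trunc_power k (s - t)) (y i) / fact r"
    using assms by (simp del: funpow.simps)
  then show ?thesis unfolding iterated_left_deriv_trunc_power by simp
qed simp

lemma trunc_divdiff_diff:
  "(y (i + int (Suc r)) - y i) * trunc_divdiff k t i (Suc r) =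
     trunc_divdiff k t (i + 1) r - trunc_divdiff k t i r"
proof (cases "y i = y (i + int (Suc r))")
  case True
  have eq: "y l = y i" if "i \<le> l" "l \<le> i + int (Suc r)" for l
    using knots_equal_between[OF True] that by blast
  have "trunc_divdiff k t (i + 1) r = trunc_divdiff k t i r"
    using trunc_divdiff_equal[of "i + 1" r k t] trunc_divdiff_equal[of i r k t]
      eq[of "i + 1"] eq[of "i + 1 + int r"] eq[of "i + int r"] by simp
  then show ?thesis using True by simp
qed simp

text \<open>The product rule for divided differences, as raising the degree multiplies the truncated
  power by \<open>s - t\<close>, whose divided differences of order above one vanish.\<close>

lemma trunc_divdiff_Leibniz:
  "trunc_divdiff (Suc k) t i (Suc r) =
     (y i - t) * trunc_divdiff k t i (Suc r) + trunc_divdiff k t (i + 1) r"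
proof (induction r arbitrary: i)
  case 0
  show ?case
  proof (cases "y i = y (i + 1)")
    case True
    then have 1: "y i = y (i + int (Suc 0))" by simp
    have "(y i - t) * (real k * trunc_power (k - 1) (y i - t)) = real k * trunc_power k (y i - t)"
      by (cases k) (simp_all add: trunc_power_Suc)
    then show ?thesis
      unfolding trunc_divdiff_equal[OF 1] using True by (simp add: algebra_simps)
  next
    case False
    define a b where "a = trunc_power k (y i - t)" and "b = trunc_power k (y (i + 1) - t)"
    have "((y (i + 1) - t) * b - (y i - t) * a) / (y (i + 1) - y i) = (y i - t) * ((b - a) / (y (i + 1) - y i)) + b"
      using False by (simp add: divide_simps) (simp add: algebra_simps)
    then show ?thesis using False by (simp add: trunc_power_Suc a_def b_def)
  qed
next
  case (Suc r)
  show ?case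
  proof (cases "y i = y (i + int (Suc (Suc r)))")
    case True
    have eq: "y l = y i" if "i \<le> l" "l \<le> i + int (Suc (Suc r))" for l
      using knots_equal_between[OF True] that by blast
    define u where "u = y i - t"
    have y1: "y (i + 1) = y i" and y2: "y (i + 1) = y (i + 1 + int (Suc r))"
      using eq[of "i + 1"] eq[of "i + 1 + int (Suc r)"] by simp_all
    have v: "trunc_divdiff k t (i + 1) (Suc r) = real (k choose Suc r) * trunc_power (k - Suc r) u"
      unfolding trunc_divdiff_equal[OF y2] y1 u_def ..
    have w: "u * (real (k choose Suc (Suc r)) * trunc_power (k - Suc (Suc r)) u) =
        real (k choose Suc (Suc r)) * trunc_power (k - Suc r) u"
    proof (cases "Suc r < k")
      case True
      then have "k - Suc r = Suc (k - Suc (Suc r))" by simp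
      then show ?thesis by (metis trunc_power_Suc mult.left_commute)
    next
      case False
      then have "k choose Suc (Suc r) = 0" by (intro binomial_eq_0) simp
      then show ?thesis by (simp only: of_nat_0 mult_zero_left mult_zero_right)
    qed
    have "real (Suc k choose Suc (Suc r)) = real (k choose Suc (Suc r)) + real (k choose Suc r)"
      by simp
    then show ?thesis
      unfolding trunc_divdiff_equal[OF True] v u_def[symmetric] w by (simp only: diff_Suc_Suc distrib_right)
  next
    case False
    define D where "D = y (i + int (Suc (Suc r))) - y i"
    have D: "D \<noteq> 0" using False by (simp add: D_def)
    define a b where "a = trunc_divdiff k t i (Suc r)" and "b = trunc_divdiff k t (i + 1) (Suc r)"
    have d: "trunc_divdiff k t (i + 2) r - trunc_divdiff k t (i + 1) r = (y (i + int (Suc (Suc r))) - y (i + 1)) * b"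
      using trunc_divdiff_diff[of "i + 1" r k t] unfolding b_def by (simp add: add_ac)
    have "D * trunc_divdiff (Suc k) t i (Suc (Suc r)) =
        trunc_divdiff (Suc k) t (i + 1) (Suc r) - trunc_divdiff (Suc k) t i (Suc r)"
      unfolding D_def by (rule trunc_divdiff_diff)
    also have "\<dots> = ((y (i + 1) - t) * b + trunc_divdiff k t (i + 2) r) - ((y i - t) * a + trunc_divdiff k t (i + 1) r)"
      using Suc[of "i + 1"] Suc[of i] unfolding a_def b_def by (simp only: add.assoc one_add_one)
    also have "\<dots> = (y (i + 1) - t) * b - (y i - t) * a + (y (i + int (Suc (Suc r))) - y (i + 1)) * b"
      using d by (simp add: algebra_simps)
    also have "\<dots> = (y i - t) * (b - a) + D * b" by (simp add: D_def algebra_simps)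
    also have "b - a = D * trunc_divdiff k t i (Suc (Suc r))"
      unfolding D_def a_def b_def by (rule trunc_divdiff_diff[symmetric])
    finally have "D * trunc_divdiff (Suc k) t i (Suc (Suc r)) =
        D * ((y i - t) * trunc_divdiff k t i (Suc (Suc r)) + b)"
      by (simp only: distrib_left mult_ac)
    then show ?thesis unfolding b_def by (rule mult_left_cancel[OF D, THEN iffD1])
  qed
qed

text \<open>The difference relation and the product rule combine to the recursion of
  \<open>mspline\<close>. In degree 0 the convention \<open>trunc_power 0 0 = 0\<close> produces the
  interval closed on the left and open on the right.\<close>

lemma trunc_divdiff_eq_mspline: "trunc_divdiff k t j (Suc k) = mspline k y j t"
proof (induction k arbitrary: j)
  case 0
  show ?case
  proof (cases "y j = y (j + 1)")
    case True
    then show ?thesis using trunc_divdiff_equal[of j 1 0 t] by simp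
  next
    case False
    then have "y j < y (j + 1)" using monoD[OF mono_y, of j "j + 1"] by simp
    then show ?thesis by (auto simp: trunc_power_def)
  qed
next
  case (Suc k)
  show ?case
  proof (cases "y j = y (j + int (Suc (Suc k)))")
    case True
    then have "mspline (Suc k) y j t = 0" by (simp add: add_ac)
    moreover have "Suc k choose Suc (Suc k) = 0" by (rule binomial_eq_0) simp
    ultimately show ?thesis
      unfolding trunc_divdiff_equal[OF True, of "Suc k" t] by (simp only: of_nat_0 mult_zero_left)
  next
    case False
    then have lt: "y j < y (j + int k + 2)" using monoD[OF mono_y, of j "j + int k + 2"] by (simp add: add_ac)
    define E where "E = y (j + int k + 2)"
    define a b where "a = mspline k y j t" and "b = mspline k y (j + 1) t"
    define d d' where "d = trunc_divdiff k t j (Suc (Suc k))" and "d' = trunc_divdiff (Suc k) t j (Suc (Suc k))"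
    have E: "y (j + int (Suc (Suc k))) = E" by (simp add: E_def add_ac)
    have 1: "(E - y j) * d = b - a"
      using trunc_divdiff_diff[of j "Suc k" k t] unfolding Suc E a_def b_def d_def .
    have d': "d' = (y j - t) * d + b"
      using trunc_divdiff_Leibniz[of k t j "Suc k"] unfolding Suc b_def d_def d'_def .
    have "(E - y j) * d' = (y j - t) * ((E - y j) * d) + (E - y j) * b"
      unfolding d' by (simp add: algebra_simps)
    also have "\<dots> = (y j - t) * (b - a) + (E - y j) * b" unfolding 1 ..
    also have "\<dots> = (t - y j) * a + (E - t) * b" by (simp add: algebra_simps)
    finally have "d' = ((t - y j) * a + (E - t) * b) / (E - y j)"
      using lt by (simp add: E_def eq_divide_eq mult.commute)
    also have "\<dots> = mspline (Suc k) y j t" using lt by (simp add: a_def b_def E_def)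
    finally show ?thesis unfolding d'_def .
  qed
qed

end

lemma divdiff_cong:
  assumes "\<And>l. i \<le> l \<Longrightarrow> l \<le> i + int r \<Longrightarrow> x l = y l"
  shows "divdiff f x i r = divdiff f y i r"
  using assms
proof (induction r arbitrary: i)
  case (Suc r)
  have "divdiff f x (i + 1) r = divdiff f y (i + 1) r" "divdiff f x i r = divdiff f y i r"
    using Suc.prems by (auto intro!: Suc.IH)
  moreover have "x i = y i" "x (i + int (Suc r)) = y (i + int (Suc r))" using Suc.prems by auto
  ultimately show ?case by simp
qed simp

text \<open>One recursion step followed by an index shift in the second term. The bounds on
  \<open>a\<close> and \<open>b\<close> make the splines of lower degree at both ends vanish at
  \<open>t\<close>, so no boundary terms remain.\<close>

lemma mspline_weighted_sum:
  assumes y: "mono y" "y m \<le> t" "t < y (m + 1)" and ab: "a \<le> m - int (Suc k)" "m \<le> b"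
  shows "(\<Sum>j=a..b. c j * ((y (j + int k + 2) - y j) * mspline (Suc k) y j t)) =
    (\<Sum>j=a..b. (c j * (t - y j) + c (j - 1) * (y (j + int k + 1) - t)) * mspline k y j t)"
proof -
  have z: "mspline k y a t = 0" "mspline k y (b + 1) t = 0"
    using mspline_support[OF y(1), of k a t] mspline_support[OF y(1), of k "b + 1" t]
      monoD[OF y(1), of "a + int k + 1" m] monoD[OF y(1), of "m + 1" "b + 1"] y ab by fastforce+
  define h where "h j = c (j - 1) * (y (j + int k + 1) - t) * mspline k y j t" for j
  have "(\<Sum>j=a..b. h (j + 1)) = (\<Sum>j=a+1..b+1. h j)"
    by (rule sum.reindex_bij_witness[of _ "\<lambda>j. j - 1" "\<lambda>j. j + 1"]) auto
  also have "\<dots> = (\<Sum>j=a..b. h j)"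
  proof -
    have "(\<Sum>j=a+1..b+1. h j) = (\<Sum>j=a..b+1. h j)"
    proof (intro sum.mono_neutral_left ballI)
      fix i assume "i \<in> {a..b + 1} - {a + 1..b + 1}"
      then have "i = a" by auto
      then show "h i = 0" using z by (simp add: h_def)
    qed auto
    also have "\<dots> = (\<Sum>j=a..b. h j)"
    proof (intro sum.mono_neutral_right ballI)
      fix i assume "i \<in> {a..b + 1} - {a..b}"
      then have "i = b + 1" by auto
      then show "h i = 0" using z by (simp add: h_def)
    qed auto
    finally show ?thesis .
  qed
  finally have h: "(\<Sum>j=a..b. h (j + 1)) = (\<Sum>j=a..b. h j)" .
  have "(\<Sum>j=a..b. c j * ((y (j + int k + 2) - y j) * mspline (Suc k) y j t)) =
      (\<Sum>j=a..b. c j * (t - y j) * mspline k y j t + h (j + 1))"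
    unfolding mspline_rec[OF y(1)] h_def by (intro sum.cong) (auto simp: algebra_simps)
  also have "\<dots> = (\<Sum>j=a..b. c j * (t - y j) * mspline k y j t + h j)"
    by (simp only: sum.distrib h)
  finally show ?thesis by (simp add: h_def distrib_right)
qed

lemma mspline_partition_of_unity:
  assumes y: "mono y" "y m \<le> t" "t < y (m + 1)" and ab: "a \<le> m - int k" "m \<le> b"
  shows "(\<Sum>j=a..b. (y (j + int k + 1) - y j) * mspline k y j t) = 1"
  using ab
proof (induction k)
  case 0
  have "(\<Sum>j=a..b. (y (j + int 0 + 1) - y j) * mspline 0 y j t) = (\<Sum>j=a..b. if j = m then 1 else 0)"
  proof (intro sum.cong)
    fix j
    show "(y (j + int 0 + 1) - y j) * mspline 0 y j t = (if j = m then 1 else 0)"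
      using y monoD[OF y(1), of "j + 1" m] monoD[OF y(1), of "m + 1" j]
      by (cases j m rule: linorder_cases) auto
  qed simp
  then show ?case using 0 by simp
next
  case (Suc k)
  have "(\<Sum>j=a..b. (y (j + int (Suc k) + 1) - y j) * mspline (Suc k) y j t) =
     (\<Sum>j=a..b. 1 * ((y (j + int k + 2) - y j) * mspline (Suc k) y j t))"
    by (intro sum.cong) (auto simp del: mspline.simps simp: add_ac)
  also have "\<dots> = (\<Sum>j=a..b. (y (j + int k + 1) - y j) * mspline k y j t)"
    unfolding mspline_weighted_sum[OF y Suc.prems] by (intro sum.cong) auto
  finally show ?case using Suc by simp
qed

lemma mspline_linear_reproduction:
  assumes y: "mono y" "y m \<le> t" "t < y (m + 1)" and ab: "a \<le> m - int k" "m \<le> b"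
  shows "(\<Sum>j=a..b. (\<Sum>i=j+1..j+int k. y i) * ((y (j + int k + 1) - y j) * mspline k y j t)) = real k * t"
  using ab
proof (induction k)
  case 0
  then show ?case by simp
next
  case (Suc k)
  define c where "c j = (\<Sum>i=j+1..j+int (Suc k). y i)" for j
  define s where "s j = (\<Sum>i=j+1..j+int k. y i)" for j
  have c1: "c j = s j + y (j + int k + 1)" for j
  proof -
    have "{j+1..j+int (Suc k)} = insert (j + int k + 1) {j+1..j+int k}" by auto
    then show ?thesis by (simp add: c_def s_def)
  qed
  have c2: "c (j - 1) = y j + s j" for j
  proof -
    have "{j - 1 + 1..j - 1 + int (Suc k)} = insert j {j+1..j+int k}" by auto
    then show ?thesis by (simp add: c_def s_def)
  qed
  have "(\<Sum>j=a..b. c j * ((y (j + int (Suc k) + 1) - y j) * mspline (Suc k) y j t)) =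
     (\<Sum>j=a..b. c j * ((y (j + int k + 2) - y j) * mspline (Suc k) y j t))"
    by (intro sum.cong) (auto simp del: mspline.simps simp: add_ac)
  \<comment> \<open>Here \<open>s j\<close> is the part common to \<open>c j\<close> and
    \<open>c (j - 1)\<close>; the mixed products of knots cancel, leaving \<open>s j + t\<close>
    times the support length.\<close>
  also have "\<dots> = (\<Sum>j=a..b. s j * ((y (j + int k + 1) - y j) * mspline k y j t) +
      t * ((y (j + int k + 1) - y j) * mspline k y j t))"
    unfolding mspline_weighted_sum[OF y Suc.prems] c2 unfolding c1
    by (intro sum.cong) (auto simp: algebra_simps)
  also have "\<dots> = real k * t + t * 1"
    unfolding sum.distrib sum_distrib_left[symmetric] s_def
    using Suc mspline_partition_of_unity[OF y, of a k b] by simp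
  finally show ?case by (simp add: c_def algebra_simps)
qed

section \<open>The B-spline basis of a clamped knot sequence\<close>

text \<open>The spline lemmas need a sequence monotone on all integers, while the given one is
  constrained only on a finite index range.\<close>

definition extend_knots :: "nat \<Rightarrow> nat \<Rightarrow> (int \<Rightarrow> real) \<Rightarrow> int \<Rightarrow> real" where
  "extend_knots n k x i = (if i < - int k then 0 else if int n + int k < i then 1 else x i)"

text \<open>\<open>mspline\<close> is 0 at the right end of the knots, whereas a B-spline takes its
  left limit there. Facts on \<open>[0,1)\<close> are therefore carried to 1 by continuity.\<close>

lemma continuous_limit_nonneg:
  fixes f :: "real \<Rightarrow> real"
  assumes "continuous_on {0..1} f" "\<And>t. 0 \<le> t \<Longrightarrow> t < 1 \<Longrightarrow> 0 \<le> f t"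
  shows "0 \<le> f 1"
proof (rule tendsto_lowerbound)
  show "(f \<longlongrightarrow> f 1) (at_left 1)" using assms(1) by (intro continuous_on_Icc_at_leftD) auto
  show "\<forall>\<^sub>F t in at_left 1. 0 \<le> f t"
    using eventually_at_left_real[of 0 1] by (auto elim!: eventually_mono intro: assms(2))
qed simp

lemma continuous_limit_zero:
  fixes f :: "real \<Rightarrow> real"
  assumes "continuous_on {0..1} f" "\<And>t. 0 \<le> t \<Longrightarrow> t < 1 \<Longrightarrow> f t = 0"
  shows "f 1 = 0"
  using continuous_limit_nonneg[of f] continuous_limit_nonneg[of "\<lambda>t. - f t"] assms
  by (force intro: continuous_intros)

locale schoenberg_knots =
  fixes n k :: nat and x :: "int \<Rightarrow> real"
  assumes n_pos: "0 < n" and k_pos: "0 < k" and knots: "knot_sequence n k x"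
begin

definition y :: "int \<Rightarrow> real" where "y = extend_knots n k x"

abbreviation \<xi> :: "int \<Rightarrow> real" where "\<xi> \<equiv> greville k x"

lemma y_eq_x: "- int k \<le> i \<Longrightarrow> i \<le> int n + int k \<Longrightarrow> y i = x i"
  by (simp add: y_def extend_knots_def)

lemma y_zero: "i \<le> 0 \<Longrightarrow> y i = 0"
  using knots by (auto simp: y_def extend_knots_def knot_sequence_def)

lemma y_one: "int n \<le> i \<Longrightarrow> y i = 1"
  using knots by (auto simp: y_def extend_knots_def knot_sequence_def)

lemma y_less: 
  assumes "i < j" "0 < j" "i < int n"
  shows "y i < y j"
proof -
  have st: "y a < y b" if "0 \<le> a" "a < b" "b \<le> int n" for a b
    using knots that by (auto simp: y_eq_x knot_sequence_def strict_mono_on_def)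
  have "y i = y (max i 0)" "y j = y (min j (int n))"
    using y_zero[of i] y_zero[of 0] y_one[of j] y_one[of "int n"] by (auto simp: max_def min_def)
  then show ?thesis using st[of "max i 0" "min j (int n)"] assms n_pos by auto
qed

lemma mono_y: "mono y"
proof (rule monoI)
  fix i j :: int assume "i \<le> j"
  consider "j \<le> 0" | "int n \<le> i" | "i = j" | "i < j" "0 < j" "i < int n" using \<open>i \<le> j\<close> by linarith
  then show "y i \<le> y j"
    by cases (use \<open>i \<le> j\<close> in \<open>auto simp: y_zero y_one intro: less_imp_le[OF y_less]\<close>)
qed

lemma y_pos: "0 < i \<Longrightarrow> 0 < y i"
  using y_less[of 0 i] y_zero[of 0] n_pos by simp

lemma y_less_one: "i < int n \<Longrightarrow> y i < 1"
  using y_less[of i "int n"] y_one[of "int n"] n_pos by simp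

lemma interior_level:
  assumes "0 < y i" "y i < 1"
  shows "0 < i \<and> i < int n"
  using assms y_zero[of i] y_one[of i] by (force simp: not_less)

section \<open>Position of the Greville nodes\<close>

lemma greville_eq: 
  assumes "- int k \<le> j" "j < int n"
  shows "\<xi> j = (\<Sum>i=j+1..j+int k. y i) / real k"
  unfolding greville_def using assms by (auto intro!: sum.cong simp: y_eq_x)

lemma greville_less:
  assumes "- int k \<le> i" "i < j" "j < int n"
  shows "\<xi> i < \<xi> j"
proof -
  \<comment> \<open>An offset in \<open>{1..int k}\<close> with \<open>0 < j + l\<close> and
    \<open>i + l < int n\<close>, so that the two knots compared there are not both clamped at the
    same end.\<close>
  define l where "l = max 1 (1 - j)"
  have l: "i + l < int n" "1 \<le> l" "l \<le> int k" "0 < j + l"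
    using assms n_pos k_pos by (auto simp: l_def max_def)
  have "(\<Sum>a=1..int k. y (i + a)) < (\<Sum>a=1..int k. y (j + a))"
  proof (rule sum_strict_mono_ex1)
    show "\<forall>a\<in>{1..int k}. y (i + a) \<le> y (j + a)" using assms by (auto intro: monoD[OF mono_y])
    show "\<exists>a\<in>{1..int k}. y (i + a) < y (j + a)"
      using assms l by (intro bexI[of _ l] y_less) auto
  qed simp
  moreover have "(\<Sum>a=1..int k. y (m + a)) = (\<Sum>a=m+1..m+int k. y a)" for m
    by (rule sum.reindex_bij_witness[of _ "\<lambda>a. a - m" "\<lambda>a. m + a"]) auto
  ultimately show ?thesis using assms k_pos by (simp add: greville_eq divide_strict_right_mono)
qed

lemma greville_first: "\<xi> (- int k) = 0"
proof -
  have "(\<Sum>i=- int k+1..- int k+int k. y i) = 0" by (intro sum.neutral) (auto simp: y_zero)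
  then show ?thesis using n_pos by (simp add: greville_eq)
qed

lemma greville_last: "\<xi> (int n - 1) = 1"
proof -
  have "(\<Sum>i=int n - 1+1..int n - 1+int k. y i) = (\<Sum>i=int n - 1+1..int n - 1+int k. 1)"
    by (intro sum.cong) (auto simp: y_one)
  then show ?thesis using n_pos k_pos by (simp add: greville_eq)
qed

lemma greville_interior:
  assumes "1 < k" "- int k < j" "j < int n - 1"
  shows "y (j + 1) < \<xi> j" "\<xi> j < y (j + int k)"
proof -
  have lt: "y (j + 1) < y (j + int k)" using assms by (intro y_less) auto
  have "(\<Sum>i=j+1..j+int k. y (j + 1)) < (\<Sum>i=j+1..j+int k. y i)"
  proof (rule sum_strict_mono_ex1)
    show "\<exists>i\<in>{j+1..j+int k}. y (j + 1) < y i" using lt assms by (intro bexI[of _ "j + int k"]) auto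
  qed (auto intro: monoD[OF mono_y])
  then show "y (j + 1) < \<xi> j" using assms by (simp add: greville_eq field_simps)
  have "(\<Sum>i=j+1..j+int k. y i) < (\<Sum>i=j+1..j+int k. y (j + int k))"
  proof (rule sum_strict_mono_ex1)
    show "\<exists>i\<in>{j+1..j+int k}. y i < y (j + int k)" using lt assms by (intro bexI[of _ "j + 1"]) auto
  qed (auto intro: monoD[OF mono_y])
  then show "\<xi> j < y (j + int k)" using assms by (simp add: greville_eq field_simps)
qed

text \<open>Interior knots are simple, so knots coincide only at 0 or 1. At 0 the truncated power
  vanishes for \<open>t \<ge> 0\<close>, at 1 it is a polynomial for \<open>t < 1\<close>. Order 0
  uses \<open>k > 0\<close>.\<close>

lemma divdiff_continuous:
  "\<exists>g. continuous_on {0..1} g \<and> (\<forall>t\<in>{0..<1}. divdiff (\<lambda>s. trunc_power k (s - t)) y i r = g t)"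
proof (induction r arbitrary: i)
  case 0
  have "trunc_power k u = (max 0 u) ^ k" for u using k_pos by (auto simp: trunc_power_def max_def)
  then show ?case by (intro exI[of _ "\<lambda>t. (max 0 (y i - t)) ^ k"]) (auto intro!: continuous_intros)
next
  case (Suc r)
  show ?case
  proof (cases "y i = y (i + int (Suc r))")
    case True
    note eq = trunc_divdiff_equal[OF mono_y True]
    have "i \<le> - 1 \<or> int n \<le> i"
      using y_less[of i "i + int (Suc r)"] True by fastforce
    then show ?thesis
    proof
      assume "i \<le> - 1"
      then have "y i = 0" by (simp add: y_zero)
      then show ?thesis unfolding eq by (intro exI[of _ "\<lambda>t. 0"]) (auto simp: trunc_power_def)
    next
      assume "int n \<le> i"
      then have "y i = 1" by (simp add: y_one)
      then show ?thesis unfolding eq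
        by (intro exI[of _ "\<lambda>t. real (k choose Suc r) * (1 - t) ^ (k - Suc r)"])
           (auto simp: trunc_power_def intro!: continuous_intros)
    qed
  next
    case False
    obtain g h where "continuous_on {0..1} g" "\<forall>t\<in>{0..<1}. divdiff (\<lambda>s. trunc_power k (s - t)) y i r = g t"
      "continuous_on {0..1} h" "\<forall>t\<in>{0..<1}. divdiff (\<lambda>s. trunc_power k (s - t)) y (i + 1) r = h t"
      using Suc[of i] Suc[of "i + 1"] by blast
    then show ?thesis using False
      by (intro exI[of _ "\<lambda>t. (h t - g t) / (y (i + int (Suc r)) - y i)"]) (auto intro!: continuous_intros)
  qed
qed

section \<open>Normalized B-splines on the unit interval\<close>

definition N :: "int \<Rightarrow> real \<Rightarrow> real" where "N = bspline k x"

lemma bspline_formula_eq: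
  assumes "- int k \<le> j" "j < int n"
  shows "bspline_formula k x j t = (y (j + int k + 1) - y j) * mspline k y j t"
proof -
  have "divdiff (\<lambda>s. trunc_power k (s - t)) x j (k + 1) = divdiff (\<lambda>s. trunc_power k (s - t)) y j (k + 1)"
    using assms by (intro divdiff_cong) (auto simp: y_eq_x)
  also have "\<dots> = mspline k y j t" using trunc_divdiff_eq_mspline[OF mono_y, of k t j] by simp
  finally show ?thesis using assms by (simp add: bspline_formula_def y_eq_x)
qed

lemma N_eq:
  assumes "- int k \<le> j" "j < int n" "t < 1"
  shows "N j t = (y (j + int k + 1) - y j) * mspline k y j t"
  using bspline_formula_eq[OF assms(1,2)] assms(3) by (simp add: N_def bspline_def)

lemma N_continuous:
  assumes "- int k \<le> j" "j < int n"
  shows "continuous_on {0..1} (N j)"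
proof -
  obtain g where g: "continuous_on {0..1} g"
    "\<And>t. t \<in> {0..<1} \<Longrightarrow> divdiff (\<lambda>s. trunc_power k (s - t)) y j (Suc k) = g t"
    using divdiff_continuous by metis
  define h where "h t = (y (j + int k + 1) - y j) * g t" for t
  have h: "continuous_on {0..1} h" unfolding h_def by (intro continuous_intros g)
  have f: "bspline_formula k x j t = h t" if "t \<in> {0..<1}" for t
    using bspline_formula_eq[OF assms] g(2)[OF that] trunc_divdiff_eq_mspline[OF mono_y, of k t j]
    by (simp only: h_def)
  have "\<forall>\<^sub>F t in at_left 1. h t = bspline_formula k x j t"
    using eventually_at_left_real[of 0 1] by (auto elim!: eventually_mono simp: f)
  moreover have "(h \<longlongrightarrow> h 1) (at_left 1)" using h by (intro continuous_on_Icc_at_leftD) auto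
  ultimately have "(bspline_formula k x j \<longlongrightarrow> h 1) (at_left 1)" by (rule Lim_transform_eventually[rotated])
  then have "Lim (at_left 1) (bspline_formula k x j) = h 1" by (intro tendsto_Lim) auto
  then have "N j t = h t" if "t \<in> {0..1}" for t using that f by (auto simp: N_def bspline_def)
  then show ?thesis using h continuous_on_cong by metis
qed

lemma N_nonneg:
  assumes "- int k \<le> j" "j < int n" "0 \<le> t" "t \<le> 1"
  shows "0 \<le> N j t"
proof -
  have "0 \<le> N j t" if "t < 1" for t
    using N_eq[OF assms(1,2) that] mspline_nonneg[OF mono_y] monoD[OF mono_y, of j "j + int k + 1"] by simp
  then show ?thesis using continuous_limit_nonneg[OF N_continuous[OF assms(1,2)]] assms
    by (cases "t = 1") auto
qed

lemma knot_interval: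
  assumes "0 \<le> t" "t < 1"
  obtains m where "y m \<le> t" "t < y (m + 1)" "0 \<le> m" "m < int n"
proof -
  obtain m where m: "y m \<le> t" "t < y (m + 1)"
    using mono_int_crossing[OF mono_y, of 0 t "int n"] assms y_zero[of 0] y_one[of "int n"] by auto
  moreover have "0 \<le> m" using m y_zero[of "m + 1"] assms by force
  moreover have "m < int n" using m y_one[of m] assms by force
  ultimately show ?thesis using that by blast
qed

lemma N_partition:
  assumes "0 \<le> t" "t \<le> 1"
  shows "(\<Sum>j=- int k..int n - 1. N j t) = 1"
proof -
  have less: "(\<Sum>j=- int k..int n - 1. N j t) = 1" if t: "0 \<le> t" "t < 1" for t
  proof -
    obtain m where m: "y m \<le> t" "t < y (m + 1)" "0 \<le> m" "m < int n" using knot_interval t by blast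
    have "(\<Sum>j=- int k..int n - 1. N j t) = (\<Sum>j=- int k..int n - 1. (y (j + int k + 1) - y j) * mspline k y j t)"
      using t by (intro sum.cong) (auto simp: N_eq)
    then show ?thesis using mspline_partition_of_unity[OF mono_y m(1,2), of "- int k" k "int n - 1"] m by simp
  qed
  have "(\<Sum>j=- int k..int n - 1. N j 1) - 1 = 0"
    by (rule continuous_limit_zero[where f = "\<lambda>t. (\<Sum>j=- int k..int n - 1. N j t) - 1"])
       (auto intro!: continuous_intros N_continuous simp: less)
  then show ?thesis using less assms by (cases "t = 1") auto
qed

lemma N_linear:
  assumes "0 \<le> t" "t \<le> 1"
  shows "(\<Sum>j=- int k..int n - 1. \<xi> j * N j t) = t"
proof -
  have less: "(\<Sum>j=- int k..int n - 1. \<xi> j * N j t) = t" if t: "0 \<le> t" "t < 1" for t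
  proof -
    obtain m where m: "y m \<le> t" "t < y (m + 1)" "0 \<le> m" "m < int n" using knot_interval t by blast
    have "(\<Sum>j=- int k..int n - 1. \<xi> j * N j t) = 
        (\<Sum>j=- int k..int n - 1. (\<Sum>i=j+1..j+int k. y i) * ((y (j + int k + 1) - y j) * mspline k y j t)) / real k"
      unfolding sum_divide_distrib using t by (intro sum.cong) (auto simp: N_eq greville_eq)
    also have "\<dots> = real k * t / real k"
      using mspline_linear_reproduction[OF mono_y m(1,2), of "- int k" k "int n - 1"] m by simp
    finally show ?thesis using k_pos by simp
  qed
  have "(\<Sum>j=- int k..int n - 1. \<xi> j * N j 1) - 1 = 0"
    by (rule continuous_limit_zero[where f = "\<lambda>t. (\<Sum>j=- int k..int n - 1. \<xi> j * N j t) - t"])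
       (auto intro!: continuous_intros N_continuous simp: less)
  then show ?thesis using less assms by (cases "t = 1") auto
qed

text \<open>At \<open>t = 0\<close> and \<open>t = 1\<close> the convex combination \<open>\<Sum>\<^sub>j \<xi>\<^sub>j N\<^sub>j(t) = t\<close> is an extreme point of
  \<open>[0,1]\<close>, so only the end node can carry weight.\<close>

lemma N_at_ends:
  assumes "- int k \<le> j" "j < int n"
  shows "N j 0 = (if j = - int k then 1 else 0)" "N j 1 = (if j = int n - 1 then 1 else 0)"
proof -
  have pos: "0 < \<xi> j" if "- int k < j" "j < int n" for j
    using greville_less[of "- int k" j] that greville_first by simp
  have lt: "\<xi> j < 1" if "- int k \<le> j" "j < int n - 1" for j
    using greville_less[of j "int n - 1"] that greville_last by simp
  have ge: "0 \<le> \<xi> j" "\<xi> j \<le> 1" if "- int k \<le> j" "j < int n" for j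
    using pos[of j] lt[of j] greville_first greville_last that by (cases "j = - int k"; cases "j = int n - 1"; force)+
  have 0: "N j 0 = 0" if "- int k < j" "j < int n" for j
  proof -
    have "\<xi> j * N j 0 = 0"
      using sum_nonneg_eq_0_iff[of "{- int k..int n - 1}" "\<lambda>j. \<xi> j * N j 0"]
        N_linear[of 0] that ge N_nonneg[of _ 0] by auto
    then show ?thesis using pos[OF that] by simp
  qed
  have 1: "N j 1 = 0" if "- int k \<le> j" "j < int n - 1" for j
  proof -
    have "(\<Sum>j=- int k..int n - 1. (1 - \<xi> j) * N j 1) = 0"
      using N_linear[of 1] N_partition[of 1] by (simp add: left_diff_distrib sum_subtractf)
    then have "(1 - \<xi> j) * N j 1 = 0"
      using sum_nonneg_eq_0_iff[of "{- int k..int n - 1}" "\<lambda>j. (1 - \<xi> j) * N j 1"]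
        that ge N_nonneg[of _ 1] by auto
    then show ?thesis using lt[OF that] by simp
  qed
  have "(\<Sum>j=- int k..int n - 1. N j 0) = (\<Sum>j=- int k..int n - 1. if j = - int k then N (- int k) 0 else 0)"
    by (intro sum.cong) (auto intro: 0)
  then have "N (- int k) 0 = 1" using N_partition[of 0] n_pos by simp
  then show "N j 0 = (if j = - int k then 1 else 0)" using 0 assms by auto
  have "(\<Sum>j=- int k..int n - 1. N j 1) = (\<Sum>j=- int k..int n - 1. if j = int n - 1 then N (int n - 1) 1 else 0)"
    by (intro sum.cong) (auto intro: 1)
  then have "N (int n - 1) 1 = 1" using N_partition[of 1] n_pos by simp
  then show "N j 1 = (if j = int n - 1 then 1 else 0)" using 1 assms by auto
qed

end

section \<open>The interior collocation matrix\<close>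

context schoenberg_knots
begin

text \<open>The number of interior nodes, that is, all \<open>n + k\<close> nodes except the two
  ends.\<close>

definition d :: nat where "d = n + k - 2"

definition node :: "nat \<Rightarrow> int" where "node i = int i - int k + 1"

abbreviation \<tau> :: "nat \<Rightarrow> real" where "\<tau> i \<equiv> \<xi> (node i)"

definition coll :: "nat \<Rightarrow> nat \<Rightarrow> real" where "coll i l = N (node l) (\<tau> i)"

lemma node_bounds: "i < d \<Longrightarrow> - int k < node i \<and> node i < int n - 1"
  using n_pos k_pos by (auto simp: node_def d_def)

lemma tau_less: "i < j \<Longrightarrow> j < d \<Longrightarrow> \<tau> i < \<tau> j"
  using node_bounds[of i] node_bounds[of j] by (intro greville_less) (auto simp: node_def)

lemma tau_inj: "i < d \<Longrightarrow> j < d \<Longrightarrow> \<tau> i = \<tau> j \<longleftrightarrow> i = j"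
  using tau_less[of i j] tau_less[of j i] by (cases i j rule: linorder_cases) auto

lemma tau_range: "i < d \<Longrightarrow> 0 < \<tau> i \<and> \<tau> i < 1"
  using node_bounds[of i] greville_less[of "- int k" "node i"] greville_less[of "node i" "int n - 1"]
    greville_first greville_last by simp

lemma sum_node: "(\<Sum>j=- int k + 1..int n - 2. g j) = (\<Sum>l<d. g (node l))"
  by (rule sum.reindex_bij_witness[of _ node "\<lambda>j. nat (j + int k - 1)"]) (auto simp: node_def d_def)

definition width :: "int \<Rightarrow> real" where "width j = y (j + int k + 1) - y j"

lemma coll_eq: "i < d \<Longrightarrow> l < d \<Longrightarrow> coll i l = width (node l) * mspline k y (node l) (\<tau> i)"
  using node_bounds[of l] tau_range[of i] by (simp add: coll_def width_def N_eq)

lemma width_pos: "l < d \<Longrightarrow> 0 < width (node l)"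
  using y_less[of "node l" "node l + int k + 1"] node_bounds[of l] by (simp add: width_def)

text \<open>Interior nodes lie in the open unit interval, where all knots are simple.\<close>

lemma admissible_nodes: "admissible k (\<tau> ` {..<d}) y"
proof -
  have "card {j. y j = \<tau> i} \<le> k" if i: "i < d" for i
  proof (cases "{j. y j = \<tau> i} = {}")
    case True
    then show ?thesis by (simp only: card.empty le0)
  next
    case False
    then obtain j where j: "y j = \<tau> i" by blast
    have "l = j" if "y l = \<tau> i" for l
    proof -
      have "0 < j \<and> j < int n" "0 < l \<and> l < int n"
        using interior_level tau_range[OF i] j that by auto
      then show ?thesis using y_less[of l j] y_less[of j l] j that by (cases l j rule: linorder_cases) auto
    qed
    then have "{j. y j = \<tau> i} \<subseteq> {j}" by blast
    from card_mono[OF _ this] show ?thesis using k_pos by simp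
  qed
  moreover have "y 0 < \<tau> i" "\<tau> i < y (int n)" if "i < d" for i
    using tau_range[OF that] y_zero[of 0] y_one[of "int n"] by simp_all
  ultimately show ?thesis using mono_y unfolding admissible_def ball_simps by blast
qed

lemma coll_alternation:
  assumes "alternation (lin d coll v) {..<d} s p"
  shows "alternation v {..<d} s p"
proof -
  \<comment> \<open>Coefficients with respect to \<open>mspline\<close>. The positive factor
    \<open>width\<close> leaves signs unchanged, and the two end splines get coefficient 0.\<close>
  define c where "c j = (if - int k < j \<and> j < int n - 1 then width j * v (nat (j + int k - 1)) else 0)" for j
  have cn: "c (node l) = width (node l) * v l" if "l < d" for l
    using node_bounds[OF that] by (simp add: c_def node_def)
  have eq: "lin d coll v i = (\<Sum>j=- int k + 1..int n - 2. c j * mspline k y j (\<tau> i))" if "i < d" for i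
    unfolding sum_node lin_def using that by (intro sum.cong) (auto simp: cn coll_eq)
  have "alternation (\<lambda>t. \<Sum>j=- int k + 1..int n - 2. c j * mspline k y j t) (\<tau> ` {..<d}) s p"
  proof (rule alternation_transport[OF _ _ assms, where R = "\<lambda>i t. i < d \<and> t = \<tau> i"])
    fix i assume i: "i \<in> {..<d}" "lin d coll v i \<noteq> 0"
    then have "0 < lin d coll v i * lin d coll v i" using not_real_square_gt_zero by blast
    then have "0 < lin d coll v i * (\<Sum>j=- int k + 1..int n - 2. c j * mspline k y j (\<tau> i))"
      using eq[of i] i by simp
    then show "\<exists>t\<in>\<tau> ` {..<d}. 0 < lin d coll v i * (\<Sum>j=- int k + 1..int n - 2. c j * mspline k y j t) \<and> i < d \<and> t = \<tau> i"
      using i by blast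
  qed (auto dest: tau_less)
  then have "alternation c UNIV s p"
    by (rule spline_alternation[OF _ admissible_nodes k_pos, rotated 2]) (auto simp: c_def)
  then show ?thesis
  proof (rule alternation_transport[where R = "\<lambda>j l. j = node l", rotated 2])
    fix j assume "c j \<noteq> 0"
    then have j: "- int k < j" "j < int n - 1" "width j * v (nat (j + int k - 1)) \<noteq> 0"
      by (auto simp: c_def split: if_splits)
    define l where "l = nat (j + int k - 1)"
    have l: "l < d" "j = node l" using j by (auto simp: l_def node_def d_def)
    have "v l \<noteq> 0" using j by (simp add: l_def)
    then have "0 < v l * v l" using not_real_square_gt_zero by blast
    then have "0 < c j * v l" using cn[OF l(1)] l width_pos[OF l(1)] by (simp add: mult.assoc)
    then show "\<exists>l\<in>{..<d}. 0 < c j * v l \<and> j = node l" using l by blast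
  qed (auto simp: node_def)
qed

lemma coll_transpose_alternation:
  assumes "alternation (lin d (\<lambda>i j. coll j i) v) {..<d} s p"
  shows "alternation v {..<d} s p"
proof -
  define w where "w t = v (the_inv_into {..<d} \<tau> t)" for t
  have inj: "inj_on \<tau> {..<d}" using tau_inj by (auto simp: inj_on_def)
  have w: "w (\<tau> i) = v i" if "i < d" for i
    using the_inv_into_f_f[OF inj, of i] that by (simp add: w_def)
  have eq: "lin d (\<lambda>i j. coll j i) v l = width (node l) * (\<Sum>t\<in>\<tau> ` {..<d}. w t * mspline k y (node l) t)" if "l < d" for l
    unfolding lin_def sum.reindex[OF inj] sum_distrib_left
    using that by (intro sum.cong) (auto simp: w coll_eq)
  have "alternation (\<lambda>j. \<Sum>t\<in>\<tau> ` {..<d}. w t * mspline k y j t) UNIV s p"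
  proof (rule alternation_transport[OF _ _ assms, where R = "\<lambda>i j. j = node i"])
    fix l assume l: "l \<in> {..<d}" "lin d (\<lambda>i j. coll j i) v l \<noteq> 0"
    define g where "g = (\<Sum>t\<in>\<tau> ` {..<d}. w t * mspline k y (node l) t)"
    have e: "lin d (\<lambda>i j. coll j i) v l = width (node l) * g" using eq[of l] l by (simp add: g_def)
    then have "g \<noteq> 0" using l by auto
    then have "0 < g * g" using not_real_square_gt_zero by blast
    then have "0 < lin d (\<lambda>i j. coll j i) v l * g" using e width_pos[of l] l by (simp add: mult.assoc)
    then show "\<exists>j\<in>UNIV. 0 < lin d (\<lambda>i j. coll j i) v l * (\<Sum>t\<in>\<tau> ` {..<d}. w t * mspline k y j t) \<and> j = node l"
      by (auto simp: g_def)
  qed (auto simp: node_def)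
  then have "alternation w (\<tau> ` {..<d}) s p"
    by (rule spline_dual_alternation[OF _ admissible_nodes k_pos, rotated]) auto
  then show ?thesis
  proof (rule alternation_transport[where R = "\<lambda>t i. i < d \<and> t = \<tau> i", rotated 2])
    fix t assume "t \<in> \<tau> ` {..<d}" "w t \<noteq> 0"
    then obtain i where i: "i < d" "t = \<tau> i" "v i \<noteq> 0" using w by auto
    have "0 < v i * v i" using i(3) not_real_square_gt_zero by blast
    then have "0 < w t * v i" using w i by simp
    then show "\<exists>i\<in>{..<d}. 0 < w t * v i \<and> i < d \<and> t = \<tau> i" using i by blast
  next
    fix t t' i i' assume "t < t'" "i < d \<and> t = \<tau> i" "i' < d \<and> t' = \<tau> i'"
    then show "i \<le> i'" using tau_less[of i' i] by (cases "i \<le> i'") auto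
  qed
qed

lemma coll_pos:
  assumes "i < d" "l < d" "y (node l) < \<tau> i" "\<tau> i < y (node l + int k + 1)"
  shows "0 < coll i l"
  using coll_eq[OF assms(1,2)] width_pos[OF assms(2)] mspline_pos[OF mono_y assms(3,4)] by simp

text \<open>For \<open>k > 1\<close> the knots averaged in an interior node are not all equal, so
  the mean lies strictly between the outer two. The assumption turns \<open>k = 1\<close> into the
  vacuous case \<open>d = 0\<close>.\<close>

lemma tau_between:
  assumes "k = 1 \<longrightarrow> n = 1" "i < d"
  shows "y (node i + 1) < \<tau> i" "\<tau> i < y (node i + int k)"
proof -
  have "1 < k"
  proof (rule ccontr)
    assume "\<not> 1 < k"
    then have "d = 0" unfolding d_def using assms(1) k_pos by auto
    then show False using assms(2) by simp
  qed
  then show "y (node i + 1) < \<tau> i" "\<tau> i < y (node i + int k)"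
    using node_bounds[OF assms(2)] by (auto intro: greville_interior)
qed

lemma coll_tridiagonal_pos:
  assumes "k = 1 \<longrightarrow> n = 1"
  shows "i < d \<Longrightarrow> 0 < coll i i" "Suc i < d \<Longrightarrow> 0 < coll i (Suc i)" "Suc i < d \<Longrightarrow> 0 < coll (Suc i) i"
proof -
  have le: "y (node i) \<le> y (node i + 1)" "y (node i + int k) \<le> y (node i + int k + 1)" for i
    by (auto intro: monoD[OF mono_y])
  note b = tau_between[OF assms]
  show "0 < coll i i" if "i < d"
    using b[OF that] le[of i] that by (intro coll_pos) auto
  have S: "node (Suc i) = node i + 1" for i by (simp add: node_def)
  show "0 < coll i (Suc i)" if "Suc i < d"
  proof (rule coll_pos)
    show "\<tau> i < y (node (Suc i) + int k + 1)"
      using b(2)[of i] that monoD[OF mono_y, of "node i + int k" "node (Suc i) + int k + 1"] S by simp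
  qed (use b(1)[of i] that S in auto)
  show "0 < coll (Suc i) i" if "Suc i < d"
  proof (rule coll_pos)
    show "y (node i) < \<tau> (Suc i)"
      using b(1)[OF that] monoD[OF mono_y, of "node i" "node (Suc i) + 1"] S by simp
    show "\<tau> (Suc i) < y (node i + int k + 1)"
      using b(2)[OF that] S by (simp add: add_ac)
  qed (use that in auto)
qed

text \<open>The Schoenberg-Whitney condition holds: each node lies strictly inside the support of
  the spline with its own index.\<close>

lemma coll_det_pos:
  assumes "k = 1 \<longrightarrow> n = 1"
  shows "0 < column_det d (\<lambda>i l. mspline k y (node i) (\<tau> l))"
proof -
  have "y (node i) < \<tau> i \<and> \<tau> i < y (node i + int k + 1)" if "i < d" for i
    using tau_between[OF assms that] monoD[OF mono_y, of "node i" "node i + 1"]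
      monoD[OF mono_y, of "node i + int k" "node i + int k + 1"] by simp
  then show ?thesis
    using collocation_det[OF tau_less admissible_nodes k_pos, of node] by (simp add: node_def)
qed

lemma coll_oscillating:
  assumes "k = 1 \<longrightarrow> n = 1"
  shows "oscillating d coll" "oscillating d (\<lambda>i j. coll j i)"
proof -
  note pos = coll_tridiagonal_pos[OF assms]
  note det = coll_det_pos[OF assms]
  have "v i = 0" if z: "\<forall>i<d. lin d coll v i = 0" and "i < d" for v i
  proof -
    have "width (node i) * v i = 0"
    proof (rule column_det_kernel[OF _ _ \<open>i < d\<close>, where v = "\<lambda>i. width (node i) * v i"])
      show "column_det d (\<lambda>i l. mspline k y (node i) (\<tau> l)) \<noteq> 0" using det by simp
      fix l assume "l < d"
      then have "lin d coll v l = (\<Sum>i<d. mspline k y (node i) (\<tau> l) * (width (node i) * v i))"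
        unfolding lin_def by (intro sum.cong) (auto simp: coll_eq)
      then show "(\<Sum>i<d. mspline k y (node i) (\<tau> l) * (width (node i) * v i)) = 0" using z \<open>l < d\<close> by simp
    qed
    then show ?thesis using width_pos[OF \<open>i < d\<close>] by simp
  qed
  then show "oscillating d coll"
    unfolding oscillating_def using pos coll_alternation by (intro conjI allI impI) auto
  have "v i = 0" if z: "\<forall>i<d. lin d (\<lambda>i j. coll j i) v i = 0" and "i < d" for v i
  proof (rule column_det_kernel[OF _ _ \<open>i < d\<close>])
    show "column_det d (\<lambda>i l. mspline k y (node l) (\<tau> i)) \<noteq> 0"
      using det column_det_transpose[of d "\<lambda>i l. mspline k y (node i) (\<tau> l)"] by simp
    fix l assume l: "l < d"
    then have "lin d (\<lambda>i j. coll j i) v l = width (node l) * (\<Sum>i<d. mspline k y (node l) (\<tau> i) * v i)"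
      unfolding lin_def sum_distrib_left by (intro sum.cong) (auto simp: coll_eq)
    then show "(\<Sum>i<d. mspline k y (node l) (\<tau> i) * v i) = 0" using z l width_pos[OF l] by simp
  qed
  then show "oscillating d (\<lambda>i j. coll j i)"
    unfolding oscillating_def using pos coll_transpose_alternation by (intro conjI allI impI) auto
qed

text \<open>Row sums are at most 1. At the first index where \<open>\<bar>u i\<bar>\<close> is
  maximal there is a strict loss: in row 0 the first B-spline takes some weight, and in any later
  row the positive subdiagonal entry meets a strictly smaller value.\<close>

lemma coll_eigenvalue_less_one:
  assumes nk: "k = 1 \<longrightarrow> n = 1" and ev: "\<And>i. i < d \<Longrightarrow> (\<Sum>l<d. coll i l * u l) = \<mu> * u i"
    and "r < d" "u r \<noteq> 0"
  shows "\<mu> < 1"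
proof (rule ccontr)
  assume mu: "\<not> \<mu> < 1"
  define M where "M = Max ((\<lambda>i. \<bar>u i\<bar>) ` {..<d})"
  have le: "\<bar>u i\<bar> \<le> M" if "i < d" for i using that by (auto simp: M_def)
  have M0: "0 < M" using le[OF \<open>r < d\<close>] \<open>u r \<noteq> 0\<close> by simp
  have "M \<in> (\<lambda>i. \<bar>u i\<bar>) ` {..<d}" unfolding M_def using \<open>r < d\<close> by (intro Max_in) auto
  then have ex: "\<exists>i. i < d \<and> \<bar>u i\<bar> = M" by auto
  define i where "i = (LEAST i. i < d \<and> \<bar>u i\<bar> = M)"
  have i: "i < d" "\<bar>u i\<bar> = M" using LeastI_ex[OF ex] by (auto simp: i_def)
  have least: "\<bar>u l\<bar> < M" if "l < i" for l
    using not_less_Least[of l "\<lambda>i. i < d \<and> \<bar>u i\<bar> = M"] that i(1) le[of l] by (force simp: i_def)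
  have t: "0 \<le> \<tau> i" "\<tau> i < 1" using tau_range[OF i(1)] by auto
  have nn: "0 \<le> coll i l" if "l < d" for l
    using node_bounds[OF that] t by (auto simp: coll_def intro!: N_nonneg)
  have Nfirst: "0 \<le> N (- int k) (\<tau> i)" "0 \<le> N (int n - 1) (\<tau> i)" using t n_pos by (auto intro!: N_nonneg)
  have rowsum: "(\<Sum>l<d. coll i l) = 1 - N (- int k) (\<tau> i) - N (int n - 1) (\<tau> i)"
  proof -
    have "{- int k..int n - 1} = insert (- int k) (insert (int n - 1) {- int k + 1..int n - 2})"
      using n_pos k_pos by auto
    then have "1 = N (- int k) (\<tau> i) + (N (int n - 1) (\<tau> i) + (\<Sum>j=- int k + 1..int n - 2. N j (\<tau> i)))"
      using N_partition[of "\<tau> i"] t n_pos k_pos by simp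
    then show ?thesis unfolding sum_node coll_def by simp
  qed
  have "M \<le> \<mu> * M" using mu M0 by simp
  also have "\<dots> = \<bar>\<Sum>l<d. coll i l * u l\<bar>" using ev[OF i(1)] i(2) mu by (simp add: abs_mult)
  also have "\<dots> \<le> (\<Sum>l<d. coll i l * \<bar>u l\<bar>)"
    using nn by (intro order.trans[OF sum_abs] sum_mono) (auto simp: abs_mult)
  also have "\<dots> < M"
  proof (cases i)
    case 0
    have "(\<Sum>l<d. coll i l * \<bar>u l\<bar>) \<le> (\<Sum>l<d. coll i l) * M"
      unfolding sum_distrib_right using nn le by (intro sum_mono mult_left_mono) auto
    also have "\<dots> < 1 * M"
    proof (rule mult_strict_right_mono[OF _ M0])
      have node0: "node i = - int k + 1" using 0 by (simp add: node_def)
      have "y (- int k) < \<tau> i" using y_zero[of "- int k"] tau_range[OF i(1)] by simp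
      moreover have "\<tau> i < y (- int k + int k + 1)"
        using tau_between(2)[OF nk i(1)] node0 by (simp add: add_ac)
      ultimately have "0 < mspline k y (- int k) (\<tau> i)" by (intro mspline_pos mono_y)
      moreover have "y (- int k) < y (- int k + int k + 1)" using y_less[of "- int k" 1] n_pos by simp
      ultimately have "0 < N (- int k) (\<tau> i)" using t n_pos by (simp add: N_eq)
      then show "(\<Sum>l<d. coll i l) < 1" using rowsum Nfirst by simp
    qed
    finally show ?thesis by simp
  next
    case (Suc l)
    have "(\<Sum>l<d. coll i l * \<bar>u l\<bar>) < (\<Sum>l<d. coll i l * M)"
    proof (rule sum_strict_mono_ex1)
      show "\<forall>l\<in>{..<d}. coll i l * \<bar>u l\<bar> \<le> coll i l * M" using nn le by (auto intro: mult_left_mono)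
      have "0 < coll i l" using coll_tridiagonal_pos(3)[OF nk, of l] i(1) Suc by simp
      then show "\<exists>l\<in>{..<d}. coll i l * \<bar>u l\<bar> < coll i l * M"
        using least[of l] Suc i(1) by (intro bexI[of _ l]) auto
    qed simp
    also have "\<dots> \<le> 1 * M"
      unfolding sum_distrib_right[symmetric] using rowsum Nfirst M0 by (intro mult_right_mono) auto
    finally show ?thesis by simp
  qed
  finally show False by simp
qed

end

section \<open>Eigenspaces of the Schoenberg operator\<close>

lemma char_poly_complex_roots:
  fixes b :: "nat \<Rightarrow> nat \<Rightarrow> real"
  assumes "char_poly (Matrix.mat N N (\<lambda>(i, j). b i j)) = (\<Prod>r\<leftarrow>rs. [:- r, 1:])"
  shows "poly (char_poly (Matrix.mat N N (\<lambda>(i, j). complex_of_real (b i j)))) z = 0 \<longleftrightarrow>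
    z \<in> complex_of_real ` set rs"
proof -
  have A: "Matrix.mat N N (\<lambda>(i, j). b i j) \<in> carrier_mat N N" by simp
  have "map_mat complex_of_real (Matrix.mat N N (\<lambda>(i, j). b i j)) =
      Matrix.mat N N (\<lambda>(i, j). complex_of_real (b i j))" by (intro eq_matI) auto
  then have "char_poly (Matrix.mat N N (\<lambda>(i, j). complex_of_real (b i j))) =
      (\<Prod>a\<leftarrow>map complex_of_real rs. [:- a, 1:])"
    using of_real_hom.char_poly_hom[OF A, where ?'a = complex] assms map_of_real_linear_factors[of rs] by simp
  then show ?thesis by (auto simp: poly_prod_list prod_list_zero_iff)
qed

context schoenberg_knots
begin

abbreviation S :: "(real \<Rightarrow> 'a::real_normed_field) \<Rightarrow> real \<Rightarrow> 'a" where
  "S \<equiv> schoenberg n k x"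

text \<open>Polymorphic in the scalars, so that one reduction serves the real and the complex
  operator.\<close>

definition interior_eigenvalue :: "'a::real_normed_field \<Rightarrow> bool" where
  "interior_eigenvalue \<mu> \<longleftrightarrow>
     (\<exists>u. (\<exists>i<d. u i \<noteq> 0) \<and> (\<forall>i<d. (\<Sum>l<d. of_real (coll i l) * u l) = \<mu> * u i))"

lemma greville_range:
  assumes "- int k \<le> j" "j < int n"
  shows "0 \<le> \<xi> j" "\<xi> j \<le> 1"
  using greville_less[of "- int k" j] greville_less[of j "int n - 1"] greville_first greville_last assms
  by (cases "j = - int k"; cases "j = int n - 1"; force)+

lemma S_inside: "0 \<le> t \<Longrightarrow> t \<le> 1 \<Longrightarrow> S f t = (\<Sum>j=- int k..int n - 1. f (\<xi> j) * of_real (N j t))"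
  by (simp add: schoenberg_def N_def)

lemma S_outside: "t \<notin> {0..1} \<Longrightarrow> S f t = 0"
  unfolding schoenberg_def by (rule if_not_P)

lemma S_ends: "S f 0 = f 0" "S f 1 = f 1"
proof -
  have "S f 0 = (\<Sum>j=- int k..int n - 1. if j = - int k then f 0 else 0)"
    unfolding S_inside[of 0, simplified] by (intro sum.cong) (auto simp: N_at_ends greville_first)
  then show "S f 0 = f 0" using n_pos by simp
  have "S f 1 = (\<Sum>j=- int k..int n - 1. if j = int n - 1 then f 1 else 0)"
    unfolding S_inside[of 1, simplified] by (intro sum.cong) (auto simp: N_at_ends greville_last)
  then show "S f 1 = f 1" using n_pos by simp
qed

lemma S_zero_ends:
  assumes "f 0 = 0" "f 1 = 0" "0 \<le> t" "t \<le> 1"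
  shows "S f t = (\<Sum>l<d. f (\<tau> l) * of_real (N (node l) t))"
proof -
  have "S f t = (\<Sum>j=- int k..int n - 1. f (\<xi> j) * of_real (N j t))"
    using assms by (intro S_inside)
  also have "\<dots> = (\<Sum>j=- int k + 1..int n - 2. f (\<xi> j) * of_real (N j t))"
  proof (intro sum.mono_neutral_right ballI)
    fix j assume "j \<in> {- int k..int n - 1} - {- int k + 1..int n - 2}"
    then have "j = - int k \<or> j = int n - 1" by auto
    then have "f (\<xi> j) = 0" using assms greville_first greville_last by auto
    then show "f (\<xi> j) * of_real (N j t) = 0" by simp
  qed auto
  also have "\<dots> = (\<Sum>l<d. f (\<tau> l) * of_real (N (node l) t))" by (rule sum_node)
  finally show ?thesis .
qed

lemma S_diff: "S (\<lambda>t. f t - c * g t) = (\<lambda>t. S f t - c * S g t)"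
  by (auto simp: schoenberg_def fun_eq_iff algebra_simps sum_subtractf sum_distrib_left)

lemma eigenspace_diff:
  assumes "f \<in> eigenspace S \<mu>" "g \<in> eigenspace S \<mu>"
  shows "(\<lambda>t. f t - c * g t) \<in> eigenspace S \<mu>"
  using assms unfolding eigenspace_def C01_def mem_Collect_eq S_diff
  by (auto simp: algebra_simps intro!: continuous_intros)

lemma eigenspace_S: "f \<in> eigenspace S \<mu> \<Longrightarrow> S f t = \<mu> * f t"
  by (auto simp: eigenspace_def dest: fun_cong)

lemma eigenspace_zero_ends:
  assumes "f \<in> eigenspace S \<mu>" "\<mu> \<noteq> 1"
  shows "f 0 = 0" "f 1 = 0"
  using eigenspace_S[OF assms(1), of 0] eigenspace_S[OF assms(1), of 1] assms(2) by (auto simp: S_ends)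

lemma eigenspace_interior:
  assumes "f \<in> eigenspace S \<mu>" "f 0 = 0" "f 1 = 0" "i < d"
  shows "(\<Sum>l<d. of_real (coll i l) * f (\<tau> l)) = \<mu> * f (\<tau> i)"
  using eigenspace_S[OF assms(1), of "\<tau> i"] S_zero_ends[of f "\<tau> i"] assms tau_range[of i]
  by (simp add: coll_def mult.commute)

text \<open>For a nonzero eigenvalue \<open>f\<close> is a multiple of \<open>S f\<close>, which
  depends only on the node values.\<close>

lemma eigenspace_eq_zero:
  assumes "f \<in> eigenspace S \<mu>" "\<mu> \<noteq> 0" "f 0 = 0" "f 1 = 0" "\<And>i. i < d \<Longrightarrow> f (\<tau> i) = 0"
  shows "f = (\<lambda>_. 0)"
proof
  fix t show "f t = 0"
  proof (cases "t \<in> {0..1}")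
    case True
    then have "\<mu> * f t = 0"
      using eigenspace_S[OF assms(1), of t] S_zero_ends[of f t] assms by simp
    then show ?thesis using assms by simp
  qed (use assms in \<open>auto simp: eigenspace_def C01_def\<close>)
qed

lemma eigenspace_extend:
  fixes \<mu> :: "'a::real_normed_field"
  assumes "\<mu> \<noteq> 0" "\<And>i. i < d \<Longrightarrow> (\<Sum>l<d. of_real (coll i l) * u l) = \<mu> * u i"
  obtains f where "f \<in> eigenspace S \<mu>" "\<And>i. i < d \<Longrightarrow> f (\<tau> i) = u i"
proof -
  define f where "f t = (if t \<in> {0..1} then (\<Sum>l<d. u l * of_real (N (node l) t)) / \<mu> else 0)" for t
  have ft: "f (\<tau> i) = u i" if "i < d" for i
    using assms(1) assms(2)[OF that] tau_range[OF that] by (simp add: f_def coll_def mult.commute)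
  have ends: "N (node l) 0 = 0" "N (node l) 1 = 0" if "l < d" for l
    using node_bounds[OF that] by (simp_all add: N_at_ends)
  have "continuous_on {0..1} (\<lambda>t. (\<Sum>l<d. u l * of_real (N (node l) t)) / \<mu>)"
  proof (intro continuous_intros N_continuous)
    fix l assume "l \<in> {..<d}"
    then show "- int k \<le> node l" "node l < int n" using node_bounds[of l] by auto
  qed (use assms(1) in auto)
  then have "continuous_on {0..1} f" by (rule continuous_on_eq) (simp add: f_def)
  moreover have "f 0 = 0" "f 1 = 0" by (simp_all add: f_def ends)
  then have "S f t = \<mu> * f t" for t
    using S_zero_ends[of f t] S_outside[of t f] assms(1) ft by (cases "t \<in> {0..1}") (auto simp: f_def)
  ultimately have "f \<in> eigenspace S \<mu>" by (auto simp: eigenspace_def C01_def f_def)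
  then show ?thesis using that ft by blast
qed

lemma eigenspace_affine: "(\<lambda>t. if t \<in> {0..1} then a + c * of_real t else 0) \<in> eigenspace S 1"
proof -
  define f where "f t = (if t \<in> {0..1} then a + c * of_real t else 0)" for t :: real
  have "continuous_on {0..1} (\<lambda>t. a + c * of_real t)" by (intro continuous_intros)
  then have "continuous_on {0..1} f" by (rule continuous_on_eq) (simp add: f_def)
  moreover have "S f t = f t" for t
  proof (cases "t \<in> {0..1}")
    case True
    then have t: "0 \<le> t" "t \<le> 1" by auto
    have "S f t = (\<Sum>j=- int k..int n - 1. a * of_real (N j t) + c * of_real (\<xi> j * N j t))"
      unfolding S_inside[OF t] using greville_range by (intro sum.cong) (auto simp: f_def algebra_simps)
    also have "\<dots> = a * of_real (\<Sum>j=- int k..int n - 1. N j t) + c * of_real (\<Sum>j=- int k..int n - 1. \<xi> j * N j t)"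
      by (simp only: sum.distrib of_real_sum sum_distrib_left)
    also have "\<dots> = f t" using True by (simp add: N_partition[OF t] N_linear[OF t] f_def)
    finally show ?thesis .
  qed (auto simp: S_outside f_def)
  ultimately have "f \<in> eigenspace S 1" by (auto simp: eigenspace_def C01_def f_def)
  then show ?thesis unfolding f_def .
qed

text \<open>Subtracting the affine interpolant at 0 and 1 leaves an eigenfunction with zero end
  values, whose interior node values would form an eigenvector of the collocation matrix unless they
  vanish.\<close>

lemma eigenspace_one:
  assumes "f \<in> eigenspace S (1 :: 'a::real_normed_field)" "\<not> interior_eigenvalue (1 :: 'a)"
  shows "f = (\<lambda>t. if t \<in> {0..1} then f 0 + (f 1 - f 0) * of_real t else 0)"
proof -
  define h where "h = (\<lambda>t. if t \<in> {0..1} then f 0 + (f 1 - f 0) * of_real t else 0)"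
  define g where "g t = f t - 1 * h t" for t
  have g: "g \<in> eigenspace S 1"
    unfolding g_def h_def by (rule eigenspace_diff[OF assms(1) eigenspace_affine])
  have g01: "g 0 = 0" "g 1 = 0" by (simp_all add: g_def h_def)
  have "g (\<tau> i) = 0" if "i < d" for i
  proof (rule ccontr)
    assume "g (\<tau> i) \<noteq> 0"
    then have "interior_eigenvalue (1 :: 'a)"
      unfolding interior_eigenvalue_def using that eigenspace_interior[OF g g01]
      by (intro exI[of _ "\<lambda>i. g (\<tau> i)"]) auto
    then show False using assms(2) by simp
  qed
  then have "g = (\<lambda>_. 0)" by (intro eigenspace_eq_zero[OF g _ g01]) auto
  then have "f t = h t" for t by (simp add: g_def fun_eq_iff)
  then show ?thesis unfolding h_def[symmetric] by blast
qed

text \<open>A nonzero polynomial vanishing at all Greville nodes is a witness.\<close>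

lemma eigenspace_kernel: "\<exists>f \<in> eigenspace S (0 :: 'a::real_normed_field). f \<noteq> (\<lambda>_. 0)"
proof -
  define f :: "real \<Rightarrow> 'a" where
    "f t = (if t \<in> {0..1} then \<Prod>j=- int k..int n - 1. of_real (t - \<xi> j) else 0)" for t
  have "continuous_on {0..1} (\<lambda>t. \<Prod>j=- int k..int n - 1. of_real (t - \<xi> j) :: 'a)"
    by (intro continuous_intros)
  then have "continuous_on {0..1} f" by (rule continuous_on_eq) (simp add: f_def)
  moreover have "f (\<xi> j) = 0" if "- int k \<le> j" "j < int n" for j
    using that by (auto simp: f_def intro!: bexI[of _ j])
  then have "S f t = 0" for t
    using S_inside[of t f] S_outside[of t f] by (cases "t \<in> {0..1}") auto
  ultimately have "f \<in> eigenspace S 0" by (auto simp: eigenspace_def C01_def f_def)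
  moreover have "f \<noteq> (\<lambda>_. 0)"
  proof
    assume f0: "f = (\<lambda>_. 0)"
    have "infinite {0..1::real}" by (simp add: infinite_Icc_iff)
    then have "infinite ({0..1} - \<xi> ` {- int k..int n - 1})" by (intro Diff_infinite_finite) auto
    then obtain t where t: "t \<in> {0..1}" "t \<notin> \<xi> ` {- int k..int n - 1}"
      using infinite_imp_nonempty by blast
    then have "f t \<noteq> 0" by (auto simp: f_def)
    then show False using f0 by simp
  qed
  ultimately show ?thesis by blast
qed

lemma eigenvalues_eq: "eigenvalues S = {0, 1 :: 'a::real_normed_field} \<union> {\<mu>. interior_eigenvalue \<mu>}"
proof (intro equalityI subsetI)
  fix \<mu> :: 'a assume "\<mu> \<in> eigenvalues S"
  then obtain f where f: "f \<in> eigenspace S \<mu>" "f \<noteq> (\<lambda>_. 0)" by (auto simp: eigenvalues_def)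
  show "\<mu> \<in> {0, 1} \<union> {\<mu>. interior_eigenvalue \<mu>}"
  proof (cases "\<mu> = 0 \<or> \<mu> = 1")
    case False
    then have e: "f 0 = 0" "f 1 = 0" using eigenspace_zero_ends[OF f(1)] by auto
    then obtain i where "i < d" "f (\<tau> i) \<noteq> 0" using eigenspace_eq_zero[OF f(1)] f(2) False by blast
    then have "interior_eigenvalue \<mu>"
      unfolding interior_eigenvalue_def using eigenspace_interior[OF f(1) e]
      by (intro exI[of _ "\<lambda>i. f (\<tau> i)"]) auto
    then show ?thesis by simp
  qed auto
next
  fix \<mu> :: 'a assume mu: "\<mu> \<in> {0, 1} \<union> {\<mu>. interior_eigenvalue \<mu>}"
  consider "\<mu> = 0" | "\<mu> = 1" | "\<mu> \<noteq> 0" "interior_eigenvalue \<mu>" using mu by auto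
  then show "\<mu> \<in> eigenvalues S"
  proof cases
    case 1
    then show ?thesis using eigenspace_kernel by (auto simp: eigenvalues_def)
  next
    case 2
    have "(\<lambda>t. if t \<in> {0..1} then 1 + 0 * of_real t else 0) \<noteq> (\<lambda>_::real. 0 :: 'a)"
      by (auto simp: fun_eq_iff intro!: exI[of _ 0])
    then show ?thesis using 2 eigenspace_affine[of 1 "0 :: 'a"] unfolding eigenvalues_def by blast
  next
    case 3
    then obtain u i where u: "i < d" "u i \<noteq> 0" "\<And>i. i < d \<Longrightarrow> (\<Sum>l<d. of_real (coll i l) * u l) = \<mu> * u i"
      by (auto simp: interior_eigenvalue_def)
    obtain f where "f \<in> eigenspace S \<mu>" "\<And>i. i < d \<Longrightarrow> f (\<tau> i) = u i"
      using eigenspace_extend[OF 3(1) u(3)] by blast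
    moreover from this u have "f \<noteq> (\<lambda>_. 0)" by auto
    ultimately show ?thesis unfolding eigenvalues_def by blast
  qed
qed

section \<open>Dimensions of the eigenspaces\<close>

lemma dim_eigenspace_one:
  assumes "\<not> interior_eigenvalue (1 :: real)"
  shows "fun_space.dim (eigenspace S (1 :: real)) = 2"
proof -
  define e where "e = (\<lambda>a c t :: real. if t \<in> {0..1} then a + c * t else (0::real))"
  have e: "e a c \<in> eigenspace S 1" for a c
    using eigenspace_affine[of a c] by (simp only: e_def of_real_eq_id id_def)
  have ne: "e 1 0 \<noteq> e 0 1" by (auto simp: e_def fun_eq_iff intro!: exI[of _ 0])
  show ?thesis
  proof (rule fun_space.dim_unique[of "{e 1 0, e 0 1}"])
    show "{e 1 0, e 0 1} \<subseteq> eigenspace S 1" using e by simp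
    show "eigenspace S 1 \<subseteq> fun_space.span {e 1 0, e 0 1}"
    proof
      fix f assume f: "f \<in> eigenspace S (1::real)"
      have "f = (\<lambda>t. f 0 * e 1 0 t) + (\<lambda>t. (f 1 - f 0) * e 0 1 t)"
        by (subst eigenspace_one[OF f assms]) (auto simp: e_def fun_eq_iff)
      also have "\<dots> \<in> fun_space.span {e 1 0, e 0 1}"
        by (intro fun_space.span_add fun_space.span_scale fun_space.span_base) auto
      finally show "f \<in> fun_space.span {e 1 0, e 0 1}" .
    qed
    show "\<not> fun_space.dependent {e 1 0, e 0 1}"
    proof (rule fun_space.independent_insertI)
      show "\<not> fun_space.dependent {e 0 1}"
        by (auto simp: fun_space.dependent_single e_def fun_eq_iff intro!: exI[of _ 1])
      show "e 1 0 \<notin> fun_space.span {e 0 1}"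
      proof
        assume "e 1 0 \<in> fun_space.span {e 0 1}"
        then obtain c where "e 1 0 = (\<lambda>t. c * e 0 1 t)" by (auto simp: fun_space.span_singleton)
        then have "e 1 0 0 = c * e 0 1 0" by (rule fun_cong)
        then show False by (simp add: e_def)
      qed
    qed
    show "card {e 1 0, e 0 1} = 2" using ne by simp
  qed
qed

text \<open>A nonzero eigenfunction does not vanish at the first interior node, so a combination of
  two eigenfunctions that cancels there is zero.\<close>

lemma dim_eigenspace_simple:
  assumes osc: "oscillating d coll" and "interior_eigenvalue (\<mu> :: real)" "\<mu> \<noteq> 0" "\<mu> \<noteq> 1"
  shows "fun_space.dim (eigenspace S \<mu>) = 1"
proof -
  obtain u i where u: "i < d" "u i \<noteq> 0" "\<And>i. i < d \<Longrightarrow> (\<Sum>l<d. of_real (coll i l) * u l) = \<mu> * u i"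
    using assms(2) by (auto simp: interior_eigenvalue_def)
  obtain f where f: "f \<in> eigenspace S \<mu>" "\<And>i. i < d \<Longrightarrow> f (\<tau> i) = u i"
    using eigenspace_extend[OF assms(3) u(3)] by blast
  have first: "g (\<tau> 0) \<noteq> 0" if g: "g \<in> eigenspace S \<mu>" "g \<noteq> (\<lambda>_. 0)" for g
  proof -
    note g01 = eigenspace_zero_ends[OF g(1) assms(4)]
    obtain j where j: "j < d" "g (\<tau> j) \<noteq> 0" using eigenspace_eq_zero[OF g(1) assms(3) g01] g(2) by blast
    show ?thesis
      by (rule oscillating_eigenvector_first[OF osc, of "\<lambda>i. g (\<tau> i)" \<mu> j])
         (use eigenspace_interior[OF g(1) g01] j in \<open>auto simp: lin_def\<close>)
  qed
  have fnz: "f \<noteq> (\<lambda>_. 0)" using u f by auto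
  show ?thesis
  proof (rule fun_space.dim_unique[of "{f}"])
    show "eigenspace S \<mu> \<subseteq> fun_space.span {f}"
    proof
      fix g assume g: "g \<in> eigenspace S \<mu>"
      define c where "c = g (\<tau> 0) / f (\<tau> 0)"
      have "g (\<tau> 0) - c * f (\<tau> 0) = 0" using first[OF f(1) fnz] by (simp add: c_def)
      then have "(\<lambda>t. g t - c * f t) = (\<lambda>_. 0)"
        using first[OF eigenspace_diff[OF g f(1), of c]] by blast
      then have "g = (\<lambda>t. c * f t)" by (simp add: fun_eq_iff)
      then show "g \<in> fun_space.span {f}" by (auto simp: fun_space.span_singleton)
    qed
    show "\<not> fun_space.dependent {f}" using fnz by (simp add: fun_space.dependent_single zero_fun_def)
  qed (use f in auto)
qed

lemma dim_eigenspace_trivial: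
  assumes "\<mu> \<notin> eigenvalues S"
  shows "fun_space.dim (eigenspace S (\<mu> :: real)) = 0"
proof -
  have "eigenspace S \<mu> \<subseteq> {0}" using assms by (auto simp: eigenvalues_def zero_fun_def)
  then show ?thesis using fun_space.dim_le_card[of "eigenspace S \<mu>" "{}"] by simp
qed

lemma spectrum:
  assumes nk: "k = 1 \<longrightarrow> n = 1"
  obtains rs where "length rs = d" "sorted_wrt (>) rs" "\<And>r. r \<in> set rs \<Longrightarrow> 0 < r \<and> r < 1"
    "eigenvalues S = {0, 1 :: real} \<union> set rs"
    "eigenvalues S = {0, 1 :: complex} \<union> complex_of_real ` set rs"
    "\<And>\<mu>. \<mu> \<noteq> 0 \<Longrightarrow> fun_space.dim (eigenspace S \<mu>) =
        (if \<mu> = 1 then 2 else if \<mu> \<in> set rs then 1 else 0)"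
proof -
  note osc = coll_oscillating[OF nk]
  obtain rs where rs: "length rs = d" "distinct rs"
    "char_poly (Matrix.mat d d (\<lambda>(i, j). coll i j)) = (\<Prod>r\<leftarrow>rs. [:- r, 1:])"
    using oscillating_spectrum[OF osc] .
  have ir: "interior_eigenvalue (\<mu> :: real) \<longleftrightarrow> \<mu> \<in> set rs" for \<mu>
    using char_poly_root_iff[of d coll \<mu>] unfolding rs(3)
    by (auto simp: interior_eigenvalue_def poly_prod_list prod_list_zero_iff)
  have ic: "interior_eigenvalue (\<mu> :: complex) \<longleftrightarrow> \<mu> \<in> complex_of_real ` set rs" for \<mu>
    using char_poly_root_iff[of d "\<lambda>i j. complex_of_real (coll i j)" \<mu>] 
      char_poly_complex_roots[OF rs(3), of \<mu>] by (simp add: interior_eigenvalue_def)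
  have range: "0 < r \<and> r < 1" if "r \<in> set rs" for r
  proof -
    have "interior_eigenvalue r" using that ir by blast
    then obtain u i where "i < d" "u i \<noteq> 0" "\<And>i. i < d \<Longrightarrow> (\<Sum>l<d. coll i l * u l) = r * u i"
      by (auto simp: interior_eigenvalue_def)
    then show ?thesis
      using oscillating_eigenvalue_pos[OF osc(1), of u r i] coll_eigenvalue_less_one[OF nk, of u r i]
      by (auto simp: lin_def)
  qed
  define L where "L = rev (sort rs)"
  have set: "set L = set rs" by (simp add: L_def)
  have "sorted_wrt (<) (sort rs)" using rs(2) by (simp add: strict_sorted_iff)
  then have sorted: "sorted_wrt (>) L" by (simp add: L_def sorted_wrt_rev)
  have dim: "fun_space.dim (eigenspace S \<mu>) = (if \<mu> = 1 then 2 else if \<mu> \<in> set L then 1 else 0)"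
    if "\<mu> \<noteq> 0" for \<mu> :: real
    using dim_eigenspace_one dim_eigenspace_simple[OF osc(1)] dim_eigenspace_trivial[of \<mu>] that
      ir[of \<mu>] ir[of 1] range[of 1] by (auto simp: set eigenvalues_eq)
  show ?thesis
    by (rule that[of L]) (use rs sorted range dim in \<open>auto simp: set eigenvalues_eq ir ic L_def\<close>)
qed

end

text \<open>Multiplicity is expressed by eigenspace dimensions for nonzero values only, because the
  kernel contains every continuous function vanishing at the Greville nodes.\<close>

theorem theorem4:
  fixes n k :: nat and x :: "int \<Rightarrow> real"
  assumes "n > 0" and "k > 0"
    and "k = 1 \<longrightarrow> n = 1"
    and "knot_sequence n k x"
  defines "S \<equiv> (schoenberg n k x :: (real \<Rightarrow> real) \<Rightarrow> real \<Rightarrow> real)"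
    and "S\<^sub>c \<equiv> (schoenberg n k x :: (real \<Rightarrow> complex) \<Rightarrow> real \<Rightarrow> complex)"
  shows "(\<exists>ev :: nat \<Rightarrow> real.
            1 = ev 0 \<and> ev 0 = ev 1 \<and>
            (\<forall>i. 1 \<le> i \<and> i < n + k \<longrightarrow> ev i > ev (i + 1)) \<and>
            ev (n + k) = 0 \<and>
            eigenvalues S = ev ` {0..n + k} \<and>
            eigenvalues S\<^sub>c = complex_of_real ` ev ` {0..n + k} \<and>
            (\<forall>\<mu>. \<mu> \<noteq> 0 \<longrightarrow>
               fun_space.dim (eigenspace S \<mu>) = card {i \<in> {0..n + k}. ev i = \<mu>})) \<and>
         card {\<mu> \<in> eigenvalues S. \<mu> > 0} = n + k - 1"
proof -
  interpret schoenberg_knots n k x by unfold_locales (use assms in auto)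
  obtain rs where rs: "length rs = d" "sorted_wrt (>) rs" "\<And>r. r \<in> set rs \<Longrightarrow> 0 < r \<and> r < 1"
    and eig: "eigenvalues S = {0, 1 :: real} \<union> set rs"
      "eigenvalues S\<^sub>c = {0, 1 :: complex} \<union> complex_of_real ` set rs"
    and dim: "\<And>\<mu>. \<mu> \<noteq> 0 \<Longrightarrow> fun_space.dim (eigenspace S \<mu>) =
        (if \<mu> = 1 then 2 else if \<mu> \<in> set rs then 1 else 0)"
    using spectrum[OF assms(3)] unfolding S_def S\<^sub>c_def by blast
  have nk: "n + k = d + 2" using assms(1,2) by (simp add: d_def)
  \<comment> \<open>Positions 0 and 1 hold the double eigenvalue 1, so the interior list is shifted
    by 2; position \<open>d + 2 = n + k\<close> holds 0.\<close>
  define ev where "ev i = (if i \<le> 1 then 1 else if i < d + 2 then rs ! (i - 2) else 0)" for i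
  have desc: "ev i > ev (i + 1)" if "1 \<le> i" "i < d + 2" for i
  proof -
    have nth: "0 < rs ! j \<and> rs ! j < 1" if "j < d" for j using rs(1,3) that by simp
    show ?thesis
    proof (cases "i = 1")
      case True
      then show ?thesis using nth[of 0] by (auto simp: ev_def)
    next
      case False
      define j where "j = i - 2"
      have j: "i = j + 2" using False \<open>1 \<le> i\<close> by (simp add: j_def)
      show ?thesis
        using that nth[of j] sorted_wrt_nth_less[OF rs(2), of j "Suc j"] rs(1) by (auto simp: ev_def j)
    qed
  qed
  have split: "{0..d + 2} = {0, 1} \<union> (\<lambda>j. j + 2) ` {..<d} \<union> {d + 2}"
  proof (intro equalityI subsetI)
    fix i assume "i \<in> {0..d + 2}"
    then consider "i = 0 \<or> i = 1 \<or> i = d + 2" | "i - 2 < d" "i = (i - 2) + 2" by fastforce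
    then show "i \<in> {0, 1} \<union> (\<lambda>j. j + 2) ` {..<d} \<union> {d + 2}" by cases blast+
  qed auto
  have "ev ` (\<lambda>j. j + 2) ` {..<d} = (\<lambda>j. rs ! j) ` {..<d}"
    unfolding image_image by (intro image_cong) (auto simp: ev_def)
  also have "\<dots> = set rs" using rs(1) by (auto simp: set_conv_nth)
  finally have img: "ev ` {0..n + k} = {0, 1} \<union> set rs"
    unfolding nk split image_Un by (auto simp: ev_def)
  have "sorted_wrt (<) (rev rs)" using rs(2) by (simp add: sorted_wrt_rev)
  then have dist: "distinct rs" using strict_sorted_iff distinct_rev by blast
  have card: "card {i \<in> {0..n + k}. ev i = \<mu>} = (if \<mu> = 1 then 2 else if \<mu> \<in> set rs then 1 else 0)"
    if "\<mu> \<noteq> 0" for \<mu>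
  proof -
    have ge2: "ev i = rs ! (i - 2)" if "i \<in> (\<lambda>j. j + 2) ` {..<d}" for i using that by (auto simp: ev_def)
    consider "\<mu> = 1" | "\<mu> \<noteq> 1" "\<mu> \<in> set rs" | "\<mu> \<noteq> 1" "\<mu> \<notin> set rs" by blast
    then show ?thesis
    proof cases
      case 1
      have "rs ! j \<noteq> 1" if "j < d" for j using rs(3)[of "rs ! j"] nth_mem[of j rs] rs(1) that by auto
      then have "{i \<in> {0..n + k}. ev i = \<mu>} = {0, 1}"
        unfolding nk split using 1 by (auto simp: ev_def)
      then show ?thesis using 1 by simp
    next
      case 2
      then obtain j where j: "j < d" "rs ! j = \<mu>" using rs(1) by (auto simp: in_set_conv_nth)
      have "{i \<in> {0..n + k}. ev i = \<mu>} = {j + 2}"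
      proof (intro equalityI subsetI)
        fix i assume "i \<in> {i \<in> {0..n + k}. ev i = \<mu>}"
        then have i: "2 \<le> i" "i < d + 2" "ev i = \<mu>"
          using 2 \<open>\<mu> \<noteq> 0\<close> by (auto simp: ev_def nk split: if_splits)
        then have "rs ! (i - 2) = \<mu>" "i - 2 < d" by (auto simp: ev_def)
        then have "i - 2 = j" using nth_eq_iff_index_eq[OF dist, of "i - 2" j] j rs(1) by simp
        then show "i \<in> {j + 2}" using i by simp
      qed (use j in \<open>auto simp: ev_def nk\<close>)
      then show ?thesis using 2 by simp
    next
      case 3
      have "ev i \<noteq> \<mu>" if "i \<in> {0..n + k}" for i using img that 3 \<open>\<mu> \<noteq> 0\<close> by blast
      then have "{i \<in> {0..n + k}. ev i = \<mu>} = {}" by blast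
      then show ?thesis using 3 by simp
    qed
  qed
  have "{\<mu> \<in> eigenvalues S. \<mu> > 0} = insert 1 (set rs)" using eig(1) rs(3) by auto
  moreover have "1 \<notin> set rs" using rs(3) by blast
  ultimately have "card {\<mu> \<in> eigenvalues S. \<mu> > 0} = n + k - 1"
    using distinct_card[OF dist] rs(1) nk by simp
  moreover have "eigenvalues S\<^sub>c = complex_of_real ` ev ` {0..n + k}" unfolding img eig(2) by auto
  moreover have "1 = ev 0" "ev 0 = ev 1" "ev (n + k) = 0" by (simp_all add: ev_def nk)
  moreover have "\<forall>i. 1 \<le> i \<and> i < n + k \<longrightarrow> ev i > ev (i + 1)" using desc nk by simp
  moreover have "eigenvalues S = ev ` {0..n + k}" unfolding img by (rule eig(1))
  moreover have "\<forall>\<mu>. \<mu> \<noteq> 0 \<longrightarrow>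
      fun_space.dim (eigenspace S \<mu>) = card {i \<in> {0..n + k}. ev i = \<mu>}" using dim card by simp
  ultimately show ?thesis by blast
qed

end
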